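(* For a positive integer $n$, let $\mathcal{Q}_{\mathrm{GAQ}}(n)$ be the set of quandle isomorphism classes of generalized Alexander quandles $Q(G,\psi)$, where $G$ ranges over all groups of order $n$ and $\psi$ over all group automorphisms of $G$. Then for $n=1,2,3,4,5,6,7,8,9,10,11,12,13,14,15$ the cardinality $|\mathcal{Q}_{\mathrm{GAQ}}(n)|$ equals, respectively, $1,1,2,3,4,3,6,9,11,5,10,11,12,7,8$.
   Context: For a finite group $G$ and a group automorphism $\psi$, the generalized Alexander quandle $Q(G,\psi)$ is the set $G$ equipped with the maps $s_x:G\to G$, $s_x(y)=x\psi(x^{-1}y)$, for $x\in G$. A quandle isomorphism from $(Q,s)$ to $(Q',s')$ is a bijection $f:Q\to Q'$ with $f\circ s_x=s'_{f(x)}\circ f$ for all $x\in Q$ (the underlying groups of the two quandles may be different). *)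

theory Defs
  imports "HOL-Algebra.Coset"
begin

text \<open>A quandle \<open>(Q, s)\<close> is encoded as its carrier set together with the family of maps
  \<open>s x = s\<^sub>x\<close>; the values of \<open>s\<close> outside the carrier are irrelevant.\<close>

type_synonym 'a quandle = "'a set \<times> ('a \<Rightarrow> 'a \<Rightarrow> 'a)"

definition gen_alexander :: "('a, 'm) monoid_scheme \<Rightarrow> ('a \<Rightarrow> 'a) \<Rightarrow> 'a quandle" where
  "gen_alexander G \<psi> =
     (carrier G, \<lambda>x y. x \<otimes>\<^bsub>G\<^esub> \<psi> (inv\<^bsub>G\<^esub> x \<otimes>\<^bsub>G\<^esub> y))"

definition quandle_iso :: "'a quandle \<Rightarrow> 'b quandle \<Rightarrow> ('a \<Rightarrow> 'b) set" where
  "quandle_iso X Y = {f. bij_betw f (fst X) (fst Y) \<and>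
     (\<forall>x\<in>fst X. \<forall>y\<in>fst X. f (snd X x y) = snd Y (f x) (f y))}"

definition quandle_isomorphic :: "'a quandle \<Rightarrow> 'b quandle \<Rightarrow> bool" where
  "quandle_isomorphic X Y \<longleftrightarrow> quandle_iso X Y \<noteq> {}"

text \<open>To obtain a set, the underlying groups are taken on arbitrary subsets of \<^typ>\<open>nat\<close>.
  By \<open>gen_alexander_transfer\<close> below this loses no isomorphism class: every generalized
  Alexander quandle of order \<open>n\<close>, over any type, is isomorphic to a member of \<open>GAQ n\<close>.
  (The finiteness condition only matters for \<open>n = 0\<close>, as \<^const>\<open>card\<close> is \<open>0\<close> on infinite sets.)\<close>

definition GAQ :: "nat \<Rightarrow> nat quandle set" where
  "GAQ n = {gen_alexander G \<psi> | (G :: nat monoid) \<psi>.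
     group G \<and> finite (carrier G) \<and> order G = n \<and> \<psi> \<in> iso G G}"

definition GAQ_rel :: "nat \<Rightarrow> nat quandle rel" where
  "GAQ_rel n = {(X, Y). X \<in> GAQ n \<and> Y \<in> GAQ n \<and> quandle_isomorphic X Y}"

definition GAQ_classes :: "nat \<Rightarrow> nat quandle set set" where
  "GAQ_classes n = GAQ n // GAQ_rel n"

lemma gen_alexander_closed:
  assumes "group G" "\<psi> \<in> iso G G" "x \<in> carrier G" "y \<in> carrier G"
  shows "snd (gen_alexander G \<psi>) x y \<in> carrier G"
proof -
  interpret group G by fact
  have "\<psi> \<in> carrier G \<rightarrow> carrier G" using assms(2) by (auto simp: iso_def hom_def)
  then show ?thesis using assms(3,4) by (auto simp: gen_alexander_def)
qed

lemma GAQ_closed: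
  assumes "X \<in> GAQ n" "x \<in> fst X" "y \<in> fst X"
  shows "snd X x y \<in> fst X"
proof -
  obtain G :: "nat monoid" and \<psi> where
    "X = gen_alexander G \<psi>" "group G" "\<psi> \<in> iso G G"
    using assms(1) by (auto simp: GAQ_def)
  then show ?thesis using assms(2,3) gen_alexander_closed[of G \<psi> x y]
    by (auto simp: gen_alexander_def)
qed

lemma quandle_isomorphic_refl: "quandle_isomorphic X X"
proof -
  have "(\<lambda>x. x) \<in> quandle_iso X X" by (auto simp: quandle_iso_def bij_betw_def)
  then show ?thesis by (auto simp: quandle_isomorphic_def)
qed

lemma quandle_isomorphic_trans:
  assumes "quandle_isomorphic X Y" "quandle_isomorphic Y Z"
  shows "quandle_isomorphic X Z"
proof -
  obtain f g where f: "f \<in> quandle_iso X Y" and g: "g \<in> quandle_iso Y Z"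
    using assms by (auto simp: quandle_isomorphic_def)
  have "f x \<in> fst Y" if "x \<in> fst X" for x
    using f that by (auto simp: quandle_iso_def bij_betw_def)
  with f g have "g \<circ> f \<in> quandle_iso X Z"
    by (auto simp: quandle_iso_def intro: bij_betw_trans)
  then show ?thesis by (auto simp: quandle_isomorphic_def)
qed

lemma quandle_isomorphic_sym:
  assumes "quandle_isomorphic X Y"
    and closed: "\<And>x y. x \<in> fst X \<Longrightarrow> y \<in> fst X \<Longrightarrow> snd X x y \<in> fst X"
  shows "quandle_isomorphic Y X"
proof -
  obtain f where f: "f \<in> quandle_iso X Y"
    using assms by (auto simp: quandle_isomorphic_def)
  then have bij: "bij_betw f (fst X) (fst Y)" by (auto simp: quandle_iso_def)
  let ?g = "inv_into (fst X) f"
  have g: "bij_betw ?g (fst Y) (fst X)" using bij by (rule bij_betw_inv_into)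
  have "?g (snd Y u v) = snd X (?g u) (?g v)" if "u \<in> fst Y" "v \<in> fst Y" for u v
  proof -
    have in_X: "?g u \<in> fst X" "?g v \<in> fst X" using g that by (auto simp: bij_betw_def)
    have "snd Y u v = snd Y (f (?g u)) (f (?g v))"
      using bij that by (simp add: bij_betw_inv_into_right)
    also have "\<dots> = f (snd X (?g u) (?g v))" using f in_X by (auto simp: quandle_iso_def)
    finally show ?thesis
      using bij closed[OF in_X] by (simp add: bij_betw_inv_into_left)
  qed
  with g have "?g \<in> quandle_iso Y X" by (auto simp: quandle_iso_def)
  then show ?thesis by (auto simp: quandle_isomorphic_def)
qed

lemma equiv_GAQ_rel: "equiv (GAQ n) (GAQ_rel n)"
proof (rule equivI)
  show "GAQ_rel n \<subseteq> GAQ n \<times> GAQ n" by (auto simp: GAQ_rel_def)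
  show "refl_on (GAQ n) (GAQ_rel n)"
    by (auto simp: refl_on_def GAQ_rel_def quandle_isomorphic_refl)
  show "sym (GAQ_rel n)"
    by (auto simp: sym_def GAQ_rel_def intro: quandle_isomorphic_sym GAQ_closed)
  show "trans (GAQ_rel n)"
    unfolding trans_def GAQ_rel_def using quandle_isomorphic_trans by blast
qed

lemma gen_alexander_transfer:
  fixes G :: "('b, 'm) monoid_scheme" (structure)
  assumes "group G" "finite (carrier G)" "\<psi> \<in> iso G G"
  shows "\<exists>X\<in>GAQ (order G). quandle_isomorphic (gen_alexander G \<psi>) X"
proof -
  interpret group G by fact
  obtain h :: "'b \<Rightarrow> nat" where h: "inj_on h (carrier G)"
    using finite_imp_inj_to_nat_seg[OF assms(2)] by blast
  let ?k = "inv_into (carrier G) h"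
  define H :: "nat monoid" where
    "H = \<lparr>carrier = h ` carrier G, mult = \<lambda>a b. h (?k a \<otimes> ?k b), one = h \<one>\<rparr>"
  define \<phi> where "\<phi> = (\<lambda>a. h (\<psi> (?k a)))"
  have kh [simp]: "?k (h x) = x" if "x \<in> carrier G" for x
    using h that by simp
  have \<psi>: "bij_betw \<psi> (carrier G) (carrier G)"
    and \<psi>_mult: "\<And>x y. x \<in> carrier G \<Longrightarrow> y \<in> carrier G \<Longrightarrow> \<psi> (x \<otimes> y) = \<psi> x \<otimes> \<psi> y"
    using assms(3) by (auto simp: iso_def hom_def)
  have \<psi>_closed [simp]: "\<psi> x \<in> carrier G" if "x \<in> carrier G" for x
    using \<psi> that by (auto simp: bij_betw_def)
  have H: "group H"
  proof (rule groupI)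
    fix a assume "a \<in> carrier H"
    then obtain x where x: "x \<in> carrier G" "a = h x" by (auto simp: H_def)
    then have "h (inv x) \<in> carrier H" "h (inv x) \<otimes>\<^bsub>H\<^esub> a = \<one>\<^bsub>H\<^esub>" by (auto simp: H_def)
    then show "\<exists>b\<in>carrier H. b \<otimes>\<^bsub>H\<^esub> a = \<one>\<^bsub>H\<^esub>" by blast
  qed (auto simp: H_def m_assoc)
  have hom: "h \<in> hom G H" by (auto simp: hom_def H_def)
  have inv_h: "inv\<^bsub>H\<^esub> (h x) = h (inv x)" if "x \<in> carrier G" for x
    using that H hom by (metis group_hom.hom_inv group_hom.intro group_hom_axioms.intro is_group)
  have bij_h: "bij_betw h (carrier G) (carrier H)" using h by (auto simp: bij_betw_def H_def)
  have "bij_betw (h \<circ> (\<psi> \<circ> ?k)) (carrier H) (carrier H)"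
    by (rule bij_betw_trans[OF bij_betw_trans[OF bij_betw_inv_into[OF bij_h] \<psi>] bij_h])
  then have "bij_betw \<phi> (carrier H) (carrier H)" by (simp add: \<phi>_def comp_def)
  then have "\<phi> \<in> iso H H" by (auto simp: iso_def hom_def H_def \<phi>_def \<psi>_mult)
  moreover have "finite (carrier H)" using assms(2) by (simp add: H_def)
  moreover have "order H = order G"
    using bij_betw_same_card[OF bij_h] by (simp add: order_def)
  ultimately have "gen_alexander H \<phi> \<in> GAQ (order G)" using H by (auto simp: GAQ_def)
  moreover have "h \<in> quandle_iso (gen_alexander G \<psi>) (gen_alexander H \<phi>)"
    using bij_h inv_h by (auto simp: quandle_iso_def gen_alexander_def) (simp_all add: H_def \<phi>_def)
  ultimately show ?thesis by (auto simp: quandle_isomorphic_def)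
qed

end

theory Submission
  imports Defs "HOL-Algebra.Sylow" "HOL-Algebra.Multiplicative_Group"
begin

text \<open>A generalized Alexander quandle remembers only part of its group. Put
  \<open>\<delta> x = x \<otimes> inv (\<psi> x)\<close>, so that \<open>s\<^sub>x y = \<delta> x \<otimes> \<psi> y\<close>, and let \<open>D = \<delta> ` carrier G\<close> be the set of
  \<^emph>\<open>displacements\<close>. The fibres of \<open>\<delta>\<close> are the left cosets of the subgroup of fixed points of
  \<open>\<psi>\<close>, hence \<open>card D * card fixed = order G\<close>.

  \<^emph>\<open>When are two quandles isomorphic?\<close> Let \<open>K\<close> be a subgroup containing \<open>D\<close>, and let \<open>h\<close> embed \<open>K\<close>
  into a second group \<open>G'\<close> of the same order, intertwining the automorphisms and mapping \<open>D\<close> onto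
  \<open>D'\<close>. A bijection \<open>f\<close> with \<open>f (k \<otimes> x) = h k \<otimes> f x\<close> and \<open>\<delta>' (f x) = h (\<delta> x)\<close> is then an isomorphism
  of quandles, because \<open>\<psi> y = inv (\<delta> y) \<otimes> y\<close>. It can be built greedily, one coset of \<open>K\<close> at a time:
  the image of a new point has to be sought in a fibre of \<open>\<delta>'\<close>, and all fibres of \<open>\<delta>\<close> and \<open>\<delta>'\<close> have
  the same size (\<open>partial_extend\<close>). So the class of the quandle is determined by the order of the
  group and a \<^emph>\<open>model\<close>: a group \<open>H\<close> with an endomorphism \<open>\<theta>\<close> and a subset \<open>E\<close>, embedded into \<open>G\<close>
  compatibly with \<open>\<psi>\<close> such that \<open>E\<close> becomes \<open>D\<close> (\<open>realizes_same_model\<close>).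

  \<^emph>\<open>When are they different?\<close> Left translations are quandle automorphisms, so an isomorphism may be
  assumed to preserve the identity. Then it commutes with the automorphisms, maps \<open>D\<close> onto \<open>D'\<close> and
  satisfies \<open>f (d \<otimes> x) = f d \<otimes> f x\<close> for \<open>d \<in> D\<close>. Hence the number of \<open>u \<in> D\<close> that solve a given
  equation between products of the elements \<open>u\<close>, \<open>\<psi> u\<close>, \<open>\<psi> (\<psi> u)\<close>, \<open>\<dots>\<close> is an invariant, and it can
  be computed in the model (\<open>isomorphic_solutions\<close>, \<open>realizes_solutions\<close>).

  So for each order \<open>n\<close> one needs a list of models with different solution counts, all of which occur
  in groups of order \<open>n\<close>, and the proof that every automorphism of a group of order \<open>n\<close> realizes one
  of them (\<open>card_classes\<close>). That proof goes by the number of displacements, a divisor of \<open>n\<close>. If it is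
  small, the relations \<open>x \<otimes> d \<otimes> inv (\<psi> x) \<in> D\<close> for \<open>d \<in> D\<close> nearly determine the model; if \<open>D\<close> is the
  whole group, \<open>\<psi>\<close> has no nontrivial fixed points, which leaves few groups. For a prime and for
  15 the group is cyclic, \<open>\<psi>\<close> is multiplication by a unit, and different units give different
  quandles. For twice an odd prime \<open>p\<close> the displacements lie in the subgroup of order \<open>p\<close>. The orders
  8, 9 and 12 take most of the work.\<close>

section \<open>Displacements of a group automorphism\<close>

text \<open>In a group, \<open>d \<otimes> \<psi> x = x\<close> says that \<open>d = x \<otimes> inv (\<psi> x)\<close>; without the inverse the set
  can be evaluated on concrete groups.\<close>

definition displacements :: "('a, 'm) monoid_scheme \<Rightarrow> ('a \<Rightarrow> 'a) \<Rightarrow> 'a set" where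
  "displacements G \<psi> = {d \<in> carrier G. \<exists>x\<in>carrier G. d \<otimes>\<^bsub>G\<^esub> \<psi> x = x}"

locale group_aut = group G for G (structure) +
  fixes \<psi> :: "'a \<Rightarrow> 'a"
  assumes finite_carrier [simp]: "finite (carrier G)"
    and aut: "\<psi> \<in> iso G G"
begin

definition disp :: "'a \<Rightarrow> 'a" (\<open>\<delta>\<close>) where "\<delta> x = x \<otimes> inv (\<psi> x)"

abbreviation "D \<equiv> displacements G \<psi>"

definition "fixed = {x \<in> carrier G. \<psi> x = x}"

lemma aut_closed [simp]: "x \<in> carrier G \<Longrightarrow> \<psi> x \<in> carrier G"
  using aut by (auto simp: iso_def hom_def)

lemma aut_mult [simp]: "x \<in> carrier G \<Longrightarrow> y \<in> carrier G \<Longrightarrow> \<psi> (x \<otimes> y) = \<psi> x \<otimes> \<psi> y"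
  using aut by (auto simp: iso_def hom_def)

lemma aut_hom: "group_hom G G \<psi>"
  using aut by (auto simp: iso_def group_hom_def group_hom_axioms_def is_group)

lemma aut_one [simp]: "\<psi> \<one> = \<one>"
  by (rule group_hom.hom_one[OF aut_hom])

lemma aut_inv [simp]: "x \<in> carrier G \<Longrightarrow> \<psi> (inv x) = inv (\<psi> x)"
  by (rule group_hom.hom_inv[OF aut_hom])

lemma aut_pow [simp]: "x \<in> carrier G \<Longrightarrow> \<psi> (x [^] (k::nat)) = \<psi> x [^] k"
  by (induction k) simp_all

lemma aut_bij: "bij_betw \<psi> (carrier G) (carrier G)"
  using aut by (auto simp: iso_def)

lemma aut_eq_iff [simp]: "x \<in> carrier G \<Longrightarrow> y \<in> carrier G \<Longrightarrow> \<psi> x = \<psi> y \<longleftrightarrow> x = y"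
  using aut_bij by (auto simp: bij_betw_def inj_on_def)

lemma aut_eq_one_iff [simp]: "x \<in> carrier G \<Longrightarrow> \<psi> x = \<one> \<longleftrightarrow> x = \<one>"
  using aut_eq_iff[of x \<one>] by simp

lemma aut_surj: "y \<in> carrier G \<Longrightarrow> \<exists>x\<in>carrier G. \<psi> x = y"
  using bij_betw_imp_surj_on[OF aut_bij] by (metis imageE)

lemma disp_closed [simp]: "x \<in> carrier G \<Longrightarrow> \<delta> x \<in> carrier G"
  by (simp add: disp_def)

lemma disp_one [simp]: "\<delta> \<one> = \<one>"
  by (simp add: disp_def)

lemma aut_via_disp: "x \<in> carrier G \<Longrightarrow> \<psi> x = inv (\<delta> x) \<otimes> x"
  by (simp add: disp_def inv_mult_group m_assoc)

lemma displacements_eq: "D = \<delta> ` carrier G"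
proof -
  have "d \<otimes> \<psi> x = x \<longleftrightarrow> d = \<delta> x" if "d \<in> carrier G" "x \<in> carrier G" for d x
    unfolding disp_def using that inv_solve_right[of d x "\<psi> x"] aut_closed[of x] by metis
  then show ?thesis by (auto simp: displacements_def)
qed

lemma displacements_closed [simp]: "d \<in> D \<Longrightarrow> d \<in> carrier G"
  by (simp add: displacements_def)

lemma finite_displacements [simp]: "finite D"
  by (simp add: displacements_eq)

lemma one_displacement [simp]: "\<one> \<in> D"
  unfolding displacements_eq by (metis disp_one image_eqI one_closed)

lemma disp_in [simp]: "x \<in> carrier G \<Longrightarrow> \<delta> x \<in> D"
  by (simp add: displacements_eq)

lemma aut_disp: "x \<in> carrier G \<Longrightarrow> \<psi> (\<delta> x) = \<delta> (\<psi> x)"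
  by (simp add: disp_def)

lemma aut_displacement [simp]: "d \<in> D \<Longrightarrow> \<psi> d \<in> D"
  unfolding displacements_eq using aut_disp by auto

lemma disp_mult:
  "x \<in> carrier G \<Longrightarrow> y \<in> carrier G \<Longrightarrow> \<delta> (x \<otimes> y) = x \<otimes> \<delta> y \<otimes> inv (\<psi> x)"
  by (simp add: disp_def inv_mult_group m_assoc)

text \<open>As \<open>x \<otimes> \<delta> y \<otimes> inv (\<psi> x) = \<delta> (x \<otimes> y)\<close>, the set \<open>D\<close> is the orbit of \<open>\<one>\<close> under a twisted
  action of the group on itself. This is the source of the relations between displacements.\<close>

lemma twisted_action:
  assumes "x \<in> carrier G" "d \<in> D"
  shows "x \<otimes> d \<otimes> inv (\<psi> x) \<in> D"
proof -
  obtain y where "y \<in> carrier G" "d = \<delta> y" using assms by (auto simp: displacements_eq)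
  then show ?thesis using disp_in[of "x \<otimes> y"] assms by (simp add: disp_mult del: disp_in)
qed

lemma disp_eq_iff:
  assumes "x \<in> carrier G" "y \<in> carrier G"
  shows "\<delta> x = \<delta> y \<longleftrightarrow> inv x \<otimes> y \<in> fixed"
proof -
  have "\<delta> x = \<delta> y \<longleftrightarrow> x = y \<otimes> inv (\<psi> y) \<otimes> \<psi> x"
    using assms by (simp add: disp_def inv_solve_right')
  also have "\<dots> \<longleftrightarrow> inv y \<otimes> x = inv (\<psi> y) \<otimes> \<psi> x"
    using assms by (simp add: inv_solve_left' m_assoc)
  also have "\<dots> \<longleftrightarrow> inv (inv y \<otimes> x) = inv (inv (\<psi> y) \<otimes> \<psi> x)"
    using assms by (simp only: inv_inj m_closed inv_closed aut_closed inj_on_eq_iff[OF inv_inj])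
  also have "\<dots> \<longleftrightarrow> \<psi> (inv x \<otimes> y) = inv x \<otimes> y"
    using assms by (auto simp: inv_mult_group)
  finally have "\<delta> x = \<delta> y \<longleftrightarrow> \<psi> (inv x \<otimes> y) = inv x \<otimes> y" .
  moreover have "inv x \<otimes> y \<in> carrier G" using assms by simp
  ultimately show ?thesis unfolding fixed_def by blast
qed

lemma fixed_subgroup: "subgroup fixed G"
proof (rule subgroupI)
  have "\<one> \<in> fixed" by (simp add: fixed_def)
  then show "fixed \<noteq> {}" by blast
  show "fixed \<subseteq> carrier G" unfolding fixed_def by blast
next
  fix a assume "a \<in> fixed" then show "inv a \<in> fixed" by (simp add: fixed_def)
next
  fix a b assume "a \<in> fixed" "b \<in> fixed" then show "a \<otimes> b \<in> fixed" by (simp add: fixed_def)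
qed

lemma fixed_closed [simp]: "x \<in> fixed \<Longrightarrow> x \<in> carrier G"
  by (simp add: fixed_def)

lemma finite_fixed [simp]: "finite fixed"
  using finite_subset[OF subgroup.subset[OF fixed_subgroup]] by simp

text \<open>By \<open>disp_eq_iff\<close> the fibre through \<open>t\<close> is the left coset of \<open>fixed\<close> that contains \<open>t\<close>.\<close>

lemma card_fibre:
  assumes "d \<in> D"
  shows "card {x \<in> carrier G. \<delta> x = d} = card fixed"
proof -
  obtain t where t: "t \<in> carrier G" "d = \<delta> t" using assms by (auto simp: displacements_eq)
  have shift: "\<delta> (t \<otimes> f) = \<delta> t \<longleftrightarrow> f \<in> fixed" if "f \<in> carrier G" for f
  proof -
    have "inv t \<otimes> (t \<otimes> f) = f" using t that by (simp add: m_assoc[symmetric])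
    then show ?thesis using t that disp_eq_iff[of t "t \<otimes> f"] by auto
  qed
  have "{x \<in> carrier G. \<delta> x = d} = (\<lambda>f. t \<otimes> f) ` fixed" (is "?L = ?R")
  proof
    show "?R \<subseteq> ?L" using t shift by auto
    show "?L \<subseteq> ?R"
    proof
      fix x assume "x \<in> ?L"
      then have x: "x \<in> carrier G" "\<delta> x = \<delta> t" using t by auto
      have "t \<otimes> (inv t \<otimes> x) = x" using t x by (simp add: m_assoc[symmetric])
      then show "x \<in> ?R" using shift[of "inv t \<otimes> x"] t x
        by (metis image_eqI inv_closed m_closed)
    qed
  qed
  moreover have "inj_on (\<lambda>f. t \<otimes> f) fixed" using t by (auto simp: inj_on_def)
  ultimately show ?thesis by (simp add: card_image)
qed

lemma card_displacements: "card D * card fixed = order G"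
proof -
  have "card (carrier G) = (\<Sum>d\<in>D. card {x \<in> carrier G. \<delta> x = d})"
    by (subst card_UN_disjoint[symmetric]) (auto intro!: arg_cong[where f = card])
  then show ?thesis by (simp add: card_fibre order_def)
qed

lemma card_fixed_dvd: "card fixed dvd order G"
  by (metis card_displacements dvd_triv_right)

lemma card_displacements_dvd: "card D dvd order G"
  by (metis card_displacements dvd_triv_left)

lemma order_pos: "order G > 0" by (simp add: order_gt_0_iff_finite)

lemma quandle_op:
  "x \<in> carrier G \<Longrightarrow> y \<in> carrier G \<Longrightarrow> snd (gen_alexander G \<psi>) x y = \<delta> x \<otimes> \<psi> y"
  by (simp add: gen_alexander_def disp_def m_assoc)

lemma fst_gen_alexander [simp]: "fst (gen_alexander G \<psi>) = carrier G"
  by (simp add: gen_alexander_def)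

lemma subgroup_card_dvd: "subgroup H G \<Longrightarrow> card H dvd order G"
  by (metis dvd_triv_right lagrange)

text \<open>The inverse of an element of a finite group is one of its powers.\<close>

lemma subgroupI_finite:
  assumes "H \<subseteq> carrier G" "H \<noteq> {}" "\<And>x y. x \<in> H \<Longrightarrow> y \<in> H \<Longrightarrow> x \<otimes> y \<in> H"
  shows "subgroup H G"
proof (rule subgroupI)
  fix a assume a: "a \<in> H"
  have "a [^] Suc k \<in> H" for k by (induction k) (use a assms in auto)
  then have "a [^] Suc (2 * order G - 2) \<in> H" .
  moreover have "a [^] Suc (2 * order G - 2) = inv a"
  proof -
    have aG: "a \<in> carrier G" using a assms by auto
    have "a [^] Suc (2 * order G - 2) \<otimes> a = a [^] Suc (Suc (2 * order G - 2))" by simp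
    also have "Suc (Suc (2 * order G - 2)) = order G * 2" using order_pos by simp
    also have "a [^] (order G * 2) = \<one>"
      using aG pow_order_eq_1[OF aG] by (simp flip: nat_pow_pow)
    finally show ?thesis using aG by (metis inv_equality nat_pow_closed)
  qed
  ultimately show "inv a \<in> H" by simp
qed (use assms in auto)

end

section \<open>Extending an isomorphism of subgroups\<close>

locale twisted_iso =
  G: group_aut G \<psi> + G': group_aut G' \<psi>'
  for G (structure) and \<psi> and G' (structure) and \<psi>' +
  fixes K h
  assumes same_order: "order G = order G'"
    and K: "subgroup K G" and D_K: "displacements G \<psi> \<subseteq> K"
    and h_closed: "k \<in> K \<Longrightarrow> h k \<in> carrier G'"
    and h_mult: "k \<in> K \<Longrightarrow> l \<in> K \<Longrightarrow> h (k \<otimes> l) = h k \<otimes>\<^bsub>G'\<^esub> h l"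
    and h_inj: "inj_on h K"
    and h_aut: "k \<in> K \<Longrightarrow> h (\<psi> k) = \<psi>' (h k)"
    and h_D: "h ` displacements G \<psi> = displacements G' \<psi>'"
begin

lemma K_closed [simp]: "k \<in> K \<Longrightarrow> k \<in> carrier G"
  using K subgroup.mem_carrier by fastforce

lemma K_mult [simp]: "k \<in> K \<Longrightarrow> l \<in> K \<Longrightarrow> k \<otimes> l \<in> K"
  using K by (simp add: subgroup.m_closed)

lemma K_inv [simp]: "k \<in> K \<Longrightarrow> inv k \<in> K"
  using K by (simp add: subgroup.m_inv_closed)

lemma K_one [simp]: "\<one> \<in> K"
  using K by (simp add: subgroup.one_closed)

lemma disp_K [simp]: "x \<in> carrier G \<Longrightarrow> G.disp x \<in> K"
  using D_K G.disp_in by blast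

lemma h_one: "h \<one> = \<one>\<^bsub>G'\<^esub>"
  using h_mult[of \<one> \<one>] h_closed[of \<one>] by simp

lemma h_inv: "k \<in> K \<Longrightarrow> h (inv k) = inv\<^bsub>G'\<^esub> h k"
  using h_mult[of "inv k" k] h_one h_closed[of k] h_closed[of "inv k"]
  by (simp add: G'.inv_equality)

lemma aut_K [simp]: "k \<in> K \<Longrightarrow> \<psi> k \<in> K"
  by (subst G.aut_via_disp) simp_all

lemma card_fixed_eq: "card G.fixed = card G'.fixed"
proof -
  have "card (displacements G \<psi>) = card (displacements G' \<psi>')"
    using card_image[OF inj_on_subset[OF h_inj D_K]] h_D by simp
  moreover have "card (displacements G \<psi>) > 0"
    by (metis G.one_displacement G.finite_displacements card_gt_0_iff empty_iff)
  ultimately show ?thesis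
    using G.card_displacements G'.card_displacements same_order by (metis mult_left_cancel less_not_refl)
qed

text \<open>\<open>A\<close> is the union of those right cosets of \<open>K\<close> on which the isomorphism has been constructed:
  an injection that is equivariant along \<open>h\<close> and lifts \<open>h\<close> through the two displacement maps.\<close>

definition partial where
  "partial A f \<longleftrightarrow> A \<subseteq> carrier G \<and> inj_on f A
     \<and> (\<forall>k\<in>K. \<forall>x\<in>A. k \<otimes> x \<in> A \<and> f (k \<otimes> x) = h k \<otimes>\<^bsub>G'\<^esub> f x)
     \<and> (\<forall>x\<in>A. f x \<in> carrier G' \<and> G'.disp (f x) = h (G.disp x))"

text \<open>The value \<open>x'\<close> at the new point \<open>x\<close> must lie in the fibre of \<open>\<delta>'\<close> over \<open>h (\<delta> x)\<close> and must be
  unused. As \<open>h\<close> is injective, only points of the fibre through \<open>x\<close> have been sent there, and at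
  least one of them, \<open>x\<close>, has not; so the equality of the sizes of the two fibres provides \<open>x'\<close>.
  Equivariance dictates the values on the rest of the coset.\<close>

lemma partial_extend:
  assumes f: "partial A f" and x: "x \<in> carrier G" "x \<notin> A"
  shows "\<exists>f'. partial (A \<union> (\<lambda>k. k \<otimes> x) ` K) f'"
proof -
  have A: "a \<in> carrier G" "f a \<in> carrier G'" "G'.disp (f a) = h (G.disp a)" if "a \<in> A" for a
    using f that by (auto simp: partial_def)
  have KA: "k \<otimes> a \<in> A" "f (k \<otimes> a) = h k \<otimes>\<^bsub>G'\<^esub> f a" if "k \<in> K" "a \<in> A" for k a
    using f that by (auto simp: partial_def)
  have f_inj: "inj_on f A" using f by (simp add: partial_def)
  let ?d = "G.disp x"
  have "h ?d \<in> displacements G' \<psi>'" using imageI[OF G.disp_in[OF x(1)], of h] h_D by simp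
  \<comment> \<open>the fibre over \<open>h ?d\<close> is as large as that over \<open>?d\<close>, which \<open>A\<close> does not exhaust\<close>
  let ?F = "{y \<in> carrier G. G.disp y = ?d}" and ?F' = "{y \<in> carrier G'. G'.disp y = h ?d}"
  have "card (f ` (A \<inter> ?F)) = card (A \<inter> ?F)"
    by (rule card_image, rule inj_on_subset[OF f_inj]) blast
  also have "\<dots> < card ?F"
  proof (rule psubset_card_mono)
    show "finite ?F" by (rule finite_subset[OF _ G.finite_carrier]) blast
    show "A \<inter> ?F \<subset> ?F" using x by blast
  qed
  also have "card ?F = card ?F'"
    using G.card_fibre[OF G.disp_in[OF x(1)]] G'.card_fibre[OF \<open>h ?d \<in> _\<close>] card_fixed_eq by simp
  finally have less: "card (f ` (A \<inter> ?F)) < card ?F'" .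
  have "finite ?F" by (rule finite_subset[OF _ G.finite_carrier]) blast
  then have "finite (f ` (A \<inter> ?F))" by blast
  from card_mono[OF this] less have "\<not> ?F' \<subseteq> f ` (A \<inter> ?F)" by (meson not_le)
  then obtain x' where x': "x' \<in> carrier G'" "G'.disp x' = h ?d" "x' \<notin> f ` (A \<inter> ?F)" by auto
  have x'_new: "x' \<noteq> f a" if "a \<in> A" for a
  proof
    assume "x' = f a"
    then have "h (G.disp a) = h ?d" using x' A[OF that] by simp
    then have "G.disp a = ?d" using h_inj A(1)[OF that] x by (auto simp: inj_on_def)
    then show False using x'(3) that A \<open>x' = f a\<close> by auto
  qed
  have disjoint: "k \<otimes> x \<notin> A" if "k \<in> K" for k
  proof
    assume "k \<otimes> x \<in> A"
    then have "inv k \<otimes> (k \<otimes> x) \<in> A" using KA(1)[of "inv k" "k \<otimes> x"] that by simp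
    moreover have "inv k \<otimes> (k \<otimes> x) = x" using that x by (simp flip: G.m_assoc)
    ultimately show False using x by simp
  qed
  define f' where "f' y = (if y \<in> A then f y else h (y \<otimes> inv x) \<otimes>\<^bsub>G'\<^esub> x')" for y
  have f'_A: "f' a = f a" if "a \<in> A" for a using that by (simp add: f'_def)
  have f'_K: "f' (k \<otimes> x) = h k \<otimes>\<^bsub>G'\<^esub> x'" if "k \<in> K" for k
    using disjoint[OF that] that x by (simp add: f'_def G.m_assoc)
  have "h k \<otimes>\<^bsub>G'\<^esub> x' \<noteq> f a" if "k \<in> K" "a \<in> A" for k a
  proof
    assume eq: "h k \<otimes>\<^bsub>G'\<^esub> x' = f a"
    have "f (inv k \<otimes> a) = inv\<^bsub>G'\<^esub> (h k) \<otimes>\<^bsub>G'\<^esub> (h k \<otimes>\<^bsub>G'\<^esub> x')"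
      using KA(2)[of "inv k" a] that eq by (simp add: h_inv)
    also have "\<dots> = x'" using h_closed[OF that(1)] x' by (simp flip: G'.m_assoc)
    finally show False using x'_new KA(1)[of "inv k" a] that by (metis K_inv)
  qed
  moreover have "inj_on (\<lambda>k. h k \<otimes>\<^bsub>G'\<^esub> x') K"
    using h_inj x' h_closed by (auto simp: inj_on_def)
  then have "inj_on f' ((\<lambda>k. k \<otimes> x) ` K)"
    by (auto simp: inj_on_def f'_K)
  moreover have "inj_on f' A" using f_inj by (simp add: inj_on_def f'_A)
  ultimately have "inj_on f' (A \<union> (\<lambda>k. k \<otimes> x) ` K)"
    unfolding inj_on_Un by (force simp: f'_A f'_K)
  moreover have "k \<otimes> y \<in> A \<union> (\<lambda>k. k \<otimes> x) ` K \<and> f' (k \<otimes> y) = h k \<otimes>\<^bsub>G'\<^esub> f' y"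
    if "k \<in> K" and y: "y \<in> A \<union> (\<lambda>k. k \<otimes> x) ` K" for k y
    using y
  proof
    assume "y \<in> A"
    then show ?thesis using KA that by (simp add: f'_A)
  next
    assume "y \<in> (\<lambda>k. k \<otimes> x) ` K"
    then obtain l where l: "l \<in> K" "y = l \<otimes> x" by auto
    then have "k \<otimes> y = (k \<otimes> l) \<otimes> x" using that x by (simp add: G.m_assoc)
    then show ?thesis using l that x' f'_K[of "k \<otimes> l"]
      by (auto simp: f'_K h_mult h_closed G'.m_assoc)
  qed
  moreover have "f' y \<in> carrier G' \<and> G'.disp (f' y) = h (G.disp y)"
    if "y \<in> A \<union> (\<lambda>k. k \<otimes> x) ` K" for y
    using that
  proof
    assume "y \<in> A"
    then show ?thesis using A by (simp add: f'_A)
  next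
    assume "y \<in> (\<lambda>k. k \<otimes> x) ` K"
    then obtain l where l: "l \<in> K" "y = l \<otimes> x" by auto
    then show ?thesis using x x'
      by (simp add: f'_K G'.disp_mult G.disp_mult h_mult h_closed h_inv h_aut)
  qed
  ultimately have "partial (A \<union> (\<lambda>k. k \<otimes> x) ` K) f'"
    using A x by (auto simp: partial_def)
  then show ?thesis by blast
qed

text \<open>From \<open>\<psi> y = inv (\<delta> y) \<otimes> y\<close> follows \<open>f (\<psi> y) = \<psi>' (f y)\<close>, and then
  \<open>f (\<delta> x \<otimes> \<psi> y) = h (\<delta> x) \<otimes> f (\<psi> y) = \<delta>' (f x) \<otimes> \<psi>' (f y)\<close>.\<close>

lemma quandle_isomorphic: "quandle_isomorphic (gen_alexander G \<psi>) (gen_alexander G' \<psi>')"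
proof -
  have "\<exists>f. partial (carrier G) f" if "partial A f" for A f
    using that
  proof (induction "card (carrier G - A)" arbitrary: A f rule: less_induct)
    case less
    show ?case
    proof (cases "carrier G \<subseteq> A")
      case True
      then have "A = carrier G" using less.prems by (auto simp: partial_def)
      then show ?thesis using less.prems by blast
    next
      case False
      then obtain x where x: "x \<in> carrier G" "x \<notin> A" by auto
      then obtain f' where f': "partial (A \<union> (\<lambda>k. k \<otimes> x) ` K) f'"
        using partial_extend[OF less.prems] by blast
      have "x = \<one> \<otimes> x" using x by simp
      then have "x \<in> (\<lambda>k. k \<otimes> x) ` K" using K_one by (rule image_eqI)
      then have "card (carrier G - (A \<union> (\<lambda>k. k \<otimes> x) ` K)) < card (carrier G - A)"
        using x by (intro psubset_card_mono) auto
      then show ?thesis using less.hyps f' by blast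
    qed
  qed
  moreover have "partial {} (\<lambda>_. undefined)" by (simp add: partial_def)
  ultimately obtain f where "partial (carrier G) f" by blast
  then have inj: "inj_on f (carrier G)"
    and fK: "\<And>k x. k \<in> K \<Longrightarrow> x \<in> carrier G \<Longrightarrow> f (k \<otimes> x) = h k \<otimes>\<^bsub>G'\<^esub> f x"
    and fc: "\<And>x. x \<in> carrier G \<Longrightarrow> f x \<in> carrier G'"
    and fd: "\<And>x. x \<in> carrier G \<Longrightarrow> G'.disp (f x) = h (G.disp x)"
    by (auto simp: partial_def)
  have "f ` carrier G = carrier G'"
    using fc same_order card_image[OF inj] by (intro card_subset_eq) (auto simp: order_def)
  then have bij: "bij_betw f (carrier G) (carrier G')" using inj by (simp add: bij_betw_def)
  have "f (G.disp x \<otimes> \<psi> y) = G'.disp (f x) \<otimes>\<^bsub>G'\<^esub> \<psi>' (f y)"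
    if x: "x \<in> carrier G" and y: "y \<in> carrier G" for x y
  proof -
    have "f (\<psi> y) = f (inv (G.disp y) \<otimes> y)" using y by (simp add: G.aut_via_disp)
    also have "\<dots> = inv\<^bsub>G'\<^esub> (h (G.disp y)) \<otimes>\<^bsub>G'\<^esub> f y" using y by (simp add: fK h_inv)
    also have "\<dots> = \<psi>' (f y)" using y by (simp add: G'.aut_via_disp fc fd)
    finally show ?thesis using x y by (simp add: fK fd)
  qed
  then have "f \<in> quandle_iso (gen_alexander G \<psi>) (gen_alexander G' \<psi>')"
    using bij fc by (simp add: quandle_iso_def G.quandle_op G'.quandle_op)
  then show ?thesis by (auto simp: quandle_isomorphic_def)
qed

end

section \<open>Models of the displacement set\<close>

text \<open>A model \<open>(H, \<theta>, E)\<close> stands for a subgroup that contains all displacements, together with the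
  restriction of the automorphism to it and the set of displacements.\<close>

type_synonym 'h model = "'h monoid \<times> ('h \<Rightarrow> 'h) \<times> 'h set"

definition model :: "'h model \<Rightarrow> bool" where
  "model M = (case M of (H, \<theta>, E) \<Rightarrow>
     group H \<and> finite (carrier H) \<and> \<theta> \<in> hom H H \<and> E \<subseteq> carrier H)"

definition realizes :: "'h model \<Rightarrow> ('a, 'm) monoid_scheme \<Rightarrow> ('a \<Rightarrow> 'a) \<Rightarrow> bool" where
  "realizes M G \<psi> = (case M of (H, \<theta>, E) \<Rightarrow>
     \<exists>c \<in> hom H G. inj_on c (carrier H) \<and> (\<forall>x\<in>carrier H. c (\<theta> x) = \<psi> (c x)) \<and>
       c ` E = displacements G \<psi>)"

text \<open>Going from one embedded copy of \<open>H\<close> to the other is a map \<open>h\<close> as required for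
  \<open>twisted_iso\<close>.\<close>

theorem realizes_same_model:
  assumes "group_aut G \<psi>" "group_aut G' \<psi>'" "order G = order G'"
    and M: "model M" "realizes M G \<psi>" "realizes M G' \<psi>'"
  shows "quandle_isomorphic (gen_alexander G \<psi>) (gen_alexander G' \<psi>')"
proof -
  interpret G: group_aut G \<psi> by fact
  interpret G': group_aut G' \<psi>' by fact
  obtain H \<theta> E where [simp]: "M = (H, \<theta>, E)" by (cases M)
  have H: "group H" "\<theta> \<in> hom H H" "E \<subseteq> carrier H" using M by (auto simp: model_def)
  obtain c where c: "c \<in> hom H G" "inj_on c (carrier H)" "c ` E = displacements G \<psi>"
    and c_aut: "\<And>x. x \<in> carrier H \<Longrightarrow> c (\<theta> x) = \<psi> (c x)"
    using M(2) by (auto simp: realizes_def)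
  obtain c' where c': "c' \<in> hom H G'" "inj_on c' (carrier H)" "c' ` E = displacements G' \<psi>'"
    and c'_aut: "\<And>x. x \<in> carrier H \<Longrightarrow> c' (\<theta> x) = \<psi>' (c' x)"
    using M(3) by (auto simp: realizes_def)
  define h where "h k = c' (inv_into (carrier H) c k)" for k
  have h [simp]: "h (c x) = c' x" if "x \<in> carrier H" for x
    using c that by (simp add: h_def)
  have \<theta>_closed: "\<theta> x \<in> carrier H" if "x \<in> carrier H" for x using H that by (auto simp: hom_def)
  interpret twisted_iso G \<psi> G' \<psi>' "c ` carrier H" h
  proof (intro twisted_iso.intro twisted_iso_axioms.intro)
    show "group_aut G \<psi>" "group_aut G' \<psi>'" by fact+
    show "order G = order G'" by fact
    show "subgroup (c ` carrier H) G"
      using c H by (metis group_hom.img_is_subgroup group_hom.intro group_hom_axioms.intro G.is_group)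
    show "displacements G \<psi> \<subseteq> c ` carrier H" using c H by blast
    show "inj_on h (c ` carrier H)" using c' by (auto simp: inj_on_def)
    show "h ` displacements G \<psi> = displacements G' \<psi>'"
      unfolding c(3)[symmetric] c'(3)[symmetric] image_image
      by (rule image_cong[OF refl]) (use H in auto)
  next
    fix k assume k: "k \<in> c ` carrier H"
    then show "h k \<in> carrier G'" using c' by (auto simp: hom_def)
    from k obtain x where x: "x \<in> carrier H" "k = c x" by blast
    then have "h (\<psi> k) = h (c (\<theta> x))" by (simp add: c_aut)
    also have "\<dots> = \<psi>' (h k)" using x by (simp add: \<theta>_closed c'_aut)
    finally show "h (\<psi> k) = \<psi>' (h k)" .
    fix l assume l: "l \<in> c ` carrier H"
    obtain x y where xy: "x \<in> carrier H" "y \<in> carrier H" "k = c x" "l = c y" using k l by auto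
    then have "x \<otimes>\<^bsub>H\<^esub> y \<in> carrier H" using H(1) by (simp add: group.is_monoid monoid.m_closed)
    then show "h (k \<otimes>\<^bsub>G\<^esub> l) = h k \<otimes>\<^bsub>G'\<^esub> h l"
      using xy by (simp add: hom_mult[OF c(1), symmetric] hom_mult[OF c'(1), symmetric])
  qed
  show ?thesis by (rule quandle_isomorphic)
qed

section \<open>Counting solutions of equations between words\<close>

text \<open>The list of exponents \<open>i, j, \<dots>\<close> encodes the product \<open>(\<psi> ^^ i) u \<otimes> (\<psi> ^^ j) u \<otimes> \<dots>\<close>.\<close>

fun word :: "('a, 'm) monoid_scheme \<Rightarrow> ('a \<Rightarrow> 'a) \<Rightarrow> nat list \<Rightarrow> 'a \<Rightarrow> 'a" where
  "word G \<psi> [] u = \<one>\<^bsub>G\<^esub>"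
| "word G \<psi> (i # is) u = (\<psi> ^^ i) u \<otimes>\<^bsub>G\<^esub> word G \<psi> is u"

text \<open>The pair of empty words is solved by every element and so contributes \<open>card E\<close>.\<close>

definition solutions ::
    "(nat list \<times> nat list) list \<Rightarrow> ('a, 'm) monoid_scheme \<times> ('a \<Rightarrow> 'a) \<times> 'a set \<Rightarrow> nat list" where
  "solutions W M = (case M of (G, \<psi>, E) \<Rightarrow>
     map (\<lambda>(v, w). card {u \<in> E. word G \<psi> v u = word G \<psi> w u}) W)"

lemma solutions_cong:
  assumes "inj_on f A" "bij_betw f E E'"
    and "\<And>u w. u \<in> E \<Longrightarrow> word G \<psi> w u \<in> A \<and> f (word G \<psi> w u) = word G' \<psi>' w (f u)"
  shows "solutions W (G, \<psi>, E) = solutions W (G', \<psi>', E')"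
proof -
  have "card {u \<in> E. word G \<psi> v u = word G \<psi> w u} =
        card {u \<in> E'. word G' \<psi>' v u = word G' \<psi>' w u}" for v w
  proof (rule bij_betw_same_card[where f = f])
    have "word G \<psi> v u = word G \<psi> w u \<longleftrightarrow> word G' \<psi>' v (f u) = word G' \<psi>' w (f u)" if "u \<in> E" for u
      using assms(3)[OF that] inj_on_eq_iff[OF assms(1)] by metis
    then show "bij_betw f {u \<in> E. word G \<psi> v u = word G \<psi> w u}
        {u \<in> E'. word G' \<psi>' v u = word G' \<psi>' w u}"
      using assms(2) by (auto simp: bij_betw_def inj_on_def)
  qed
  then show ?thesis by (simp add: solutions_def)
qed

text \<open>The embedding of the model is a homomorphism that respects the endomorphisms, so it maps
  words to words.\<close>

lemma realizes_solutions:
  assumes "group_aut G \<psi>" "model M" "realizes M G \<psi>"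
  shows "solutions W M = solutions W (G, \<psi>, displacements G \<psi>)"
proof -
  interpret G: group_aut G \<psi> by fact
  obtain H \<theta> E where M [simp]: "M = (H, \<theta>, E)" by (cases M)
  have H: "group H" "\<theta> \<in> hom H H" "E \<subseteq> carrier H" using assms by (auto simp: model_def)
  interpret H: group H by fact
  obtain c where c: "c \<in> hom H G" "inj_on c (carrier H)" "c ` E = displacements G \<psi>"
    and c_aut: "\<And>x. x \<in> carrier H \<Longrightarrow> c (\<theta> x) = \<psi> (c x)"
    using assms(3) by (auto simp: realizes_def)
  interpret c: group_hom H G c
    using c H G.is_group by (simp add: group_hom_def group_hom_axioms_def)
  have \<theta>: "\<theta> x \<in> carrier H" if "x \<in> carrier H" for x using H that by (auto simp: hom_def)
  have pow: "(\<theta> ^^ i) x \<in> carrier H \<and> c ((\<theta> ^^ i) x) = (\<psi> ^^ i) (c x)" if "x \<in> carrier H" for i x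
    by (induction i) (simp_all add: that \<theta> c_aut)
  have "word H \<theta> w u \<in> carrier H \<and> c (word H \<theta> w u) = word G \<psi> w (c u)"
    if "u \<in> carrier H" for w u
    by (induction w) (simp_all add: that pow)
  then have "solutions W (H, \<theta>, E) = solutions W (G, \<psi>, displacements G \<psi>)"
    using c H inj_on_subset[OF c(2) H(3)]
    by (intro solutions_cong[where f = c and A = "carrier H"]) (auto simp: bij_betw_def)
  then show ?thesis by simp
qed

text \<open>An isomorphism \<open>f\<close> with \<open>f \<one> = \<one>\<close> respects \<open>\<psi> = s\<^sub>\<one>\<close> and \<open>\<delta> x = s\<^sub>x \<one>\<close>. Writing
  \<open>z = \<psi> y\<close> in \<open>\<delta> x \<otimes> z = s\<^sub>x y\<close> yields \<open>f (d \<otimes> z) = f d \<otimes> f z\<close> for every displacement \<open>d\<close>.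
  All factors of a word in \<open>u \<in> D\<close> are displacements, so \<open>f\<close> maps words to words.\<close>

lemma isomorphic_solutions:
  assumes "group_aut G \<psi>" "group_aut G' \<psi>'"
    and "quandle_isomorphic (gen_alexander G \<psi>) (gen_alexander G' \<psi>')"
  shows "solutions W (G, \<psi>, displacements G \<psi>) = solutions W (G', \<psi>', displacements G' \<psi>')"
proof -
  interpret G: group_aut G \<psi> by fact
  interpret G': group_aut G' \<psi>' by fact
  obtain f0 where f0: "bij_betw f0 (carrier G) (carrier G')"
    and f0_op: "\<And>x y. x \<in> carrier G \<Longrightarrow> y \<in> carrier G \<Longrightarrow>
      f0 (G.disp x \<otimes>\<^bsub>G\<^esub> \<psi> y) = G'.disp (f0 x) \<otimes>\<^bsub>G'\<^esub> \<psi>' (f0 y)"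
  proof -
    obtain f0 where *: "f0 \<in> quandle_iso (gen_alexander G \<psi>) (gen_alexander G' \<psi>')"
      using assms(3) by (auto simp: quandle_isomorphic_def)
    then have "bij_betw f0 (carrier G) (carrier G')" by (simp add: quandle_iso_def)
    moreover from this have "f0 x \<in> carrier G'" if "x \<in> carrier G" for x
      using that by (auto simp: bij_betw_def)
    ultimately show ?thesis
      using * that[of f0] by (simp add: quandle_iso_def G.quandle_op G'.quandle_op)
  qed
  have f0_closed: "f0 x \<in> carrier G'" if "x \<in> carrier G" for x
    using f0 that by (auto simp: bij_betw_def)
  \<comment> \<open>left translations are quandle automorphisms, so a base point can be prescribed\<close>
  define g where "g = inv\<^bsub>G'\<^esub> (f0 \<one>\<^bsub>G\<^esub>)"
  have g: "g \<in> carrier G'" using f0_closed by (simp add: g_def)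
  define f where "f x = g \<otimes>\<^bsub>G'\<^esub> f0 x" for x
  have f_closed: "f x \<in> carrier G'" if "x \<in> carrier G" for x using f0_closed g that by (simp add: f_def)
  have f_inj: "inj_on f (carrier G)"
    using f0 f0_closed g by (auto simp: f_def inj_on_def bij_betw_def)
  have f_surj: "f ` carrier G = carrier G'"
  proof
    show "carrier G' \<subseteq> f ` carrier G"
    proof
      fix y assume y: "y \<in> carrier G'"
      then have "inv\<^bsub>G'\<^esub> g \<otimes>\<^bsub>G'\<^esub> y \<in> f0 ` carrier G" using f0 g by (simp add: bij_betw_def)
      then obtain x where "x \<in> carrier G" "f0 x = inv\<^bsub>G'\<^esub> g \<otimes>\<^bsub>G'\<^esub> y" by auto
      then show "y \<in> f ` carrier G" using g y
        by (intro image_eqI[of _ _ x]) (simp_all add: f_def G'.m_assoc[symmetric])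
    qed
  qed (use f_closed in auto)
  have f_op: "f (G.disp x \<otimes>\<^bsub>G\<^esub> \<psi> y) = G'.disp (f x) \<otimes>\<^bsub>G'\<^esub> \<psi>' (f y)"
    if "x \<in> carrier G" "y \<in> carrier G" for x y
  proof -
    have "inv\<^bsub>G'\<^esub> (\<psi>' g) \<otimes>\<^bsub>G'\<^esub> (\<psi>' g \<otimes>\<^bsub>G'\<^esub> \<psi>' (f0 y)) = \<psi>' (f0 y)"
      using that f0_closed g by (simp add: G'.m_assoc[symmetric])
    then show ?thesis
      using that f0_closed g by (simp add: f_def f0_op G'.disp_mult G'.m_assoc)
  qed
  have f_one: "f \<one>\<^bsub>G\<^esub> = \<one>\<^bsub>G'\<^esub>" using f0_closed by (simp add: f_def g_def)
  have f_aut: "f (\<psi> y) = \<psi>' (f y)" if "y \<in> carrier G" for y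
    using f_op[of "\<one>\<^bsub>G\<^esub>" y] that f_closed by (simp add: f_one)
  have f_disp: "f (G.disp x) = G'.disp (f x)" if "x \<in> carrier G" for x
    using f_op[of x "\<one>\<^bsub>G\<^esub>"] that f_closed by (simp add: f_one)
  have f_mult: "f (d \<otimes>\<^bsub>G\<^esub> z) = f d \<otimes>\<^bsub>G'\<^esub> f z"
    if d: "d \<in> displacements G \<psi>" and z: "z \<in> carrier G" for d z
  proof -
    obtain x where "x \<in> carrier G" "d = G.disp x" using d unfolding G.displacements_eq by blast
    moreover obtain y where "y \<in> carrier G" "z = \<psi> y" using G.aut_surj[OF z] by blast
    ultimately show ?thesis by (simp add: f_op f_aut f_disp)
  qed
  have pow: "(\<psi> ^^ i) u \<in> displacements G \<psi> \<and> f ((\<psi> ^^ i) u) = (\<psi>' ^^ i) (f u)"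
    if "u \<in> displacements G \<psi>" for i u
  proof (induction i)
    case (Suc i)
    then show ?case
      using f_aut[of "(\<psi> ^^ i) u"] G.aut_displacement[of "(\<psi> ^^ i) u"] by simp
  qed (simp add: that)
  have "word G \<psi> w u \<in> carrier G \<and> f (word G \<psi> w u) = word G' \<psi>' w (f u)"
    if u: "u \<in> displacements G \<psi>" for w u
  proof (induction w)
    case (Cons i w)
    then show ?case
      using pow[OF u, of i] f_mult[of "(\<psi> ^^ i) u" "word G \<psi> w u"] by simp
  qed (simp add: f_one)
  moreover have "bij_betw f (displacements G \<psi>) (displacements G' \<psi>')"
  proof -
    have "f ` displacements G \<psi> = (\<lambda>x. G'.disp (f x)) ` carrier G"
      unfolding G.displacements_eq image_image by (rule image_cong) (simp_all add: f_disp)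
    also have "\<dots> = displacements G' \<psi>'"
      unfolding G'.displacements_eq f_surj[symmetric] image_image ..
    finally show ?thesis
      using inj_on_subset[OF f_inj, of "displacements G \<psi>"] G.displacements_closed
      by (auto simp: bij_betw_def simp del: G.displacements_closed)
  qed
  ultimately show ?thesis
    by (intro solutions_cong[OF f_inj]) auto
qed

text \<open>Each model is realized by a quandle on natural numbers. Two of these are not isomorphic, since
  their solution counts differ; and by completeness each class contains one of them.\<close>

theorem card_classes:
  fixes Ms :: "'h model list"
  assumes model: "\<And>M. M \<in> set Ms \<Longrightarrow> model M"
    and realizable: "\<And>M. M \<in> set Ms \<Longrightarrow>
      \<exists>(G :: 'h monoid) \<psi>. group_aut G \<psi> \<and> order G = n \<and> realizes M G \<psi>"
    and complete: "\<And>(G :: nat monoid) \<psi>. group_aut G \<psi> \<Longrightarrow> order G = n \<Longrightarrow>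
      \<exists>M\<in>set Ms. realizes M G \<psi>"
    and distinct: "distinct (map (solutions W) Ms)"
  shows "card (GAQ_classes n) = length Ms"
proof -
  have "\<forall>M\<in>set Ms. \<exists>X. \<exists>(G :: 'h monoid) \<psi>. group_aut G \<psi> \<and> order G = n \<and> realizes M G \<psi>
      \<and> X \<in> GAQ n \<and> quandle_isomorphic (gen_alexander G \<psi>) X"
  proof
    fix M assume "M \<in> set Ms"
    then obtain G :: "'h monoid" and \<psi> where *: "group_aut G \<psi>" "order G = n" "realizes M G \<psi>"
      using realizable by blast
    then show "\<exists>X. \<exists>(G :: 'h monoid) \<psi>. group_aut G \<psi> \<and> order G = n \<and> realizes M G \<psi>
      \<and> X \<in> GAQ n \<and> quandle_isomorphic (gen_alexander G \<psi>) X"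
      using gen_alexander_transfer[of G \<psi>]
      by (metis group_aut.aut group_aut.axioms(1) group_aut.finite_carrier)
  qed
  then obtain X where X: "\<forall>M\<in>set Ms. \<exists>(G :: 'h monoid) \<psi>. group_aut G \<psi> \<and> order G = n \<and>
      realizes M G \<psi> \<and> X M \<in> GAQ n \<and> quandle_isomorphic (gen_alexander G \<psi>) (X M)"
    by (rule bchoice[THEN exE])
  have closed: "snd (gen_alexander G \<psi>) x y \<in> fst (gen_alexander G \<psi>)"
    if "group_aut G \<psi>" "x \<in> fst (gen_alexander G \<psi>)" "y \<in> fst (gen_alexander G \<psi>)"
    for G :: "'h monoid" and \<psi> x y
    using that gen_alexander_closed[of G \<psi> x y]
    by (simp add: group_aut.fst_gen_alexander group_aut.aut group_aut.axioms(1))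
  have in_GAQ: "X M \<in> GAQ n" if "M \<in> set Ms" for M using X that by blast
  have inj: "M = M'" if M: "M \<in> set Ms" "M' \<in> set Ms" and iso: "quandle_isomorphic (X M) (X M')" for M M'
  proof -
    obtain G :: "'h monoid" and \<psi> where G: "group_aut G \<psi>" "realizes M G \<psi>"
      "quandle_isomorphic (gen_alexander G \<psi>) (X M)" using X M by blast
    obtain G' :: "'h monoid" and \<psi>' where G': "group_aut G' \<psi>'" "realizes M' G' \<psi>'"
      "quandle_isomorphic (gen_alexander G' \<psi>') (X M')" using X M by blast
    have "quandle_isomorphic (X M') (gen_alexander G' \<psi>')"
      using quandle_isomorphic_sym[OF G'(3)] closed[OF G'(1)] by blast
    from quandle_isomorphic_trans[OF quandle_isomorphic_trans[OF G(3) iso] this]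
    have "solutions W (G, \<psi>, displacements G \<psi>) = solutions W (G', \<psi>', displacements G' \<psi>')"
      by (rule isomorphic_solutions[OF G(1) G'(1)])
    then have "solutions W M = solutions W M'"
      using realizes_solutions[OF G(1) model[OF M(1)] G(2), of W]
        realizes_solutions[OF G'(1) model[OF M(2)] G'(2), of W] by simp
    then show ?thesis using distinct M by (auto simp: distinct_map inj_on_def)
  qed
  have cover: "\<exists>M\<in>set Ms. quandle_isomorphic (X M) Y" if Y_in: "Y \<in> GAQ n" for Y
  proof -
    obtain H :: "nat monoid" and \<phi> where Y: "Y = gen_alexander H \<phi>"
      and *: "group H" "finite (carrier H)" "\<phi> \<in> iso H H" and H': "order H = n"
      using Y_in by (auto simp: GAQ_def)
    have H: "group_aut H \<phi>" "order H = n"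
      using * H' by (simp_all add: group_aut_def group_aut_axioms_def)
    obtain M where M: "M \<in> set Ms" "realizes M H \<phi>" using complete[OF H] by blast
    obtain G :: "'h monoid" and \<psi> where G: "group_aut G \<psi>" "order G = n" "realizes M G \<psi>"
      "quandle_isomorphic (gen_alexander G \<psi>) (X M)" using X M by blast
    have "quandle_isomorphic (X M) (gen_alexander G \<psi>)"
      using quandle_isomorphic_sym[OF G(4)] closed[OF G(1)] by blast
    moreover have "quandle_isomorphic (gen_alexander G \<psi>) Y"
      unfolding Y using realizes_same_model[OF G(1) H(1) _ model[OF M(1)] G(3) M(2)] G(2) H(2) by simp
    ultimately show ?thesis using M(1) quandle_isomorphic_trans by blast
  qed
  have "GAQ_classes n = (\<lambda>M. GAQ_rel n `` {X M}) ` set Ms"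
  proof
    show "(\<lambda>M. GAQ_rel n `` {X M}) ` set Ms \<subseteq> GAQ_classes n"
      using in_GAQ by (auto simp: GAQ_classes_def intro: quotientI)
    show "GAQ_classes n \<subseteq> (\<lambda>M. GAQ_rel n `` {X M}) ` set Ms"
    proof
      fix C assume "C \<in> GAQ_classes n"
      then obtain Y where Y: "Y \<in> GAQ n" "C = GAQ_rel n `` {Y}"
        by (auto simp: GAQ_classes_def elim: quotientE)
      obtain M where M: "M \<in> set Ms" "quandle_isomorphic (X M) Y" using cover[OF Y(1)] by blast
      then have "(X M, Y) \<in> GAQ_rel n" using Y in_GAQ by (simp add: GAQ_rel_def)
      then have "C = GAQ_rel n `` {X M}" using Y equiv_class_eq[OF equiv_GAQ_rel] by metis
      then show "C \<in> (\<lambda>M. GAQ_rel n `` {X M}) ` set Ms" using M by blast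
    qed
  qed
  moreover have "inj_on (\<lambda>M. GAQ_rel n `` {X M}) (set Ms)"
  proof (rule inj_onI)
    fix M M' assume M: "M \<in> set Ms" "M' \<in> set Ms" "GAQ_rel n `` {X M} = GAQ_rel n `` {X M'}"
    then have "(X M, X M') \<in> GAQ_rel n"
      using eq_equiv_class[OF _ equiv_GAQ_rel] in_GAQ by metis
    then show "M = M'" using inj M by (simp add: GAQ_rel_def)
  qed
  moreover have "card (set Ms) = length Ms"
    using distinct by (simp add: distinct_map distinct_card)
  ultimately show ?thesis by (simp add: card_image)
qed

section \<open>Models with an abelian group\<close>

type_synonym triple = "nat \<times> nat \<times> nat"

text \<open>The direct product of three cyclic groups. Models with one or two factors use trivial third
  and second factors, so that all models have elements of the same type.\<close>

definition cyclic3 :: "nat \<Rightarrow> nat \<Rightarrow> nat \<Rightarrow> triple monoid" where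
  "cyclic3 l m n = \<lparr>carrier = {..<l} \<times> {..<m} \<times> {..<n},
     monoid.mult = (\<lambda>(a, b, c) (a', b', c'). ((a + a') mod l, (b + b') mod m, (c + c') mod n)),
     one = (0, 0, 0)\<rparr>"

lemma group_cyclic3:
  assumes "l > 0" "m > 0" "n > 0"
  shows "group (cyclic3 l m n)"
proof (rule groupI)
  let ?Z = "cyclic3 l m n"
  fix x assume "x \<in> carrier ?Z"
  then obtain a b c where x: "x = (a, b, c)" "a < l" "b < m" "c < n"
    by (auto simp: cyclic3_def)
  have "((l - a) mod l, (m - b) mod m, (n - c) mod n) \<in> carrier ?Z"
    using assms by (simp add: cyclic3_def)
  moreover have "((l - a) mod l, (m - b) mod m, (n - c) mod n) \<otimes>\<^bsub>?Z\<^esub> x = \<one>\<^bsub>?Z\<^esub>"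
    using x by (simp add: cyclic3_def mod_simps)
  ultimately show "\<exists>y\<in>carrier ?Z. y \<otimes>\<^bsub>?Z\<^esub> x = \<one>\<^bsub>?Z\<^esub>" by blast
qed (use assms in \<open>auto simp: cyclic3_def mod_simps add.assoc\<close>)

text \<open>The linear map that sends the three standard generators to \<open>r\<close>, \<open>s\<close> and \<open>t\<close>.\<close>

definition linear3 :: "nat \<Rightarrow> nat \<Rightarrow> nat \<Rightarrow> triple \<Rightarrow> triple \<Rightarrow> triple \<Rightarrow> triple \<Rightarrow> triple" where
  "linear3 l m n = (\<lambda>(r1, r2, r3) (s1, s2, s3) (t1, t2, t3) (i, j, k).
     ((i * r1 + j * s1 + k * t1) mod l, (i * r2 + j * s2 + k * t2) mod m,
      (i * r3 + j * s3 + k * t3) mod n))"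

definition abelian_model :: "nat \<Rightarrow> nat \<Rightarrow> nat \<Rightarrow> triple \<Rightarrow> triple \<Rightarrow> triple \<Rightarrow> triple set \<Rightarrow> triple model" where
  "abelian_model l m n r s t E = (cyclic3 l m n, linear3 l m n r s t, E)"

definition cyclic_model :: "nat \<Rightarrow> nat \<Rightarrow> nat set \<Rightarrow> triple model" where
  "cyclic_model n a E = abelian_model n 1 1 (a, 0, 0) (0, 0, 0) (0, 0, 0) ((\<lambda>i. (i, 0, 0)) ` E)"

text \<open>Multiplication by \<open>a\<close> modulo \<open>n\<close>; the displacements are the multiples of \<open>1 - a\<close>, described here
  without subtraction of natural numbers.\<close>

definition affine_model :: "nat \<Rightarrow> nat \<Rightarrow> triple model" where
  "affine_model n a = cyclic_model n a {d \<in> {..<n}. \<exists>x\<in>{..<n}. (d + a * x) mod n = x}"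

context group_aut
begin

lemma pow_mod_period:
  assumes "u \<in> carrier G" "u [^] (l::nat) = \<one>"
  shows "u [^] (k mod l) = u [^] k"
proof -
  have "u [^] k = u [^] (l * (k div l) + k mod l)" by simp
  also have "\<dots> = (u [^] l) [^] (k div l) \<otimes> u [^] (k mod l)"
    using assms(1) by (simp only: nat_pow_mult nat_pow_pow)
  also have "\<dots> = u [^] (k mod l)" using assms by simp
  finally show ?thesis by simp
qed

lemma commute_pows:
  assumes "x \<in> carrier G" "y \<in> carrier G" "x \<otimes> y = y \<otimes> x"
  shows "x [^] (i::nat) \<otimes> y [^] (j::nat) = y [^] j \<otimes> x [^] i"
proof -
  have "x [^] i \<otimes> y = y \<otimes> x [^] i" by (rule group_commutes_pow[OF assms(3,1,2)])
  then show ?thesis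
    using group_commutes_pow[of y "x [^] i" j] assms by simp
qed

lemma commuting_triple_mult:
  assumes "a \<in> carrier G" "b \<in> carrier G" "c \<in> carrier G"
    "a' \<in> carrier G" "b' \<in> carrier G" "c' \<in> carrier G"
    and "b \<otimes> a' = a' \<otimes> b" "c \<otimes> a' = a' \<otimes> c" "c \<otimes> b' = b' \<otimes> c"
  shows "(a \<otimes> b \<otimes> c) \<otimes> (a' \<otimes> b' \<otimes> c') = (a \<otimes> a') \<otimes> (b \<otimes> b') \<otimes> (c \<otimes> c')"
proof -
  have swap: "x \<otimes> (y \<otimes> z) = y \<otimes> (x \<otimes> z)"
    if "x \<in> carrier G" "y \<in> carrier G" "z \<in> carrier G" "x \<otimes> y = y \<otimes> x" for x y z
    using that by (simp flip: m_assoc)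
  show ?thesis
    using assms by (simp add: m_assoc swap[of b a'] swap[of c a'] swap[of c b'])
qed

definition monomial :: "'a \<Rightarrow> 'a \<Rightarrow> 'a \<Rightarrow> triple \<Rightarrow> 'a" where
  "monomial u v w = (\<lambda>(i, j, k). u [^] i \<otimes> v [^] j \<otimes> w [^] k)"

lemma monomial_hom:
  assumes carr: "u \<in> carrier G" "v \<in> carrier G" "w \<in> carrier G"
    and comm: "u \<otimes> v = v \<otimes> u" "u \<otimes> w = w \<otimes> u" "v \<otimes> w = w \<otimes> v"
    and period: "u [^] l = \<one>" "v [^] m = \<one>" "w [^] n = \<one>"
  shows "monomial u v w \<in> hom (cyclic3 l m n) G"
proof (rule homI)
  fix x y :: triple
  obtain i j k i' j' k' where x: "x = (i, j, k)" and y: "y = (i', j', k')"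
    by (cases x, cases y) auto
  have "monomial u v w (x \<otimes>\<^bsub>cyclic3 l m n\<^esub> y) =
      (u [^] i \<otimes> u [^] i') \<otimes> (v [^] j \<otimes> v [^] j') \<otimes> (w [^] k \<otimes> w [^] k')"
    using carr period by (simp add: monomial_def cyclic3_def x y pow_mod_period nat_pow_mult)
  also have "\<dots> = monomial u v w x \<otimes> monomial u v w y"
    unfolding monomial_def x y prod.case using carr comm
    by (intro commuting_triple_mult[symmetric]) (simp_all add: commute_pows)
  finally show "monomial u v w (x \<otimes>\<^bsub>cyclic3 l m n\<^esub> y) = monomial u v w x \<otimes> monomial u v w y" .
qed (use carr in \<open>auto simp: monomial_def\<close>)

lemma monomial_inj:
  assumes carr: "u \<in> carrier G" "v \<in> carrier G" "w \<in> carrier G"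
    and comm: "u \<otimes> v = v \<otimes> u" "u \<otimes> w = w \<otimes> u" "v \<otimes> w = w \<otimes> v"
    and period: "u [^] l = \<one>" "v [^] m = \<one>" "w [^] n = \<one>" "l > 0" "m > 0" "n > 0"
    and indep: "\<And>i j k. i < l \<Longrightarrow> j < m \<Longrightarrow> k < n \<Longrightarrow>
      u [^] i \<otimes> v [^] j \<otimes> w [^] k = \<one> \<Longrightarrow> i = 0 \<and> j = 0 \<and> k = 0"
  shows "inj_on (monomial u v w) (carrier (cyclic3 l m n))"
proof -
  interpret h: group_hom "cyclic3 l m n" G "monomial u v w"
    using monomial_hom[OF carr comm period(1-3)] group_cyclic3 period
    by (simp add: group_hom_def group_hom_axioms_def is_group)
  have "kernel (cyclic3 l m n) G (monomial u v w) = {\<one>\<^bsub>cyclic3 l m n\<^esub>}"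
    using indep period by (auto simp: kernel_def cyclic3_def monomial_def)
  then show ?thesis by (simp add: h.inj_iff_trivial_ker)
qed

text \<open>Commuting elements \<open>u\<close>, \<open>v\<close>, \<open>w\<close> that are independent span a copy of the product of three cyclic
  groups, on which the automorphism is determined by the images of \<open>u\<close>, \<open>v\<close> and \<open>w\<close>.\<close>

lemma realizes_abelian_model:
  assumes carr: "u \<in> carrier G" "v \<in> carrier G" "w \<in> carrier G"
    and comm: "u \<otimes> v = v \<otimes> u" "u \<otimes> w = w \<otimes> u" "v \<otimes> w = w \<otimes> v"
    and period: "u [^] l = \<one>" "v [^] m = \<one>" "w [^] n = \<one>" "l > 0" "m > 0" "n > 0"
    and indep: "\<And>i j k. i < l \<Longrightarrow> j < m \<Longrightarrow> k < n \<Longrightarrow>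
      u [^] i \<otimes> v [^] j \<otimes> w [^] k = \<one> \<Longrightarrow> i = 0 \<and> j = 0 \<and> k = 0"
    and aut: "\<psi> u = monomial u v w r" "\<psi> v = monomial u v w s" "\<psi> w = monomial u v w t"
    and E: "monomial u v w ` E = D"
  shows "realizes (abelian_model l m n r s t E) G \<psi>"
proof -
  obtain r1 r2 r3 s1 s2 s3 t1 t2 t3
    where rst: "r = (r1, r2, r3)" "s = (s1, s2, s3)" "t = (t1, t2, t3)"
    by (cases r, cases s, cases t) auto
  have pow: "monomial u v w (a, b, c) [^] i = monomial u v w (i * a, i * b, i * c)" for a b c i
  proof -
    have "w [^] c \<otimes> (u [^] a \<otimes> v [^] b) = u [^] a \<otimes> (v [^] b \<otimes> w [^] c)"
      using commuting_triple_mult[of \<one> \<one> "w [^] c" "u [^] a" "v [^] b" \<one>] carr comm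
      by (simp add: commute_pows m_assoc)
    then have "(u [^] a \<otimes> v [^] b \<otimes> w [^] c) [^] i = (u [^] a \<otimes> v [^] b) [^] i \<otimes> (w [^] c) [^] i"
      using carr by (intro pow_mult_distrib) (simp_all add: m_assoc)
    also have "(u [^] a \<otimes> v [^] b) [^] i = (u [^] a) [^] i \<otimes> (v [^] b) [^] i"
      using carr comm by (intro pow_mult_distrib) (simp_all add: commute_pows)
    finally show ?thesis using carr by (simp add: monomial_def nat_pow_pow mult.commute)
  qed
  have add: "monomial u v w (a, b, c) \<otimes> monomial u v w (a', b', c') =
      monomial u v w (a + a', b + b', c + c')" for a b c a' b' c'
    unfolding monomial_def prod.case nat_pow_mult[symmetric, OF carr(1)]
      nat_pow_mult[symmetric, OF carr(2)] nat_pow_mult[symmetric, OF carr(3)]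
    using carr comm by (intro commuting_triple_mult) (simp_all add: commute_pows)
  have "monomial u v w (linear3 l m n r s t x) = \<psi> (monomial u v w x)" for x
  proof -
    obtain i j k where x: "x = (i, j, k)" by (cases x) auto
    have "\<psi> (monomial u v w x) = monomial u v w r [^] i \<otimes> monomial u v w s [^] j \<otimes> monomial u v w t [^] k"
      using carr unfolding aut[symmetric] by (simp add: x monomial_def)
    also have "\<dots> = monomial u v w (i * r1 + j * s1 + k * t1, i * r2 + j * s2 + k * t2, i * r3 + j * s3 + k * t3)"
      by (simp add: rst pow add)
    also have "\<dots> = monomial u v w (linear3 l m n r s t x)"
      using carr period by (simp add: monomial_def linear3_def rst x pow_mod_period)
    finally show ?thesis by simp
  qed
  then show ?thesis
    using monomial_hom[OF carr comm period(1-3)] monomial_inj[OF carr comm period indep] E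
    unfolding realizes_def abelian_model_def prod.case by blast
qed

lemma realizes_cyclic_model:
  assumes u: "u \<in> carrier G" "u [^] n = \<one>" "n > 0" "\<And>i. 0 < i \<Longrightarrow> i < n \<Longrightarrow> u [^] i \<noteq> \<one>"
    and a: "\<psi> u = u [^] a" and E: "(\<lambda>i. u [^] i) ` E = D"
  shows "realizes (cyclic_model n a E) G \<psi>"
  unfolding cyclic_model_def
proof (rule realizes_abelian_model[where u = u and v = \<one> and w = \<one>])
  show "monomial u \<one> \<one> ` (\<lambda>i. (i, 0, 0)) ` E = D"
    using u E by (simp add: image_image monomial_def)
qed (use u a in \<open>auto simp: monomial_def\<close>)

end

section \<open>Concrete groups and automorphisms\<close>

definition realizable :: "nat \<Rightarrow> triple model \<Rightarrow> bool" where
  "realizable n M \<longleftrightarrow> (\<exists>(G :: triple monoid) \<psi>. group_aut G \<psi> \<and> order G = n \<and> realizes M G \<psi>)"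

definition auto_check :: "triple monoid \<Rightarrow> (triple \<Rightarrow> triple) \<Rightarrow> bool" where
  "auto_check G \<psi> \<longleftrightarrow> \<psi> ` carrier G = carrier G \<and>
     (\<forall>x\<in>carrier G. \<forall>y\<in>carrier G. \<psi> (x \<otimes>\<^bsub>G\<^esub> y) = \<psi> x \<otimes>\<^bsub>G\<^esub> \<psi> y)"

text \<open>A decidable form of \<open>realizes\<close> for a given embedding \<open>c\<close>, whose injectivity is expressed by
  counting its values.\<close>

definition embed_check :: "(triple \<Rightarrow> triple) \<Rightarrow> triple model \<Rightarrow> triple monoid \<Rightarrow> (triple \<Rightarrow> triple) \<Rightarrow> bool" where
  "embed_check c M G \<psi> = (case M of (H, \<theta>, E) \<Rightarrow>
     c ` carrier H \<subseteq> carrier G \<and> card (c ` carrier H) = card (carrier H) \<and>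
     (\<forall>x\<in>carrier H. \<forall>y\<in>carrier H. c (x \<otimes>\<^bsub>H\<^esub> y) = c x \<otimes>\<^bsub>G\<^esub> c y) \<and>
     (\<forall>x\<in>carrier H. c (\<theta> x) = \<psi> (c x)) \<and> c ` E = displacements G \<psi>)"

lemma auto_check_group_aut:
  assumes "group G" "finite (carrier G)" "auto_check G \<psi>"
  shows "group_aut G \<psi>"
proof -
  have "bij_betw \<psi> (carrier G) (carrier G)"
    using assms by (auto simp: auto_check_def bij_betw_def intro: eq_card_imp_inj_on)
  then show ?thesis
    using assms by (auto simp: group_aut_def group_aut_axioms_def iso_def hom_def auto_check_def)
qed

lemma realizableI:
  assumes "group G" "finite (carrier G)" "card (carrier G) = n" "auto_check G \<psi>"
    and "finite (carrier (fst M))" "embed_check c M G \<psi>"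
  shows "realizable n M"
proof -
  have "realizes M G \<psi>"
    using assms(5,6) by (cases M) (auto simp: embed_check_def realizes_def hom_def intro!: bexI[of _ c] eq_card_imp_inj_on)
  then show ?thesis
    using assms auto_check_group_aut[of G \<psi>] by (auto simp: realizable_def order_def)
qed

lemma affine_group_aut:
  assumes "coprime a n" "n > 0"
  shows "group_aut (cyclic3 n 1 1) (linear3 n 1 1 (a, 0, 0) (0, 0, 0) (0, 0, 0))"
    (is "group_aut ?Z ?\<theta>")
proof -
  have fin: "finite (carrier ?Z)" by (simp add: cyclic3_def)
  have "inj_on ?\<theta> (carrier ?Z)"
  proof (rule inj_onI)
    fix x y assume xy: "x \<in> carrier ?Z" "y \<in> carrier ?Z" "?\<theta> x = ?\<theta> y"
    then obtain i j where ij: "x = (i, 0, 0)" "y = (j, 0, 0)" "i < n" "j < n"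
      by (auto simp: cyclic3_def)
    have "i = j" if "i \<le> j" "j < n" "(a * i) mod n = (a * j) mod n" for i j
    proof -
      have "n dvd a * j - a * i" using that mod_eq_dvd_iff_nat[of "a * i" "a * j" n] by simp
      then have "n dvd a * (j - i)" by (simp add: diff_mult_distrib2)
      then have "n dvd j - i" using assms by (metis coprime_commute coprime_dvd_mult_right_iff)
      then show ?thesis using that nat_dvd_not_less[of "j - i" n] by linarith
    qed
    from this[of i j] this[of j i] show "x = y"
      using ij xy by (cases "i \<le> j") (simp_all add: linear3_def mult.commute)
  qed
  moreover have "?\<theta> ` carrier ?Z \<subseteq> carrier ?Z" using assms by (auto simp: cyclic3_def linear3_def)
  ultimately have "bij_betw ?\<theta> (carrier ?Z) (carrier ?Z)"
    using fin by (simp add: bij_betw_def endo_inj_surj)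
  moreover have "?\<theta> \<in> hom ?Z ?Z"
    using assms by (auto simp: hom_def cyclic3_def linear3_def mod_simps algebra_simps)
  ultimately show ?thesis
    using fin group_cyclic3[of n 1 1] assms
    by (simp add: group_aut_def group_aut_axioms_def iso_def)
qed

text \<open>The model is the whole group, so the identity serves as the embedding.\<close>

lemma affine_model_realizable:
  assumes "coprime a n" "n > 0"
  shows "model (affine_model n a) \<and> realizable n (affine_model n a)"
proof -
  let ?Z = "cyclic3 n 1 1" and ?\<theta> = "linear3 n 1 1 (a, 0, 0) (0, 0, 0) (0, 0, 0)"
  interpret group_aut ?Z ?\<theta> by (rule affine_group_aut[OF assms])
  have E: "affine_model n a = (?Z, ?\<theta>, displacements ?Z ?\<theta>)"
    by (auto simp: affine_model_def cyclic_model_def abelian_model_def displacements_def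
        cyclic3_def linear3_def mult.commute mod_simps image_iff Bex_def)
  have "?\<theta> \<in> hom ?Z ?Z" using aut by (simp add: iso_def)
  moreover have "realizes (affine_model n a) ?Z ?\<theta>"
    unfolding E realizes_def by (auto intro!: bexI[of _ id] simp: hom_def)
  moreover have "order ?Z = n" by (simp add: order_def cyclic3_def card_cartesian_product)
  moreover have "displacements ?Z ?\<theta> \<subseteq> carrier ?Z" by (simp add: displacements_def)
  ultimately show ?thesis
    using group_aut_axioms is_group finite_carrier
    unfolding model_def E realizable_def prod.case by blast
qed

definition trivial_model :: "triple model" where "trivial_model = cyclic_model 1 0 {0}"

text \<open>If \<open>D = {\<one>, c}\<close>, then \<open>c\<close> is fixed, and its order \<open>m\<close> is all that matters.\<close>

definition two_model :: "nat \<Rightarrow> triple model" where "two_model m = cyclic_model m 1 {0, 1}"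

text \<open>The automorphism \<open>u \<mapsto> v\<close>, \<open>v \<mapsto> u\<^sup>a \<otimes> v\<^sup>b\<close> of a product of two cyclic groups of order \<open>m\<close>, with
  every element a displacement.\<close>

definition companion_model :: "nat \<Rightarrow> nat \<Rightarrow> nat \<Rightarrow> triple model" where
  "companion_model m a b = abelian_model m m 1 (0,1,0) (a,b,0) (0,0,0) ({..<m} \<times> {..<m} \<times> {..<1})"

text \<open>\<open>(i, j, k)\<close> is \<open>z\<^sup>i \<otimes> a\<^sup>j \<otimes> b\<^sup>k\<close> for generators with \<open>a \<otimes> a = b \<otimes> b = z\<close>, where \<open>z\<close> is a central
  involution and \<open>b \<otimes> a = z \<otimes> a \<otimes> b\<close>.\<close>

definition quaternion :: "triple monoid" where
  "quaternion = \<lparr>carrier = {..<2} \<times> {..<2} \<times> {..<2},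
     monoid.mult = (\<lambda>(i, j, k) (i', j', k').
       ((i + i' + k * j' + j * j' + k * k') mod 2, (j + j') mod 2, (k + k') mod 2)),
     one = (0, 0, 0)\<rparr>"

text \<open>\<open>(i, j, k)\<close> is \<open>f\<^sup>i \<otimes> t\<^sup>j \<otimes> z\<^sup>k\<close>, where \<open>f\<close> and \<open>t\<close> span a Klein four-group and the element \<open>z\<close> of order
  three permutes \<open>f\<close>, \<open>t\<close>, \<open>f \<otimes> t\<close> cyclically by conjugation: this is the alternating group of
  degree four.\<close>

definition alternating :: "triple monoid" where
  "alternating = \<lparr>carrier = {..<2} \<times> {..<2} \<times> {..<3},
     monoid.mult = (\<lambda>(i, j, k) (i', j', k').
       ((i + (if k = 0 then i' else if k = 1 then j' else i' + j')) mod 2,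
        (j + (if k = 0 then j' else if k = 1 then i' + j' else i')) mod 2, (k + k') mod 3)),
     one = (0, 0, 0)\<rparr>"

text \<open>\<open>(i, e, _)\<close> is \<open>r\<^sup>i \<otimes> s\<^sup>e\<close> for a rotation \<open>r\<close> of order \<open>m\<close> and a reflection \<open>s\<close>.\<close>

definition dihedral :: "nat \<Rightarrow> triple monoid" where
  "dihedral m = \<lparr>carrier = {..<m} \<times> {..<2} \<times> {..<1},
     monoid.mult = (\<lambda>(i, e, _) (j, f, _).
       ((i + (if e = 0 then j else (m - 1) * j)) mod m, (e + f) mod 2, 0)),
     one = (0, 0, 0)\<rparr>"

definition group_check :: "triple monoid \<Rightarrow> bool" where
  "group_check G \<longleftrightarrow> \<one>\<^bsub>G\<^esub> \<in> carrier G \<and>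
     (\<forall>x\<in>carrier G. \<one>\<^bsub>G\<^esub> \<otimes>\<^bsub>G\<^esub> x = x \<and> (\<exists>y\<in>carrier G. y \<otimes>\<^bsub>G\<^esub> x = \<one>\<^bsub>G\<^esub>)) \<and>
     (\<forall>x\<in>carrier G. \<forall>y\<in>carrier G. x \<otimes>\<^bsub>G\<^esub> y \<in> carrier G \<and>
       (\<forall>z\<in>carrier G. x \<otimes>\<^bsub>G\<^esub> y \<otimes>\<^bsub>G\<^esub> z = x \<otimes>\<^bsub>G\<^esub> (y \<otimes>\<^bsub>G\<^esub> z)))"

lemma group_check: "group_check G \<Longrightarrow> group G"
  by (rule groupI) (auto simp: group_check_def)

lemma group_dihedral:
  assumes "m > 0"
  shows "group (dihedral m)"
proof (rule groupI)
  fix x y z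
  assume "x \<in> carrier (dihedral m)" "y \<in> carrier (dihedral m)" "z \<in> carrier (dihedral m)"
  then obtain i e j f k g where "x = (i, e, 0)" "y = (j, f, 0)" "z = (k, g, 0)"
      "i < m" "j < m" "k < m" "e < 2" "f < 2" "g < 2"
    by (auto simp: dihedral_def)
  moreover have "((m - 1) * ((m - 1) * k)) mod m = k mod m"
  proof -
    have "(m - 1) * ((m - 1) * k) + m * k * 2 = k + m * (m * k)"
      using assms by (cases m) (simp_all add: algebra_simps)
    then show ?thesis by (metis mod_mult_self2 mult.assoc)
  qed
  then have "(i + ((m - 1) * j + (m - 1) * ((m - 1) * k))) mod m = (i + ((m - 1) * j + k)) mod m"
    by (metis mod_add_right_eq)
  moreover have "(i + (m - 1) * (l mod m)) mod m = (i + (m - 1) * l) mod m" for l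
    by (metis mod_add_right_eq mod_mult_right_eq)
  ultimately show "x \<otimes>\<^bsub>dihedral m\<^esub> y \<otimes>\<^bsub>dihedral m\<^esub> z =
      x \<otimes>\<^bsub>dihedral m\<^esub> (y \<otimes>\<^bsub>dihedral m\<^esub> z)"
    by (auto simp: dihedral_def mod_simps add.assoc distrib_left less_2_cases_iff)
next
  fix x assume "x \<in> carrier (dihedral m)"
  then obtain i e where x: "x = (i, e, 0)" "i < m" "e < 2" by (auto simp: dihedral_def)
  define y where "y = ((if e = 0 then (m - i) mod m else i), e, 0::nat)"
  have "i + (m - 1) * i = m * i" using assms by (cases m) simp_all
  then have "y \<in> carrier (dihedral m)" "y \<otimes>\<^bsub>dihedral m\<^esub> x = \<one>\<^bsub>dihedral m\<^esub>"
    using x assms by (auto simp: dihedral_def mod_simps less_2_cases_iff y_def)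
  then show "\<exists>y\<in>carrier (dihedral m). y \<otimes>\<^bsub>dihedral m\<^esub> x = \<one>\<^bsub>dihedral m\<^esub>" by blast
qed (use assms in \<open>auto simp: dihedral_def\<close>)

lemma group_quaternion: "group quaternion"
proof -
  have "group_check quaternion" by code_simp
  then show ?thesis by (rule group_check)
qed

lemma group_alternating: "group alternating"
proof -
  have "group_check alternating" by code_simp
  then show ?thesis by (rule group_check)
qed

text \<open>The automorphism \<open>a \<mapsto> b \<mapsto> b \<otimes> a \<mapsto> a\<close> of order three.\<close>

definition quaternion_aut :: "triple \<Rightarrow> triple" where
  "quaternion_aut = (\<lambda>(i, j, k). ((i + k) mod 2, k, (j + k) mod 2))"

definition quaternion_model :: "triple model" where
  "quaternion_model = (quaternion, quaternion_aut, {(0,0,0), (0,1,0), (0,0,1), (1,1,1)})"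

text \<open>The automorphism \<open>f \<mapsto> f\<close>, \<open>t \<mapsto> f \<otimes> t\<close>, \<open>z \<mapsto> f\<^sup>e \<otimes> z \<otimes> z\<close>.\<close>

definition alternating_aut :: "nat \<Rightarrow> triple \<Rightarrow> triple" where
  "alternating_aut e = (\<lambda>(i, j, k).
     if k = 0 then ((i + j) mod 2, j, 0)
     else if k = 1 then ((i + j + e) mod 2, j, 2)
     else ((i + j) mod 2, (j + e) mod 2, 1))"

definition alternating_model :: "nat \<Rightarrow> triple model" where
  "alternating_model e =
     (alternating, alternating_aut e, displacements alternating (alternating_aut e))"

section \<open>At most four displacements\<close>

lemma permutation_of_three:
  assumes "x' \<in> {x, y, z}" "y' \<in> {x, y, z}" "z' \<in> {x, y, z}" "x' \<noteq> y'" "y' \<noteq> z'" "x' \<noteq> z'"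
  shows "x' = y \<and> y' = z \<and> z' = x \<or> x' = z \<and> z' = y \<and> y' = x \<or> x' = x \<and> y' = z \<and> z' = y \<or>
    y' = y \<and> x' = z \<and> z' = x \<or> z' = z \<and> x' = y \<and> y' = x \<or> x' = x \<and> y' = y \<and> z' = z"
  using assms by auto

context group_aut
begin

lemma pow_card_subgroup:
  assumes "subgroup K G" "x \<in> K"
  shows "x [^] card K = \<one>"
proof -
  have "x [^]\<^bsub>G\<lparr>carrier := K\<rparr>\<^esub> order (G\<lparr>carrier := K\<rparr>) = \<one>\<^bsub>G\<lparr>carrier := K\<rparr>\<^esub>"
    using group.pow_order_eq_1[OF subgroup_imp_group[OF assms(1)]] assms(2) by simp
  then show ?thesis by (simp add: order_def nat_pow_consistent[symmetric])
qed

lemma twisted_exchange: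
  assumes "x \<in> carrier G" "d \<in> D"
  obtains e where "e \<in> D" "x \<otimes> d = e \<otimes> \<psi> x"
proof
  show "x \<otimes> d \<otimes> inv (\<psi> x) \<in> D" by (rule twisted_action[OF assms])
  show "x \<otimes> d = x \<otimes> d \<otimes> inv (\<psi> x) \<otimes> \<psi> x" using assms by (simp add: m_assoc)
qed

lemma displacement_witness:
  assumes "d \<in> D"
  obtains x where "x \<in> carrier G" "d \<otimes> \<psi> x = x"
  using assms that unfolding displacements_def by blast

lemma fixedI: "x \<in> carrier G \<Longrightarrow> \<psi> x = x \<Longrightarrow> x \<in> fixed"
  by (simp add: fixed_def del: fixed_closed)

lemma fixedD: "x \<in> fixed \<Longrightarrow> \<psi> x = x"
  by (simp add: fixed_def del: fixed_closed)

lemma displacements_insert: "D = insert \<one> (D - {\<one>})"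
  using one_displacement by blast

lemma realizes_trivial_model:
  assumes "card D = 1"
  shows "realizes trivial_model G \<psi>"
proof -
  obtain x where "D = {x}" using assms by (rule card_1_singletonE)
  then have "D = {\<one>}" using one_displacement by (metis singletonD)
  then show ?thesis unfolding trivial_model_def
    by (intro realizes_cyclic_model[where u = \<one>]) simp_all
qed

text \<open>As \<open>\<psi>\<close> permutes \<open>D\<close> and preserves \<open>\<one>\<close>, it fixes \<open>c\<close>; so the order of \<open>c\<close> divides the number of
  fixed points, which is half the order of the group.\<close>

lemma realizes_two_model:
  assumes "card D = 2"
  shows "\<exists>m. m > 1 \<and> m dvd order G div 2 \<and> realizes (two_model m) G \<psi>"
proof -
  obtain c where D: "D = {\<one>, c}" and c: "c \<noteq> \<one>"
  proof -
    have "card (D - {\<one>}) = 1" using assms by simp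
    then obtain c where "D - {\<one>} = {c}" by (metis card_1_singletonE)
    then show ?thesis using displacements_insert that[of c] by blast
  qed
  have cG: "c \<in> carrier G" using D displacements_closed by blast
  have "\<psi> c \<in> {\<one>, c}" using D aut_displacement[of c] by simp
  then have \<psi>c: "\<psi> c = c" using c cG by simp
  then have "c \<in> fixed" using cG by (rule fixedI[rotated])
  then have "c [^] card fixed = \<one>" by (rule pow_card_subgroup[OF fixed_subgroup])
  moreover have "card fixed = order G div 2" using card_displacements assms by simp
  ultimately have dvd: "ord c dvd order G div 2" using cG by (simp add: pow_eq_id)
  have "ord c > 1" using c cG ord_ge_1[of c] ord_eq_1[of c] by simp
  moreover have "realizes (two_model (ord c)) G \<psi>"
    unfolding two_model_def
  proof (rule realizes_cyclic_model[where u = c])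
    show "c [^] i \<noteq> \<one>" if "0 < i" "i < ord c" for i
      using that cG by (auto simp: pow_eq_id dest: dvd_imp_le)
  qed (use cG \<psi>c D \<open>ord c > 1\<close> in auto)
  ultimately show ?thesis using dvd by blast
qed

text \<open>A generator \<open>g\<close> is sent to another generator \<open>g\<^sup>a\<close>, so \<open>a\<close> is a unit.\<close>

lemma realizes_affine_model:
  assumes g: "g \<in> carrier G" "ord g = order G"
  shows "\<exists>a<order G. coprime a (order G) \<and> realizes (affine_model (order G) a) G \<psi>"
proof -
  let ?n = "order G"
  have n: "?n > 0" by (rule order_pos)
  have inj: "g [^] i = g [^] j \<longleftrightarrow> i mod ?n = j mod ?n" for i j :: nat
  proof
    assume "g [^] i = g [^] j"
    then have "g [^] (i mod ?n) = g [^] (j mod ?n)"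
      using g pow_order_eq_1[OF g(1)] by (simp add: pow_mod_period)
    then show "i mod ?n = j mod ?n"
      using inj_onD[OF ord_inj[OF g(1)], of "i mod ?n" "j mod ?n"] g n
      by (simp add: less_Suc_eq_le[symmetric])
  next
    assume "i mod ?n = j mod ?n"
    then show "g [^] i = g [^] j"
      using g pow_order_eq_1[OF g(1)] by (metis pow_mod_period)
  qed
  have gen: "\<exists>i<?n. x = g [^] i" if "x \<in> carrier G" for x
  proof -
    have "inj_on (\<lambda>i::nat. g [^] i) {..<?n}" using inj by (auto simp: inj_on_def)
    then have "card ((\<lambda>i::nat. g [^] i) ` {..<?n}) = ?n" by (simp add: card_image)
    then have "(\<lambda>i::nat. g [^] i) ` {..<?n} = carrier G"
      using g by (intro card_subset_eq) (auto simp: order_def)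
    then show ?thesis using that by auto
  qed
  obtain a where a: "a < ?n" "\<psi> g = g [^] a" using gen[of "\<psi> g"] g by auto
  have "coprime a ?n"
  proof -
    have "ord (g [^] a) = ord g"
    proof (rule ord_unique[THEN iffD2])
      show "\<forall>k. (g [^] a) [^] k = \<one> \<longleftrightarrow> ord g dvd k"
      proof
        fix k :: nat
        have "(g [^] a) [^] k = \<psi> (g [^] k)" using g a by simp
        then have "(g [^] a) [^] k = \<one> \<longleftrightarrow> g [^] k = \<one>" using g by (simp del: aut_pow)
        then show "(g [^] a) [^] k = \<one> \<longleftrightarrow> ord g dvd k" using g by (simp add: pow_eq_id)
      qed
    qed (use g in auto)
    then show ?thesis using pow_ord_eq_ord_iff[OF finite_carrier g(1)] g by simp
  qed
  moreover have "realizes (affine_model ?n a) G \<psi>"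
    unfolding affine_model_def
  proof (rule realizes_cyclic_model[where u = g])
    show "g [^] i \<noteq> \<one>" if "0 < i" "i < ?n" for i
      using that inj[of i 0] by simp
    have "g [^] d \<in> D \<longleftrightarrow> (\<exists>x<?n. (d + a * x) mod ?n = x)" for d
    proof -
      have "g [^] d \<in> D \<longleftrightarrow> (\<exists>x<?n. g [^] d \<otimes> \<psi> (g [^] x) = g [^] x)"
      proof
        assume "g [^] d \<in> D"
        then obtain x where "x \<in> carrier G" "g [^] d \<otimes> \<psi> x = x" by (rule displacement_witness)
        then show "\<exists>x<?n. g [^] d \<otimes> \<psi> (g [^] x) = g [^] x" using gen by metis
      next
        assume "\<exists>x<?n. g [^] d \<otimes> \<psi> (g [^] x) = g [^] x"
        then show "g [^] d \<in> D" unfolding displacements_def using g nat_pow_closed by blast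
      qed
      moreover have "g [^] d \<otimes> \<psi> (g [^] x) = g [^] (d + a * x)" for x
        using g a by (simp add: nat_pow_pow nat_pow_mult)
      ultimately show ?thesis by (auto simp: inj)
    qed
    then have "(\<lambda>i. g [^] i) ` {d \<in> {..<?n}. \<exists>x\<in>{..<?n}. (d + a * x) mod ?n = x} =
        {x. \<exists>d<?n. x = g [^] d \<and> x \<in> D}" by (auto simp: Bex_def)
    also have "\<dots> = D" using gen displacements_closed by blast
    finally show "(\<lambda>i. g [^] i) ` {d \<in> {..<?n}. \<exists>x\<in>{..<?n}. (d + a * x) mod ?n = x} = D" .
  qed (use g a n pow_order_eq_1 in auto)
  ultimately show ?thesis using a by blast
qed

lemma realizes_affine_model_prime:
  assumes "prime (order G)"
  shows "\<exists>a<order G. coprime a (order G) \<and> realizes (affine_model (order G) a) G \<psi>"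
proof -
  have "card (carrier G) > 1" using assms prime_gt_1_nat by (simp add: order_def)
  then obtain g where g: "g \<in> carrier G" "g \<noteq> \<one>"
    by (metis card_1_singleton_iff card_eq_0_iff finite_carrier is_singletonI' is_singleton_altdef less_irrefl_nat not_one_less_zero one_closed)
  have "ord g = 1 \<or> ord g = order G"
    using assms ord_dvd_group_order[OF g(1)] by (simp add: prime_nat_iff)
  then have "ord g = order G" using g ord_eq_1[of g] by auto
  then show ?thesis using g realizes_affine_model by blast
qed

text \<open>Either \<open>\<psi>\<close> swaps the two nontrivial displacements, or it fixes them. In the second case
  \<open>a \<otimes> b \<otimes> inv a = a \<otimes> b \<otimes> inv (\<psi> a)\<close> is a displacement, which can only be \<open>b\<close>.\<close>

lemma three_displacements_cases:
  assumes "card D = 3"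
  obtains (swap) a b where "D = {\<one>, a, b}" "distinct [\<one>, a, b]" "\<psi> a = b" "\<psi> b = a"
  | (pointwise) a b where "D = {\<one>, a, b}" "distinct [\<one>, a, b]" "a \<in> fixed" "b \<in> fixed" "a \<otimes> b = b \<otimes> a"
proof -
  obtain a b where D: "D = {\<one>, a, b}" and ne: "a \<noteq> \<one>" "b \<noteq> \<one>" "a \<noteq> b"
  proof -
    have "card (D - {\<one>}) = 2" using assms by simp
    then obtain a b where "D - {\<one>} = {a, b}" "a \<noteq> b" by (metis card_2_iff)
    then show ?thesis using displacements_insert that[of a b] by blast
  qed
  have G: "a \<in> carrier G" "b \<in> carrier G" using D displacements_closed by blast+
  have mem: "\<psi> a \<in> {a, b}" "\<psi> b \<in> {a, b}"
    using aut_displacement[of a] aut_displacement[of b] ne G by (auto simp: D)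
  show ?thesis
  proof (cases "\<psi> a = a")
    case True
    then have \<psi>b: "\<psi> b = b" using mem ne G aut_eq_iff[of a b] by auto
    obtain e where "e \<in> D" "a \<otimes> b = e \<otimes> \<psi> a" using twisted_exchange[of a b] D G by auto
    then have "a \<otimes> b = b \<otimes> a" using True ne G by (auto simp: D)
    then show ?thesis using pointwise[OF D _ fixedI[OF G(1) True] fixedI[OF G(2) \<psi>b]] ne by auto
  next
    case False
    then have "\<psi> a = b" "\<psi> b = a" using mem ne G aut_eq_iff[of a b] by auto
    then show ?thesis using swap[OF D] ne by auto
  qed
qed

text \<open>The displacement \<open>a \<otimes> inv (\<psi> a)\<close> is neither \<open>\<one>\<close> nor \<open>a\<close>, so \<open>a = b \<otimes> b\<close>; applying \<open>\<psi>\<close> gives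
  \<open>b = a \<otimes> a\<close>, and \<open>a\<close> has order three.\<close>

lemma realizes_three_swap:
  assumes D: "D = {\<one>, a, b}" "distinct [\<one>, a, b]" and \<psi>: "\<psi> a = b" "\<psi> b = a"
  shows "realizes (cyclic_model 3 2 {..<3}) G \<psi>"
proof (rule realizes_cyclic_model[where u = a])
  have [simp]: "a \<in> carrier G" "b \<in> carrier G" using D displacements_closed by blast+
  obtain e where "e \<in> D" "a \<otimes> \<one> = e \<otimes> \<psi> a" using twisted_exchange[of a \<one>] D by auto
  then have a: "a = b \<otimes> b" using D \<psi> by auto
  then have b: "b = a \<otimes> a" using \<psi> aut_mult[of b b] by simp
  have "b \<otimes> a \<otimes> a = \<one> \<otimes> a" using a b by (simp add: m_assoc)
  then have "b \<otimes> a = \<one>" by (simp del: l_one)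
  then show "a [^] (3::nat) = \<one>" using b by (simp add: numeral_3_eq_3)
  show "a [^] i \<noteq> \<one>" if "0 < i" "i < 3" for i :: nat
  proof -
    have "i = 1 \<or> i = 2" using that by auto
    then show ?thesis using D b by (auto simp: numeral_2_eq_2)
  qed
  show "\<psi> a = a [^] (2::nat)" using \<psi> b by (simp add: numeral_2_eq_2)
  have "{..<3::nat} = {0, 1, 2}" by auto
  then show "(\<lambda>i. a [^] i) ` {..<3::nat} = D" using b by (auto simp: D numeral_2_eq_2)
qed (use D displacements_closed in auto)

lemma left_swap:
  assumes "x \<otimes> y = w \<otimes> v" "x \<in> carrier G" "y \<in> carrier G" "z \<in> carrier G" "w \<in> carrier G" "v \<in> carrier G"
  shows "x \<otimes> (y \<otimes> z) = w \<otimes> (v \<otimes> z)"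
  using assms by (simp flip: m_assoc)

text \<open>The cases are the cycle types of \<open>\<psi>\<close> on the three nontrivial displacements.\<close>

lemma four_displacements_cases:
  assumes "card D = 4"
  obtains a b c where "D = {\<one>, a, b, c}" "distinct [\<one>, a, b, c]" "\<psi> a = b" "\<psi> b = c" "\<psi> c = a"
  | f b c where "D = {\<one>, f, b, c}" "distinct [\<one>, f, b, c]" "\<psi> f = f" "\<psi> b = c" "\<psi> c = b"
  | "D \<subseteq> fixed"
proof -
  have "card (D - {\<one>}) = 3" using assms by simp
  then obtain x y z where "D - {\<one>} = {x, y, z}" and xyz: "x \<noteq> y" "y \<noteq> z" "x \<noteq> z"
    by (metis card_3_iff)
  then have D: "D = {\<one>, x, y, z}" and ne: "\<one> \<notin> {x, y, z}" using displacements_insert by blast+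
  have G: "x \<in> carrier G" "y \<in> carrier G" "z \<in> carrier G" using D displacements_closed by blast+
  have mem: "\<psi> x \<in> {x, y, z}" "\<psi> y \<in> {x, y, z}" "\<psi> z \<in> {x, y, z}"
    using aut_displacement[of x] aut_displacement[of y] aut_displacement[of z] G ne
    by (auto simp: D simp del: aut_displacement)
  have inj: "\<psi> x \<noteq> \<psi> y" "\<psi> y \<noteq> \<psi> z" "\<psi> x \<noteq> \<psi> z" using G xyz by simp_all
  have perm: "{\<one>, x, y, z} = {\<one>, y, x, z}" "{\<one>, x, y, z} = {\<one>, z, x, y}"
    "{\<one>, x, y, z} = {\<one>, x, z, y}" by auto
  consider "\<psi> x = y" "\<psi> y = z" "\<psi> z = x" | "\<psi> x = z" "\<psi> z = y" "\<psi> y = x"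
    | "\<psi> x = x" "\<psi> y = z" "\<psi> z = y" | "\<psi> y = y" "\<psi> x = z" "\<psi> z = x"
    | "\<psi> z = z" "\<psi> x = y" "\<psi> y = x" | "\<psi> x = x" "\<psi> y = y" "\<psi> z = z"
    using permutation_of_three[OF mem inj] by blast
  then show ?thesis
  proof cases
    case 1 then show ?thesis using that(1)[of x y z] D ne xyz by auto
  next
    case 2 then show ?thesis using that(1)[of x z y] D ne xyz perm by auto
  next
    case 3 then show ?thesis using that(2)[of x y z] D ne xyz by auto
  next
    case 4 then show ?thesis using that(2)[of y x z] D ne xyz perm by auto
  next
    case 5 then show ?thesis using that(2)[of z x y] D ne xyz perm by auto
  next
    case 6
    have "\<one> \<in> fixed" "x \<in> fixed" "y \<in> fixed" "z \<in> fixed"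
      using fixedI[OF one_closed aut_one] fixedI[OF G(1) 6(1)] fixedI[OF G(2) 6(2)] fixedI[OF G(3) 6(3)] by blast+
    then have "D \<subseteq> fixed" unfolding D by blast
    then show ?thesis by (rule that(3))
  qed
qed

text \<open>The displacement \<open>a \<otimes> inv b\<close> is \<open>b\<close> or \<open>c\<close>. If it were \<open>b\<close>, repeated application of \<open>\<psi>\<close> would
  show that each of \<open>a\<close>, \<open>b\<close>, \<open>c\<close> is the square of the next, so that \<open>a\<close> would have order seven.
  If it is \<open>c\<close>, the relations are those of the standard generators of the quaternion group, or of
  its quotient, the Klein four-group.\<close>

lemma four_displacements_three_cycle:
  assumes D: "D = {\<one>, a, b, c}" and ne: "distinct [\<one>, a, b, c]"
    and \<psi>: "\<psi> a = b" "\<psi> b = c" "\<psi> c = a" and no7: "\<not> 7 dvd order G"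
  shows "a = c \<otimes> b" "b = a \<otimes> c" "c = b \<otimes> a" "b \<otimes> b = a \<otimes> a" "c \<otimes> c = a \<otimes> a"
    "(a \<otimes> a) \<otimes> (a \<otimes> a) = \<one>" "a \<otimes> a \<in> fixed"
proof -
  have G [simp]: "a \<in> carrier G" "b \<in> carrier G" "c \<in> carrier G" using D displacements_closed by blast+
  obtain e where e: "e \<in> D" "a \<otimes> \<one> = e \<otimes> \<psi> a" using twisted_exchange[of a \<one>] D by auto
  have "a \<noteq> b \<otimes> b"
  proof
    assume a: "a = b \<otimes> b"
    then have b: "b = c \<otimes> c" using \<psi> aut_mult[of b b] by simp
    then have c: "c = a \<otimes> a" using \<psi> aut_mult[of c c] by simp
    have "c = a [^] (2::nat)" using c by (simp add: numeral_2_eq_2)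
    then have "b = a [^] (4::nat)" using b by (simp add: nat_pow_mult)
    then have "b \<otimes> b = a [^] (8::nat)" by (simp add: nat_pow_mult)
    then have "a = a [^] (8::nat)" using a by simp
    then have "a [^] (7::nat) \<otimes> a = \<one> \<otimes> a" by (simp add: eval_nat_numeral)
    then have "ord a dvd 7" by (simp add: pow_eq_id[symmetric] del: l_one)
    then have "ord a = 1 \<or> ord a = 7" using prime_nat_iff[of 7] by auto
    then show False using no7 ne ord_dvd_group_order[of a] ord_eq_1[of a] by auto
  qed
  then show a: "a = c \<otimes> b" using e D \<psi> ne by auto
  then show b: "b = a \<otimes> c" using \<psi> aut_mult[of c b] by simp
  then show c: "c = b \<otimes> a" using \<psi> aut_mult[of a c] by simp
  have "a \<otimes> a = (a \<otimes> c) \<otimes> b" using a by (simp add: m_assoc)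
  then show bb: "b \<otimes> b = a \<otimes> a" using b by simp
  then have "c \<otimes> c = b \<otimes> b" using \<psi> aut_mult[of a a] aut_mult[of b b] by simp
  then show cc: "c \<otimes> c = a \<otimes> a" using bb by simp
  have cbc: "c \<otimes> b \<otimes> c = b" using a b by simp
  have "(b \<otimes> b) \<otimes> (b \<otimes> b) \<otimes> b = (b \<otimes> b) \<otimes> b \<otimes> (b \<otimes> b)"
    by (simp add: m_assoc)
  also have "\<dots> = (c \<otimes> c) \<otimes> b \<otimes> (c \<otimes> c)" using bb cc by simp
  also have "\<dots> = c \<otimes> (c \<otimes> b \<otimes> c) \<otimes> c" by (simp add: m_assoc)
  also have "\<dots> = \<one> \<otimes> b" using cbc by simp
  finally show "(a \<otimes> a) \<otimes> (a \<otimes> a) = \<one>" using bb by (simp del: l_one)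
  show "a \<otimes> a \<in> fixed" using \<psi> bb by (intro fixedI) simp_all
qed

lemma realizes_companion_model:
  assumes m: "m > 0" "u [^] m = \<one>" "\<psi> u [^] m = \<one>"
    and u: "u \<in> carrier G" "u \<otimes> \<psi> u = \<psi> u \<otimes> u"
    and rel: "\<psi> (\<psi> u) = u [^] a \<otimes> \<psi> u [^] b"
    and indep: "\<And>i j. i < m \<Longrightarrow> j < m \<Longrightarrow> u [^] i \<otimes> \<psi> u [^] j = \<one> \<Longrightarrow> i = 0 \<and> j = 0"
    and D: "(\<lambda>(i, j). u [^] i \<otimes> \<psi> u [^] j) ` ({..<m} \<times> {..<m}) = D"
  shows "realizes (companion_model m a b) G \<psi>"
  unfolding companion_model_def
proof (rule realizes_abelian_model[where u = u and v = "\<psi> u" and w = \<one>])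
  have "{..<m} \<times> {..<m} \<times> {..<1} = (\<lambda>(i, j). (i, j, 0::nat)) ` ({..<m} \<times> {..<m})" by auto
  then have "monomial u (\<psi> u) \<one> ` ({..<m} \<times> {..<m} \<times> {..<1}) =
      (\<lambda>(i, j). u [^] i \<otimes> \<psi> u [^] j) ` ({..<m} \<times> {..<m})"
    using u by (simp add: image_image monomial_def case_prod_unfold)
  then show "monomial u (\<psi> u) \<one> ` ({..<m} \<times> {..<m} \<times> {..<1}) = D" using D by simp
qed (use assms in \<open>auto simp: monomial_def\<close>)

lemma realizes_klein:
  assumes D: "D = {\<one>, a, b, c}" and ne: "distinct [\<one>, a, b, c]"
    and \<psi>: "\<psi> a = b" "\<psi> b = c" "\<psi> c = a"
    and sq: "a \<otimes> a = \<one>" and c: "a \<otimes> b = c" "b \<otimes> a = c" "b \<otimes> b = \<one>"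
  shows "realizes (companion_model 2 1 1) G \<psi>"
proof (rule realizes_companion_model[where u = a])
  have G [simp]: "a \<in> carrier G" "b \<in> carrier G" "c \<in> carrier G" using D displacements_closed by blast+
  have two: "{..<2::nat} = {0, 1}" by auto
  show "i = 0 \<and> j = 0" if "i < 2" "j < 2" "a [^] i \<otimes> \<psi> a [^] j = \<one>" for i j :: nat
  proof -
    have "i \<in> {0, 1}" "j \<in> {0, 1}" using that two by auto
    then show ?thesis using that(3) ne c by (auto simp: \<psi>)
  qed
  show "(\<lambda>(i, j). a [^] i \<otimes> \<psi> a [^] j) ` ({..<2::nat} \<times> {..<2::nat}) = D"
    using c unfolding two D by (auto simp: \<psi> insert_commute)
qed (use D displacements_closed \<psi> sq c in \<open>auto simp: numeral_2_eq_2\<close>)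

text \<open>The relations rewrite every product of \<open>a\<close> and \<open>b\<close> to the normal form
  \<open>z\<^sup>i \<otimes> a\<^sup>j \<otimes> b\<^sup>k\<close> with \<open>z = a \<otimes> a\<close>.\<close>

lemma realizes_quaternion_model:
  assumes D: "D = {\<one>, a, b, c}" and ne: "distinct [\<one>, a, b, c]"
    and \<psi>: "\<psi> a = b" "\<psi> b = c" "\<psi> c = a"
    and rel: "a = c \<otimes> b" "c = b \<otimes> a" "b \<otimes> b = a \<otimes> a" "c \<otimes> c = a \<otimes> a"
    and e: "(a \<otimes> a) \<otimes> (a \<otimes> a) = \<one>" "a \<otimes> a \<noteq> \<one>"
  shows "realizes quaternion_model G \<psi>"
proof -
  have G [simp]: "a \<in> carrier G" "b \<in> carrier G" "c \<in> carrier G" using D displacements_closed by blast+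
  define z where "z = a \<otimes> a"
  have z [simp]: "z \<in> carrier G" "z \<otimes> z = \<one>" "z \<noteq> \<one>" using e by (simp_all add: z_def)
  have za: "a \<otimes> z = z \<otimes> a" by (simp add: z_def m_assoc)
  have zb: "b \<otimes> z = z \<otimes> b" unfolding z_def using rel(3) by (metis G(2) m_assoc)
  have aa: "a \<otimes> a = z" and bb: "b \<otimes> b = z" using rel by (simp_all add: z_def)
  have "a \<otimes> b = c \<otimes> (b \<otimes> b)" using rel(1) by (simp add: m_assoc)
  then have ab: "a \<otimes> b = c \<otimes> z" using bb by simp
  have cz: "c \<otimes> z = z \<otimes> c" using rel(2) za zb by (simp add: m_assoc left_swap[OF zb])
  have "z \<otimes> (z \<otimes> c) = c" by (simp flip: m_assoc)
  then have c: "c = z \<otimes> (a \<otimes> b)" using ab cz by simp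
  then have ba: "b \<otimes> a = z \<otimes> (a \<otimes> b)" using rel(2) by simp
  note swaps = za zb aa bb ba left_swap[OF za] left_swap[OF zb]
  have absorb: "a \<otimes> (a \<otimes> x) = z \<otimes> x" "b \<otimes> (b \<otimes> x) = z \<otimes> x" "z \<otimes> (z \<otimes> x) = x"
    "b \<otimes> (a \<otimes> x) = z \<otimes> (a \<otimes> (b \<otimes> x))" if "x \<in> carrier G" for x
    using that aa bb ba z by (simp_all flip: m_assoc)
  define h where "h = monomial z a b"
  have two: "i = 0 \<or> i = 1" if "i < 2" for i :: nat using that by auto
  have hom: "h \<in> hom quaternion G"
  proof (rule homI)
    show "h x \<in> carrier G" for x by (simp add: h_def monomial_def split: prod.split)
    fix x y assume "x \<in> carrier quaternion" "y \<in> carrier quaternion"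
    then obtain i j k i' j' k' where x: "x = (i, j, k)" "i < 2" "j < 2" "k < 2"
      and y: "y = (i', j', k')" "i' < 2" "j' < 2" "k' < 2"
      by (auto simp: quaternion_def)
    show "h (x \<otimes>\<^bsub>quaternion\<^esub> y) = h x \<otimes> h y"
      using two[OF x(2)] two[OF x(3)] two[OF x(4)] two[OF y(2)] two[OF y(3)] two[OF y(4)]
      unfolding x(1) y(1)
      by (elim disjE) (simp_all add: h_def monomial_def quaternion_def swaps absorb m_assoc)
  qed
  interpret h: group_hom quaternion G h
    using hom group_quaternion by (simp add: group_hom_def group_hom_axioms_def is_group)
  have z_root: "z \<otimes> x \<noteq> \<one>" if "x \<in> carrier G" "x \<otimes> x = z" for x
  proof
    assume "z \<otimes> x = \<one>"
    then have "z \<otimes> (z \<otimes> x) = z" by simp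
    then have "x = z" using that absorb by simp
    then show False using that z by auto
  qed
  have cc: "c \<otimes> c = z" using rel(4) aa by simp
  have za1: "z \<otimes> a \<noteq> \<one>" and zb1: "z \<otimes> b \<noteq> \<one>" and "z \<otimes> c \<noteq> \<one>"
    using z_root[OF G(1) aa] z_root[OF G(2) bb] z_root[OF G(3) cc] .
  then have ab1: "a \<otimes> b \<noteq> \<one>" using ab cz by simp
  have c1: "z \<otimes> (a \<otimes> b) \<noteq> \<one>" using ne c by auto
  have "x = \<one>\<^bsub>quaternion\<^esub>" if x_in: "x \<in> carrier quaternion" and hx: "h x = \<one>" for x
  proof -
    obtain i j k where x: "x = (i, j, k)" "i < 2" "j < 2" "k < 2"
      using x_in by (auto simp: quaternion_def)
    show ?thesis
      using two[OF x(2)] two[OF x(3)] two[OF x(4)] hx za1 zb1 ab1 c1 ne unfolding x(1)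
      by (elim disjE) (simp_all add: h_def monomial_def quaternion_def m_assoc)
  qed
  then have "kernel quaternion G h = {\<one>\<^bsub>quaternion\<^esub>}"
    by (auto simp: kernel_def)
  then have inj: "inj_on h (carrier quaternion)" by (simp add: h.inj_iff_trivial_ker)
  have \<psi>z: "\<psi> z = z" using \<psi> bb by (simp add: z_def)
  have "h (quaternion_aut x) = \<psi> (h x)" if x_in: "x \<in> carrier quaternion" for x
  proof -
    obtain i j k where x: "x = (i, j, k)" "i < 2" "j < 2" "k < 2"
      using x_in by (auto simp: quaternion_def)
    show ?thesis
      using two[OF x(2)] two[OF x(3)] two[OF x(4)] unfolding x(1)
      by (elim disjE)
        (simp_all add: h_def monomial_def quaternion_aut_def \<psi>(1) \<psi>(2) \<psi>z c swaps absorb m_assoc)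
  qed
  moreover have "h ` {(0,0,0), (0,1,0), (0,0,1), (1,1,1)} = D"
    using c by (simp add: D h_def monomial_def m_assoc)
  ultimately show ?thesis using hom inj unfolding realizes_def quaternion_model_def prod.case by blast
qed

lemma pow_coprime_eq_one:
  assumes "x \<in> carrier G" "x [^] (k::nat) = \<one>" "coprime k (order G)"
  shows "x = \<one>"
proof -
  have "ord x dvd k" "ord x dvd order G"
    using assms by (simp_all add: pow_eq_id[symmetric] pow_order_eq_1)
  then have "ord x = 1" using assms(3) by (metis coprime_common_divisor_nat)
  then show ?thesis using assms(1) ord_eq_1[of x] by auto
qed

lemma monomial_order_dvd:
  assumes carr: "u \<in> carrier G" "v \<in> carrier G" "w \<in> carrier G"
    and comm: "u \<otimes> v = v \<otimes> u" "u \<otimes> w = w \<otimes> u" "v \<otimes> w = w \<otimes> v"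
    and period: "u [^] l = \<one>" "v [^] m = \<one>" "w [^] n = \<one>" "l > 0" "m > 0" "n > 0"
    and indep: "\<And>i j k. i < l \<Longrightarrow> j < m \<Longrightarrow> k < n \<Longrightarrow>
      u [^] i \<otimes> v [^] j \<otimes> w [^] k = \<one> \<Longrightarrow> i = 0 \<and> j = 0 \<and> k = 0"
  shows "l * m * n dvd order G"
proof -
  let ?Z = "cyclic3 l m n" and ?m = "monomial u v w"
  interpret m: group_hom ?Z G ?m
    using monomial_hom[OF carr comm period(1-3)] group_cyclic3[OF period(4-6)]
    by (simp add: group_hom_def group_hom_axioms_def is_group)
  have "card (?m ` carrier ?Z) = card (carrier ?Z)"
    by (rule card_image[OF monomial_inj[OF carr comm period indep]])
  also have "\<dots> = l * m * n" by (simp add: cyclic3_def card_cartesian_product)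
  finally have card: "card (?m ` carrier ?Z) = l * m * n" .
  show ?thesis using subgroup_card_dvd[OF m.img_is_subgroup] unfolding card .
qed

lemma fixed_pair:
  assumes "card fixed = 2" "f \<in> fixed" "f \<noteq> \<one>"
  shows "fixed = {\<one>, f}"
proof -
  have "{\<one>, f} \<subseteq> fixed" using assms fixedI[OF one_closed aut_one] by blast
  moreover have "card {\<one>, f} = 2" using assms by auto
  ultimately show ?thesis using assms(1) card_subset_eq[OF finite_fixed] by metis
qed

lemma realizes_klein_of_involution:
  assumes "D = {\<one>, a, b, c}" "distinct [\<one>, a, b, c]" "\<psi> a = b" "\<psi> b = c" "\<psi> c = a"
    and rel: "a = c \<otimes> b" "c = b \<otimes> a" "b \<otimes> b = a \<otimes> a" and sq: "a \<otimes> a = \<one>"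
  shows "realizes (companion_model 2 1 1) G \<psi>"
proof -
  have G: "a \<in> carrier G" "b \<in> carrier G" "c \<in> carrier G" using assms(1) displacements_closed by blast+
  then have "a \<otimes> b = c \<otimes> (b \<otimes> b)" using rel(1) by (metis m_assoc)
  also have "\<dots> = c" using rel(3) sq G by simp
  finally show ?thesis
    using realizes_klein[OF assms(1-5) sq _ rel(2)[symmetric] trans[OF rel(3) sq]] by blast
qed

text \<open>The displacement \<open>b \<otimes> inv c\<close> is \<open>c\<close> or \<open>f\<close>, which gives the two alternatives. Conjugation by the
  fixed element \<open>f\<close> preserves \<open>D\<close>.\<close>

lemma four_displacements_swap:
  assumes D: "D = {\<one>, f, b, c}" and ne: "distinct [\<one>, f, b, c]"
    and \<psi>: "\<psi> f = f" "\<psi> b = c" "\<psi> c = b"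
  shows "b [^] (3::nat) = \<one> \<and> c = b \<otimes> b \<and> (f \<otimes> b = b \<otimes> f \<or> f \<otimes> b = b \<otimes> b \<otimes> f) \<or>
    f \<otimes> f = \<one> \<and> f \<otimes> b = c \<and> b \<otimes> f = c \<and> b \<otimes> b \<in> fixed"
proof -
  have G [simp]: "f \<in> carrier G" "b \<in> carrier G" "c \<in> carrier G" using D displacements_closed by blast+
  obtain e where "e \<in> D" "b \<otimes> \<one> = e \<otimes> \<psi> b" using twisted_exchange[of b \<one>] D by auto
  then have "b = f \<otimes> c \<or> b = c \<otimes> c" using ne \<psi> by (auto simp: D)
  moreover obtain e' where e': "e' \<in> D" "f \<otimes> b = e' \<otimes> f" using twisted_exchange[of f b] D \<psi> by auto
  ultimately show ?thesis
  proof (elim disjE)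
    assume b: "b = c \<otimes> c"
    then have c: "c = b \<otimes> b" using \<psi> aut_mult[of c c] by simp
    have "b \<otimes> b \<otimes> (b \<otimes> b) = c \<otimes> c" using c by simp
    also have "\<dots> = b" using b by simp
    finally have "(b \<otimes> b \<otimes> b) \<otimes> b = \<one> \<otimes> b" by (simp add: m_assoc)
    then have "b [^] (3::nat) = \<one>" by (simp add: numeral_3_eq_3 del: l_one)
    moreover have "f \<otimes> b = b \<otimes> f \<or> f \<otimes> b = c \<otimes> f" using e' ne by (auto simp: D)
    ultimately show ?thesis using c by simp
  next
    assume b: "b = f \<otimes> c"
    then have c: "c = f \<otimes> b" using \<psi> aut_mult[of f c] by simp
    have "(f \<otimes> f) \<otimes> c = f \<otimes> b" using b by (simp add: m_assoc)
    also have "\<dots> = \<one> \<otimes> c" using c by simp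
    finally have ff: "f \<otimes> f = \<one>" by (simp del: l_one)
    have bf: "b \<otimes> f = c" using e' ne ff c by (auto simp: D)
    have "c \<otimes> c = b \<otimes> (f \<otimes> f) \<otimes> b" using bf c by (metis G m_assoc m_closed)
    then have "\<psi> (b \<otimes> b) = b \<otimes> b" using \<psi> ff by simp
    then have "b \<otimes> b \<in> fixed" by (intro fixedI) simp_all
    then show ?thesis using ff bf c[symmetric] by (intro disjI2 conjI)
  qed
qed

text \<open>There are no nontrivial fixed points, so \<open>\<psi>\<close> is a three-cycle on the nontrivial
  displacements.\<close>

lemma order_four_cases:
  assumes "order G = 4" "card D = 4"
  shows "realizes (companion_model 2 1 1) G \<psi>"
proof -
  have F: "card fixed = 1" using card_displacements assms by simp
  have one: "x = \<one>" if "x \<in> fixed" for x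
    using F that fixedI[OF one_closed aut_one] by (metis card_1_singletonE singletonD)
  show ?thesis
  proof (cases rule: four_displacements_cases[OF assms(2)])
    case (1 a b c)
    have "\<not> 7 dvd order G" using assms by simp
    note rel = four_displacements_three_cycle[OF 1 this]
    show ?thesis
      by (rule realizes_klein_of_involution[OF 1 rel(1,3,4) one[OF rel(7)]])
  next
    case (2 f b c)
    then have "f \<in> carrier G" using displacements_closed by blast
    then show ?thesis using one[OF fixedI[of f]] 2 by simp
  next
    case 3
    then have "card D \<le> card fixed" by (rule card_mono[OF finite_fixed])
    then show ?thesis using F assms by simp
  qed
qed

text \<open>There is one nontrivial fixed point. In the three-cycle case the square of \<open>a\<close> distinguishes the
  Klein four-group from the quaternion group. In the other case the square of \<open>b\<close> is fixed, and
  it distinguishes the Klein four-group from the cyclic group.\<close>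

lemma order_eight_four_displacements:
  assumes "order G = 8" "card D = 4"
  shows "realizes (companion_model 2 1 1) G \<psi> \<or> realizes quaternion_model G \<psi> \<or>
    realizes (companion_model 2 1 0) G \<psi> \<or> realizes (cyclic_model 4 3 {..<4}) G \<psi>"
proof -
  have F: "card fixed = 2" using card_displacements assms by simp
  show ?thesis
  proof (cases rule: four_displacements_cases[OF assms(2)])
    case (1 a b c)
    have "\<not> 7 dvd order G" using assms by simp
    note rel = four_displacements_three_cycle[OF 1 this]
    show ?thesis
    proof (cases "a \<otimes> a = \<one>")
      case True
      then show ?thesis using realizes_klein_of_involution[OF 1 rel(1,3,4)] by simp
    next
      case False
      then show ?thesis using realizes_quaternion_model[OF 1 rel(1,3,4,5,6)] by simp
    qed
  next
    case (2 f b c)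
    have G [simp]: "f \<in> carrier G" "b \<in> carrier G" "c \<in> carrier G" using 2 displacements_closed by blast+
    have "fixed = {\<one>, f}" using fixed_pair[OF F fixedI[of f]] 2 by auto
    moreover have "coprime (3::nat) 8" by code_simp
    then have "b [^] (3::nat) \<noteq> \<one>" using pow_coprime_eq_one[of b 3] 2 assms by auto
    ultimately have rel: "f \<otimes> f = \<one>" "f \<otimes> b = c" "b \<otimes> f = c" "b \<otimes> b \<in> {\<one>, f}"
      using four_displacements_swap[OF 2] by blast+
    show ?thesis
    proof (cases "b \<otimes> b = \<one>")
      case True
      have bc: "b \<otimes> c = f" "c \<otimes> b = f" using rel True by (metis G l_one m_assoc r_one)+
      have cc: "c \<otimes> c = \<one>" using rel bc True by (metis G m_assoc)
      have two: "{..<2::nat} = {0, 1}" by auto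
      have "realizes (companion_model 2 1 0) G \<psi>"
      proof (rule realizes_companion_model[where u = b])
        show "i = 0 \<and> j = 0" if "i < 2" "j < 2" "b [^] i \<otimes> \<psi> b [^] j = \<one>" for i j :: nat
        proof -
          have "i \<in> {0, 1}" "j \<in> {0, 1}" using that two by auto
          then show ?thesis using that(3) 2 bc by auto
        qed
        show "(\<lambda>(i, j). b [^] i \<otimes> \<psi> b [^] j) ` ({..<2::nat} \<times> {..<2::nat}) = D"
          using bc unfolding two 2 by (auto simp: insert_commute)
      qed (use 2 True cc bc in \<open>auto simp: numeral_2_eq_2\<close>)
      then show ?thesis by simp
    next
      case False
      then have bb: "b \<otimes> b = f" using rel by simp
      then have bbb: "b \<otimes> b \<otimes> b = c" using rel by simp
      have four: "{..<4::nat} = {0, 1, 2, 3}" by auto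
      have "realizes (cyclic_model 4 3 {..<4}) G \<psi>"
      proof (rule realizes_cyclic_model[where u = b])
        show "b [^] i \<noteq> \<one>" if "0 < i" "i < 4" for i :: nat
        proof -
          have "i \<in> {1, 2, 3}" using that by auto
          then show ?thesis using 2 bb bbb by (auto simp: eval_nat_numeral)
        qed
        show "(\<lambda>i. b [^] i) ` {..<4::nat} = D"
          unfolding four 2 using bb bbb by (auto simp: eval_nat_numeral)
        have "b [^] (4::nat) = (b \<otimes> b) \<otimes> (b \<otimes> b)" by (simp add: eval_nat_numeral m_assoc)
        then show "b [^] (4::nat) = \<one>" using bb rel by simp
        show "\<psi> b = b [^] (3::nat)" using 2 bbb by (simp add: eval_nat_numeral)
      qed simp_all
      then show ?thesis by simp
    qed
  next
    case 3
    then have "card D \<le> card fixed" by (rule card_mono[OF finite_fixed])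
    then show ?thesis using F assms by simp
  qed
qed

text \<open>The fixed points form a group of order three. In the three-cycle case it contains
  \<open>a \<otimes> a\<close>, whose square is \<open>\<one>\<close>, so \<open>a\<close> is an involution. If \<open>\<psi>\<close> fixes \<open>f\<close> and swaps \<open>b\<close> and \<open>c\<close>, then \<open>f\<close>
  and \<open>b\<close> are commuting independent elements of order three, but 9 does not divide 12.\<close>

lemma order_twelve_four_displacements:
  assumes "order G = 12" "card D = 4"
  shows "realizes (companion_model 2 1 1) G \<psi>"
proof -
  have F: "card fixed = 3" using card_displacements assms by simp
  have cube: "x [^] (3::nat) = \<one>" if "x \<in> fixed" for x
    using pow_card_subgroup[OF fixed_subgroup that] F by simp
  show ?thesis
  proof (cases rule: four_displacements_cases[OF assms(2)])
    case (1 a b c)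
    have G [simp]: "a \<in> carrier G" using 1 displacements_closed by blast
    have "\<not> 7 dvd order G" using assms by simp
    note rel = four_displacements_three_cycle[OF 1 this]
    have "(a \<otimes> a) \<otimes> (a \<otimes> a) \<otimes> (a \<otimes> a) = \<one>" using cube[OF rel(7)] by (simp add: numeral_3_eq_3)
    then have "a \<otimes> a = \<one>" using rel(6) by simp
    then show ?thesis using realizes_klein_of_involution[OF 1 rel(1,3,4)] by simp
  next
    case (2 f b c)
    have G [simp]: "f \<in> carrier G" "b \<in> carrier G" "c \<in> carrier G" using 2 displacements_closed by blast+
    have f: "f \<in> fixed" "f \<noteq> \<one>" using 2 fixedI[of f] by auto
    have f3: "f \<otimes> f \<otimes> f = \<one>" using cube[OF f(1)] by (simp add: numeral_3_eq_3)
    have "f \<otimes> f \<noteq> \<one>" using f3 f by auto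
    then have b: "b [^] (3::nat) = \<one>" "c = b \<otimes> b" "f \<otimes> b = b \<otimes> f \<or> f \<otimes> b = b \<otimes> b \<otimes> f"
      using four_displacements_swap[OF 2] by blast+
    have b3: "b \<otimes> (b \<otimes> b) = \<one>" using b(1) by (simp add: numeral_3_eq_3 m_assoc)
    have comm: "f \<otimes> b = b \<otimes> f"
    proof (rule ccontr)
      assume "f \<otimes> b \<noteq> b \<otimes> f"
      then have fb: "f \<otimes> b = b \<otimes> (b \<otimes> f)" using b(3) by (simp add: m_assoc)
      have fx: "f \<otimes> (b \<otimes> x) = b \<otimes> (b \<otimes> (f \<otimes> x))" if "x \<in> carrier G" for x
        using left_swap[of f b b "b \<otimes> f" x] fb that by (simp add: m_assoc)
      have b3x: "b \<otimes> (b \<otimes> (b \<otimes> x)) = x" if "x \<in> carrier G" for x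
        using that b3 by (metis G(2) l_one m_assoc m_closed)
      have "b = f \<otimes> (f \<otimes> (f \<otimes> b))" using f3 by (metis G l_one m_assoc m_closed)
      also have "\<dots> = b \<otimes> b \<otimes> (f \<otimes> (f \<otimes> f))" by (simp add: fb fx b3x m_assoc)
      also have "\<dots> = b \<otimes> b" using f3 by (simp add: m_assoc)
      finally have "c = b" using b by simp
      then show False using 2 by simp
    qed
    have indep: "i = 0 \<and> j = 0 \<and> k = 0"
      if "i < 3" "j < 3" "k < 1" "f [^] i \<otimes> b [^] j \<otimes> \<one> [^] k = \<one>" for i j k :: nat
    proof -
      have "f [^] i \<otimes> b [^] j = \<one>" using that by simp
      then have "b [^] j = inv (f [^] i)" by (metis G inv_unique' nat_pow_closed inv_equality inv_inv)
      moreover have "inv (f [^] i) \<in> fixed" using 2 by (intro fixedI) simp_all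
      ultimately have j: "b [^] j \<in> fixed" by simp
      have "j = 0"
      proof (rule ccontr)
        assume "j \<noteq> 0"
        then have "j = 1 \<or> j = 2" using that by auto
        then have "b [^] j = b \<or> b [^] j = c" using b by (auto simp: numeral_2_eq_2)
        then show False using fixedD[OF j] 2 by (auto simp del: aut_pow)
      qed
      moreover have "i = 0"
      proof (rule ccontr)
        assume "i \<noteq> 0"
        then have "i = 1 \<or> i = 2" using that by auto
        then show False using that \<open>j = 0\<close> f \<open>f \<otimes> f \<noteq> \<one>\<close> by (auto simp: numeral_2_eq_2)
      qed
      ultimately show ?thesis using that by simp
    qed
    have f3': "f [^] (3::nat) = \<one>" by (rule cube[OF f(1)])
    have "3 * 3 * 1 dvd order G"
      by (rule monomial_order_dvd[OF G(1,2) one_closed comm _ _ f3' b(1) _ _ _ _ indep]) simp_all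
    then show ?thesis using assms by simp
  next
    case 3
    then have "card D \<le> card fixed" by (rule card_mono[OF finite_fixed])
    then show ?thesis using F assms by simp
  qed
qed

end

section \<open>Groups of order nine, fifteen and twice a prime\<close>

lemma dvd_nine:
  assumes "k dvd (9::nat)"
  shows "k = 1 \<or> k = 3 \<or> k = 9"
proof -
  have "k \<le> 9" using assms by (rule dvd_imp_le) simp
  then have "k \<in> {0,1,2,3,4,5,6,7,8,9}" by auto
  then show ?thesis using assms by auto
qed

lemma dvd_fifteen:
  assumes "k dvd (15::nat)" "\<not> k dvd 3" "\<not> k dvd 5"
  shows "k = 15"
proof -
  have "\<forall>k\<in>set [0..<16]. k dvd 15 \<longrightarrow> \<not> k dvd 3 \<longrightarrow> \<not> k dvd 5 \<longrightarrow> k = (15::nat)" by code_simp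
  moreover have "k \<le> 15" using assms(1) by (rule dvd_imp_le) simp
  then have "k \<in> set [0..<16]" by simp
  ultimately show ?thesis using assms by blast
qed

lemma (in group) inner_group_aut:
  assumes fin: "finite (carrier G)" and g: "g \<in> carrier G"
  shows "group_aut G (\<lambda>x. g \<otimes> x \<otimes> inv g)"
proof -
  let ?\<iota> = "\<lambda>x. g \<otimes> x \<otimes> inv g"
  have "?\<iota> \<in> hom G G"
    using g by (auto simp: hom_def m_assoc) (simp flip: m_assoc)
  moreover have "inj_on ?\<iota> (carrier G)" using g by (auto simp: inj_on_def)
  moreover have "?\<iota> ` carrier G \<subseteq> carrier G" using g by auto
  ultimately have "?\<iota> \<in> iso G G"
    using fin by (simp add: iso_def bij_betw_def endo_inj_surj)
  then show ?thesis using fin by (simp add: group_aut_def group_aut_axioms_def is_group)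
qed

text \<open>If \<open>g\<close> is not central, its centralizer has order three, so conjugation by \<open>g\<close> has three
  displacements. It cannot swap two of them, since its order divides three. So they are fixed, that
  is, they form the centralizer. In particular \<open>inv g\<close> is a displacement, which means that
  \<open>inv g \<otimes> (g \<otimes> x \<otimes> inv g) = x\<close> for some \<open>x\<close>; this forces \<open>g = \<one>\<close>.\<close>

lemma (in group) commutative_of_order_nine:
  assumes "order G = 9" "g \<in> carrier G" "y \<in> carrier G"
  shows "g \<otimes> y = y \<otimes> g"
proof (rule ccontr)
  assume nc: "g \<otimes> y \<noteq> y \<otimes> g"
  have fin: "finite (carrier G)" using assms(1) order_gt_0_iff_finite by simp
  define \<iota> where "\<iota> x = g \<otimes> x \<otimes> inv g" for x
  have swap_iff: "\<iota> x = z \<longleftrightarrow> g \<otimes> x = z \<otimes> g" if "x \<in> carrier G" "z \<in> carrier G" for x z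
    using that assms inv_solve_right[of z "g \<otimes> x" g] unfolding \<iota>_def by (metis m_closed)
  have "group_aut G \<iota>" unfolding \<iota>_def by (rule inner_group_aut[OF fin assms(2)])
  then interpret \<iota>: group_aut G \<iota> .
  have g_ne: "g \<noteq> \<one>" using nc assms by auto
  have g: "g \<in> \<iota>.fixed" using assms swap_iff[of g g] by (intro \<iota>.fixedI) simp_all
  have one: "\<one> \<in> \<iota>.fixed" by (rule \<iota>.fixedI) simp_all
  have "card \<iota>.fixed \<noteq> 9"
  proof
    assume "card \<iota>.fixed = 9"
    then have "\<iota>.fixed = carrier G"
      using assms fin by (intro card_subset_eq) (auto simp: order_def)
    then have "\<iota> y = y" using assms \<iota>.fixedD by blast
    then show False using nc swap_iff[of y y] assms by simp
  qed
  moreover have "card \<iota>.fixed \<noteq> 1" using g one g_ne by (metis card_1_singletonE singletonD)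
  moreover have "card \<iota>.fixed dvd 9" using \<iota>.card_fixed_dvd assms by simp
  then have "card \<iota>.fixed = 1 \<or> card \<iota>.fixed = 3 \<or> card \<iota>.fixed = 9" by (rule dvd_nine)
  ultimately have F: "card \<iota>.fixed = 3" by simp
  then have D: "card (displacements G \<iota>) = 3" using \<iota>.card_displacements assms by simp
  show False
  proof (cases rule: \<iota>.three_displacements_cases[OF D])
    case (1 a b)
    have [simp]: "a \<in> carrier G" "b \<in> carrier G" using 1 \<iota>.displacements_closed by blast+
    have "g \<otimes> g \<otimes> g = \<one>" using \<iota>.pow_card_subgroup[OF \<iota>.fixed_subgroup g] F assms
      by (simp add: numeral_3_eq_3)
    moreover have ab: "g \<otimes> a = b \<otimes> g" "g \<otimes> b = a \<otimes> g"
      using 1(3,4) swap_iff[of a b] swap_iff[of b a] by simp_all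
    have ggg: "g \<otimes> (g \<otimes> (g \<otimes> a)) = a"
      using calculation assms by (simp flip: m_assoc)
    have "g \<otimes> (g \<otimes> a) = a \<otimes> g \<otimes> g" using ab assms by (metis \<open>a \<in> carrier G\<close> \<open>b \<in> carrier G\<close> m_assoc)
    then have "g \<otimes> (g \<otimes> (g \<otimes> a)) = b \<otimes> (g \<otimes> g \<otimes> g)"
      using ab assms by (metis \<open>a \<in> carrier G\<close> \<open>b \<in> carrier G\<close> m_assoc m_closed)
    then have "a = b" using ggg calculation by simp
    then show ?thesis using 1 by simp
  next
    case (2 a b)
    then have "{\<one>, a, b} = \<iota>.fixed" using F one by (intro card_subset_eq) auto
    then have "inv g \<in> displacements G \<iota>"
      using 2(1) subgroup.m_inv_closed[OF \<iota>.fixed_subgroup g] by simp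
    then obtain x where "x \<in> carrier G" "inv g \<otimes> \<iota> x = x" by (rule \<iota>.displacement_witness)
    then have "x \<otimes> inv g = x" using assms by (simp add: \<iota>_def) (metis inv_closed l_one l_inv m_assoc m_closed)
    then show ?thesis using g_ne assms \<open>x \<in> carrier G\<close> by simp
  qed
qed

text \<open>Two different subgroups of order \<open>p\<close> meet trivially and would give \<open>p * p\<close> products.\<close>

lemma (in group) unique_subgroup_of_large_prime_order:
  assumes fin: "finite (carrier G)" and H: "subgroup H G" and K: "subgroup K G"
    and card: "card H = p" "card K = p" and p: "prime p" "order G < p * p"
  shows "H = K"
proof -
  have finH: "finite H" "finite K"
    using H K fin by (auto dest!: subgroup.subset intro: finite_subset)
  interpret H: group "G\<lparr>carrier := H\<rparr>" by (rule subgroup_imp_group[OF H])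
  have I: "subgroup (H \<inter> K) G" by (rule subgroups_Inter_pair[OF H K])
  then have "subgroup (H \<inter> K) (G\<lparr>carrier := H\<rparr>)" using H by (simp add: subgroup_incl)
  then have "card (H \<inter> K) dvd card H"
    using H.lagrange[of "H \<inter> K"] by (metis dvd_triv_right order_def partial_object.select_convs(1) partial_object.update_convs(1) partial_object.surjective)
  then have "card (H \<inter> K) = 1 \<or> card (H \<inter> K) = p" using card p by (simp add: prime_nat_iff)
  then show ?thesis
  proof
    assume "card (H \<inter> K) = p"
    then have "H \<inter> K = H" "H \<inter> K = K"
      using card_subset_eq[OF finH(1) Int_lower1] card_subset_eq[OF finH(2) Int_lower2] card by simp_all
    then show ?thesis by simp
  next
    assume "card (H \<inter> K) = 1"
    then have I1: "H \<inter> K = {\<one>}"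
      using subgroup.one_closed[OF I] by (metis card_1_singletonE singletonD)
    have "inj_on (\<lambda>(h, k). h \<otimes> k) (H \<times> K)"
    proof (rule inj_onI, clarify)
      fix h k h' k' assume *: "h \<in> H" "k \<in> K" "h' \<in> H" "k' \<in> K" "h \<otimes> k = h' \<otimes> k'"
      have G: "h \<in> carrier G" "h' \<in> carrier G" "k \<in> carrier G" "k' \<in> carrier G"
        using * H K by (auto dest: subgroup.mem_carrier)
      have "inv h' \<otimes> h = k' \<otimes> inv k"
        using *(5) G by (metis inv_closed inv_solve_left inv_solve_right m_assoc m_closed)
      moreover have "inv h' \<otimes> h \<in> H" "k' \<otimes> inv k \<in> K"
        using * H K by (auto intro: subgroup.m_closed subgroup.m_inv_closed)
      ultimately have "inv h' \<otimes> h = \<one>" "k' \<otimes> inv k = \<one>" using I1 by (metis IntI singletonD)+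
      then show "h = h' \<and> k = k'" using G by (metis inv_closed inv_equality inv_inv)
    qed
    then have "card ((\<lambda>(h, k). h \<otimes> k) ` (H \<times> K)) = p * p"
      using card by (simp add: card_image card_cartesian_product)
    moreover have "(\<lambda>(h, k). h \<otimes> k) ` (H \<times> K) \<subseteq> carrier G"
      using H K by (auto dest: subgroup.mem_carrier)
    ultimately have "p * p \<le> order G" using fin by (metis card_mono order_def)
    then show ?thesis using p by simp
  qed
qed

context group_aut
begin

lemma aut_image_subgroup:
  assumes "subgroup H G"
  shows "subgroup (\<psi> ` H) G" "card (\<psi> ` H) = card H"
proof -
  show "subgroup (\<psi> ` H) G" by (rule group_hom.subgroup_img_is_subgroup[OF aut_hom assms])
  have "inj_on \<psi> H" using aut_bij subgroup.subset[OF assms] by (auto simp: bij_betw_def intro: inj_on_subset)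
  then show "card (\<psi> ` H) = card H" by (rule card_image)
qed

lemma cauchy:
  assumes "prime p" "p dvd order G"
  obtains H where "subgroup H G" "card H = p"
  using sylow_thm[of p G 1 "order G div p"] assms is_group by auto

lemma prime_subgroup_powers:
  assumes H: "subgroup H G" "card H = p" "prime p" and g: "g \<in> H" "g \<noteq> \<one>"
  shows "ord g = p" "H = (\<lambda>i. g [^] i) ` {..<p}"
proof -
  have gG: "g \<in> carrier G" by (rule subgroup.mem_carrier[OF H(1) g(1)])
  have "ord g dvd p" using pow_card_subgroup[OF H(1) g(1)] H(2) gG by (simp add: pow_eq_id)
  then have "ord g = 1 \<or> ord g = p" using H(3) by (simp add: prime_nat_iff)
  then show p: "ord g = p" using g(2) gG ord_eq_1[of g] by auto
  have inj: "inj_on (\<lambda>i. g [^] i) {..<p}"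
    by (rule inj_on_subset[OF ord_inj[OF gG]]) (use p prime_gt_0_nat[OF H(3)] in auto)
  have "g [^] i \<in> H" for i :: nat
    by (induction i) (simp_all add: subgroup.one_closed[OF H(1)] subgroup.m_closed[OF H(1)] g(1))
  then have "(\<lambda>i. g [^] i) ` {..<p} \<subseteq> H" by auto
  then show "H = (\<lambda>i. g [^] i) ` {..<p}"
    using card_image[OF inj] H(2) finite_subset[OF subgroup.subset[OF H(1)] finite_carrier]
    by (intro card_subset_eq[symmetric]) simp_all
qed

lemma prime_subgroup_generator:
  assumes "subgroup H G" "card H = p" "prime p"
  obtains g where "g \<in> carrier G" "g \<in> H" "g \<noteq> \<one>"
proof -
  have "H \<noteq> {\<one>}" using assms by auto
  then obtain g where "g \<in> H" "g \<noteq> \<one>" using subgroup.one_closed[OF assms(1)] by blast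
  then show ?thesis using that subgroup.mem_carrier[OF assms(1)] by blast
qed

lemma order_nine_three_displacements:
  assumes "order G = 9" "card D = 3"
  shows "realizes (cyclic_model 3 1 {..<3}) G \<psi> \<or> realizes (cyclic_model 3 2 {..<3}) G \<psi>"
proof (cases rule: three_displacements_cases[OF assms(2)])
  case (1 a b)
  then show ?thesis using realizes_three_swap by blast
next
  case (2 a b)
  have [simp]: "a \<in> carrier G" "b \<in> carrier G" using 2 by simp_all
  have F3: "card fixed = 3" using card_displacements assms by simp
  then have F: "{\<one>, a, b} = fixed"
    using 2 fixedI[OF one_closed aut_one] by (intro card_subset_eq) auto
  have "a [^] (2::nat) \<noteq> \<one>"
  proof -
    have "coprime (2::nat) 9" by code_simp
    then show ?thesis using pow_coprime_eq_one[of a 2] 2 assms by auto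
  qed
  moreover have "a \<otimes> a \<in> fixed" using 2 fixed_subgroup by (simp add: subgroup.m_closed)
  ultimately have b: "a \<otimes> a = b" using F 2 by (auto simp: numeral_2_eq_2)
  have three: "{..<3::nat} = {0, 1, 2}" by auto
  have "realizes (cyclic_model 3 1 {..<3}) G \<psi>"
  proof (rule realizes_cyclic_model[where u = a])
    show "a [^] i \<noteq> \<one>" if "0 < i" "i < 3" for i :: nat
    proof -
      have "i = 1 \<or> i = 2" using that by auto
      then show ?thesis using 2 b by (auto simp: numeral_2_eq_2)
    qed
    show "(\<lambda>i. a [^] i) ` {..<3::nat} = D" unfolding three 2(1) using b by (auto simp: numeral_2_eq_2)
    show "a [^] (3::nat) = \<one>" using pow_card_subgroup[OF fixed_subgroup 2(3)] F3 by simp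
    show "\<psi> a = a [^] (1::nat)" using fixedD[OF 2(3)] by simp
  qed simp_all
  then show ?thesis ..
qed

lemma index_two:
  assumes N: "subgroup N G" "order G = 2 * card N"
    and x: "x \<in> carrier G" "x \<notin> N" and y: "y \<in> carrier G" "y \<notin> N"
  shows "x \<otimes> inv y \<in> N"
proof -
  let ?C = "(\<lambda>n. n \<otimes> y) ` N"
  have sub: "N \<subseteq> carrier G" by (rule subgroup.subset[OF N(1)])
  have fin: "finite N" by (rule finite_subset[OF sub finite_carrier])
  have "inj_on (\<lambda>n. n \<otimes> y) N" using sub y by (intro inj_onI) (simp add: subset_iff)
  then have "card ?C = card N" by (rule card_image)
  moreover have "N \<inter> ?C = {}"
  proof (rule ccontr)
    assume "N \<inter> ?C \<noteq> {}"
    then obtain n where n: "n \<in> N" "n \<otimes> y \<in> N" by auto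
    then have "inv n \<otimes> (n \<otimes> y) \<in> N" using N by (simp add: subgroup.m_closed subgroup.m_inv_closed)
    moreover have "inv n \<otimes> (n \<otimes> y) = y" using n sub y by (simp add: subset_iff flip: m_assoc)
    ultimately show False using y by simp
  qed
  ultimately have "card (N \<union> ?C) = order G" using fin N(2) by (simp add: card_Un_disjoint)
  then have "N \<union> ?C = carrier G"
    using sub y by (intro card_subset_eq) (auto simp: order_def)
  then obtain n where "n \<in> N" "x = n \<otimes> y" using x by blast
  then show ?thesis using sub y by (simp add: m_assoc subset_iff)
qed

text \<open>The automorphism acts trivially on the quotient of order two.\<close>

lemma displacements_in_index_two:
  assumes N: "subgroup N G" "order G = 2 * card N" and inv: "\<And>x. x \<in> carrier G \<Longrightarrow> \<psi> x \<in> N \<longleftrightarrow> x \<in> N"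
  shows "D \<subseteq> N"
proof
  fix d assume "d \<in> D"
  then obtain x where x: "x \<in> carrier G" "d = \<delta> x" unfolding displacements_eq by blast
  show "d \<in> N"
  proof (cases "x \<in> N")
    case True
    then show ?thesis using x N(1) inv[of x] by (simp add: disp_def subgroup.m_closed subgroup.m_inv_closed)
  next
    case False
    then show ?thesis using x inv[of x] index_two[OF N, of x "\<psi> x"] by (simp add: disp_def)
  qed
qed

text \<open>The subgroup \<open>N\<close> of order \<open>p\<close> is the set of solutions of \<open>x [^] p = \<one>\<close>, hence invariant, and it
  contains \<open>D\<close>. So \<open>card D\<close> is 1, 2 or \<open>p\<close>. In the last case \<open>D = N\<close>, on which \<open>\<psi>\<close> is a power map; it
  is not the identity there, as only two elements are fixed.\<close>

lemma order_twice_prime_cases: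
  assumes p: "prime p" "odd p" and ord: "order G = 2 * p"
  shows "realizes trivial_model G \<psi> \<or> realizes (two_model p) G \<psi> \<or>
    (\<exists>a\<in>{2..<p}. realizes (cyclic_model p a {..<p}) G \<psi>)"
proof -
  obtain N where N: "subgroup N G" "card N = p" using cauchy[of p] p ord by auto
  have two: "order G = 2 * card N" using N ord by simp
  have in_N: "x \<in> N \<longleftrightarrow> x [^] p = \<one>" if x: "x \<in> carrier G" for x
  proof
    assume "x \<in> N"
    then show "x [^] p = \<one>" using pow_card_subgroup[OF N(1)] N(2) by simp
  next
    assume xp: "x [^] p = \<one>"
    show "x \<in> N"
    proof (rule ccontr)
      assume "x \<notin> N"
      moreover have "inv x \<notin> N"
        using \<open>x \<notin> N\<close> x subgroup.m_inv_closed[OF N(1), of "inv x"] by auto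
      ultimately have xx: "x \<otimes> x \<in> N" using index_two[OF N(1) two, of x "inv x"] x by simp
      obtain q where q: "p = 2 * q + 1" using p by (auto elim: oddE)
      have "(x \<otimes> x) [^] k \<in> N" for k :: nat
        by (induction k) (use xx N in \<open>auto intro: subgroup.one_closed subgroup.m_closed\<close>)
      moreover have "(x \<otimes> x) [^] q \<otimes> x = \<one>"
      proof -
        have "x \<otimes> x = x [^] (2::nat)" using x by (simp add: numeral_2_eq_2)
        then have "(x \<otimes> x) [^] q = x [^] (2 * q)" using x by (simp add: nat_pow_pow)
        then show ?thesis using xp q by simp
      qed
      then have "x = inv ((x \<otimes> x) [^] q)" using x by (metis inv_equality inv_inv m_closed nat_pow_closed)
      ultimately show False using \<open>x \<notin> N\<close> N by (metis subgroup.m_inv_closed)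
    qed
  qed
  have inv_N: "\<psi> x \<in> N \<longleftrightarrow> x \<in> N" if "x \<in> carrier G" for x
    using that in_N[of x] in_N[of "\<psi> x"] by (simp flip: aut_pow)
  have DN: "D \<subseteq> N" by (rule displacements_in_index_two[OF N(1) two inv_N])
  have finN: "finite N" by (rule finite_subset[OF subgroup.subset[OF N(1)] finite_carrier])
  have le: "card D \<le> p" using card_mono[OF finN DN] N by simp
  have dvd: "card D dvd 2 * p" using card_displacements_dvd ord by simp
  have "card D = 1 \<or> card D = 2 \<or> card D = p"
  proof (cases "p dvd card D")
    case True
    moreover have "card D > 0" using one_displacement by (metis card_gt_0_iff empty_iff finite_displacements)
    ultimately show ?thesis using le by (simp add: dvd_imp_le le_antisym)
  next
    case False
    then have "coprime (card D) p" using p by (metis coprime_commute prime_imp_coprime)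
    then have "card D dvd 2" using dvd by (simp add: coprime_dvd_mult_left_iff)
    then have "card D \<le> 2" "card D \<noteq> 0" by (auto dest: dvd_imp_le)
    then show ?thesis by linarith
  qed
  then show ?thesis
  proof (elim disjE)
    assume "card D = 1"
    then show ?thesis using realizes_trivial_model by simp
  next
    assume "card D = 2"
    then obtain m where "m > 1" "m dvd order G div 2" "realizes (two_model m) G \<psi>"
      using realizes_two_model by blast
    then show ?thesis using ord p by (auto simp: prime_nat_iff)
  next
    assume Dp: "card D = p"
    then have D: "D = N" using DN N finN by (simp add: card_subset_eq)
    obtain g where g: "g \<in> carrier G" "g \<in> N" "g \<noteq> \<one>" by (rule prime_subgroup_generator[OF N p(1)])
    note pow = prime_subgroup_powers[OF N p(1) g(2,3)]
    have "\<psi> g \<in> N" using inv_N g by simp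
    then obtain a where a: "a < p" "\<psi> g = g [^] a" using pow(2) by auto
    have "a \<noteq> 0"
    proof
      assume "a = 0"
      then have "\<psi> g = \<one>" using a by simp
      then show False using g by simp
    qed
    moreover have "a \<noteq> 1"
    proof
      assume "a = 1"
      then have "\<psi> g = g" using a g by simp
      then have "N \<subseteq> fixed" unfolding pow(2) using g by (auto intro!: fixedI)
      then have "p \<le> card fixed" using card_mono[OF finite_fixed] N by blast
      moreover have "card fixed = 2" using card_displacements Dp ord p(1) by (simp add: prime_gt_0_nat)
      moreover have "p > 2" using p by (metis even_numeral le_neq_implies_less prime_ge_2_nat)
      ultimately show False by simp
    qed
    ultimately have "a \<in> {2..<p}" using a by auto
    moreover have "realizes (cyclic_model p a {..<p}) G \<psi>"
    proof (rule realizes_cyclic_model[where u = g])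
      show "g [^] i \<noteq> \<one>" if "0 < i" "i < p" for i
        using that g pow(1) by (auto simp: pow_eq_id dest: dvd_imp_le)
      show "g [^] p = \<one>" using in_N g by blast
    qed (use g a pow(2) D p in \<open>auto simp: prime_gt_0_nat\<close>)
    ultimately show ?thesis by blast
  qed
qed

text \<open>The subgroup of order five is unique, hence normal. An element of order three acts on it as
  multiplication by some \<open>k\<close> whose cube is 1 modulo 5, so \<open>k = 1\<close> and the two elements commute.\<close>

lemma order_fifteen_generator:
  assumes ord: "order G = 15"
  shows "\<exists>g\<in>carrier G. ord g = 15"
proof -
  have p5: "prime (5::nat)" and p3: "prime (3::nat)" by simp_all
  obtain H where H: "subgroup H G" "card H = 5" using cauchy[OF p5] ord by auto
  obtain x where x: "x \<in> carrier G" "x \<in> H" "x \<noteq> \<one>" by (rule prime_subgroup_generator[OF H p5])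
  note powx = prime_subgroup_powers[OF H p5 x(2,3)]
  obtain K where K: "subgroup K G" "card K = 3" using cauchy[OF p3] ord by auto
  obtain y where y: "y \<in> carrier G" "y \<in> K" "y \<noteq> \<one>" by (rule prime_subgroup_generator[OF K p3])
  note powy = prime_subgroup_powers[OF K p3 y(2,3)]
  define \<iota> where "\<iota> z = y \<otimes> z \<otimes> inv y" for z
  have "group_aut G \<iota>" unfolding \<iota>_def by (rule inner_group_aut[OF finite_carrier y(1)])
  then interpret \<iota>: group_aut G \<iota> .
  have "\<iota> ` H = H"
    using unique_subgroup_of_large_prime_order[OF finite_carrier \<iota>.aut_image_subgroup(1)[OF H(1)] H(1) _ H(2) p5]
      \<iota>.aut_image_subgroup(2)[OF H(1)] H(2) ord by simp
  then have "\<iota> x \<in> H" using x(2) by blast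
  then obtain k :: nat where k: "k < 5" "\<iota> x = x [^] k" using powx(2) by blast
  have "y [^] (3::nat) = \<one>" using powy(1) y(1) pow_ord_eq_1 by metis
  then have yyy: "y \<otimes> (y \<otimes> y) = \<one>" using y by (simp add: numeral_3_eq_3 m_assoc)
  have "\<iota> (\<iota> (\<iota> x)) = (y \<otimes> (y \<otimes> y)) \<otimes> x \<otimes> inv (y \<otimes> (y \<otimes> y))"
    using x y by (simp add: \<iota>_def m_assoc inv_mult_group)
  also have "\<dots> = x" using x yyy by simp
  finally have "\<iota> (\<iota> (x [^] k)) = x" using k by simp
  then have "x [^] (k * k * k) = x" using x by (simp add: k(2) nat_pow_pow mult.assoc)
  moreover have x5: "x [^] (5::nat) = \<one>" using powx(1) x(1) pow_ord_eq_1 by metis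
  ultimately have "x [^] (k * k * k mod 5) = x [^] (1::nat)" using x by (simp add: pow_mod_period)
  then have "k * k * k mod 5 = 1"
    using inj_onD[OF ord_inj[OF x(1)], of "k * k * k mod 5" 1] powx(1) by simp
  moreover have "\<forall>k\<in>set [0..<5]. k * k * k mod 5 = 1 \<longrightarrow> k = (1::nat)" by code_simp
  moreover have "k \<in> set [0..<5]" using k(1) by simp
  ultimately have "k = 1" by blast
  then have comm: "x \<otimes> y = y \<otimes> x"
    using k(2) x y inv_solve_right'[of x "y \<otimes> x" y] by (simp add: \<iota>_def)
  have pow: "(x \<otimes> y) [^] i = x [^] i \<otimes> y [^] i" for i :: nat
    using x y comm by (intro pow_mult_distrib)
  have "ord (x \<otimes> y) dvd 15" using ord_dvd_group_order[of "x \<otimes> y"] ord x y by simp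
  moreover have "\<not> ord (x \<otimes> y) dvd 3"
  proof
    assume "ord (x \<otimes> y) dvd 3"
    then have "(x \<otimes> y) [^] (3::nat) = \<one>" using x y by (simp add: pow_eq_id)
    then have "x [^] (3::nat) = \<one>" using pow[of 3] x \<open>y [^] 3 = \<one>\<close> by simp
    then show False using powx(1) x by (simp add: pow_eq_id)
  qed
  moreover have "\<not> ord (x \<otimes> y) dvd 5"
  proof
    assume "ord (x \<otimes> y) dvd 5"
    then have "(x \<otimes> y) [^] (5::nat) = \<one>" using x y by (simp add: pow_eq_id)
    then have "y [^] (5::nat) = \<one>" using pow[of 5] y x5 by simp
    then show False using powy(1) y by (simp add: pow_eq_id)
  qed
  ultimately have "ord (x \<otimes> y) = 15" by (rule dvd_fifteen)
  then show ?thesis using x y by blast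
qed

section \<open>Three displacements in a group of order twelve\<close>

text \<open>If \<open>\<psi>\<close> fixes \<open>a\<close> and \<open>b\<close>, there are four fixed points, and they commute with \<open>a\<close> and \<open>b\<close>.
  Take \<open>t\<close> with \<open>\<delta> t = a\<close>. The displacements \<open>t \<otimes> a \<otimes> inv (\<psi> t)\<close> and \<open>t \<otimes> b \<otimes> inv (\<psi> t)\<close> are distinct
  and different from \<open>a\<close>, hence they are \<open>\<one>\<close> and \<open>b\<close> in some order. One order makes \<open>t\<close> fixed, the
  other forces \<open>a\<close> and \<open>b\<close> to be independent involutions.\<close>

lemma order_twelve_three_displacements:
  assumes "order G = 12" "card D = 3"
  shows "realizes (cyclic_model 3 2 {..<3}) G \<psi> \<or>
    realizes (abelian_model 2 2 1 (1,0,0) (0,1,0) (0,0,0) {(0,0,0), (1,0,0), (0,1,0)}) G \<psi>"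
proof (cases rule: three_displacements_cases[OF assms(2)])
  case (1 a b)
  then show ?thesis using realizes_three_swap by blast
next
  case (2 a b)
  note DD = 2(1) and aF = 2(3) and bF = 2(4) and comm = 2(5)
  have ne: "a \<noteq> \<one>" "b \<noteq> \<one>" "a \<noteq> b" "b \<noteq> a" "\<one> \<noteq> a" "\<one> \<noteq> b" using 2(2) by auto
  have ab [simp]: "a \<in> carrier G" "b \<in> carrier G" using aF bF by simp_all
  have \<psi>: "\<psi> a = a" "\<psi> b = b" using aF bF fixedD by blast+
  have card_F: "card fixed = 4" using card_displacements assms by simp
  have four: "x [^] (4::nat) = \<one>" if "x \<in> fixed" for x
    using pow_card_subgroup[OF fixed_subgroup that] card_F by simp
  have F_mult: "x \<otimes> y \<in> fixed" if "x \<in> fixed" "y \<in> fixed" for x y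
    using that fixed_subgroup by (simp add: subgroup.m_closed)
  have F_eq: "fixed = {\<one>, a, b, c}" if "c \<in> fixed" "c \<notin> {\<one>, a, b}" for c
  proof (rule card_subset_eq[symmetric])
    show "{\<one>, a, b, c} \<subseteq> fixed" using that aF bF fixedI[OF one_closed aut_one] by blast
    show "card {\<one>, a, b, c} = card fixed" using that ne card_F by auto
  qed simp
  have F_comm: "x \<otimes> a = a \<otimes> x \<and> x \<otimes> b = b \<otimes> x" if x: "x \<in> fixed" for x
  proof (cases "a \<otimes> b = \<one>")
    case False
    have "a \<otimes> b \<notin> {\<one>, a, b}" using False ne by simp
    then have F: "fixed = {\<one>, a, b, a \<otimes> b}" by (rule F_eq[OF F_mult[OF aF bF]])
    have "(a \<otimes> b) \<otimes> a = a \<otimes> (a \<otimes> b)" "(a \<otimes> b) \<otimes> b = b \<otimes> (a \<otimes> b)"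
      using comm by (simp_all add: m_assoc left_swap[OF comm])
    then show ?thesis using x comm unfolding F by auto
  next
    case True
    have aa1: "a \<otimes> a \<noteq> \<one>"
    proof
      assume "a \<otimes> a = \<one>"
      then have "a \<otimes> a = a \<otimes> b" using True by simp
      then show False using ne by simp
    qed
    have aab: "a \<otimes> a \<noteq> b"
    proof
      assume aa: "a \<otimes> a = b"
      then have "a \<otimes> (a \<otimes> a) = \<one>" using True by simp
      moreover have "a \<otimes> (a \<otimes> (a \<otimes> a)) = \<one>" using four[OF aF] by (simp add: eval_nat_numeral m_assoc)
      ultimately show False using ne by simp
    qed
    have "a \<otimes> a \<notin> {\<one>, a, b}" using aa1 aab ne by simp
    then have F: "fixed = {\<one>, a, b, a \<otimes> a}" by (rule F_eq[OF F_mult[OF aF aF]])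
    have "(a \<otimes> a) \<otimes> a = a \<otimes> (a \<otimes> a)" "(a \<otimes> a) \<otimes> b = b \<otimes> (a \<otimes> a)"
      using comm by (simp_all add: m_assoc left_swap[OF comm])
    then show ?thesis using x comm unfolding F by auto
  qed
  \<comment> \<open>\<open>t\<close> and \<open>s\<close> move the base point of \<open>D\<close> to \<open>a\<close> and \<open>b\<close>\<close>
  obtain t where t [simp]: "t \<in> carrier G" and at: "a \<otimes> \<psi> t = t"
    using displacement_witness[of a] DD by blast
  obtain s where s [simp]: "s \<in> carrier G" and bs: "b \<otimes> \<psi> s = s"
    using displacement_witness[of b] DD by blast
  obtain e where e: "e \<in> D" "t \<otimes> a = e \<otimes> \<psi> t" using twisted_exchange[of t a] DD by auto
  obtain e' where e': "e' \<in> D" "t \<otimes> b = e' \<otimes> \<psi> t" using twisted_exchange[of t b] DD by auto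
  have \<psi>t: "\<psi> t \<noteq> t" using at ne by auto
  have "e \<noteq> a" using e at ne by auto
  have "e' \<noteq> a" using e' at ne by auto
  have "e \<noteq> e'"
  proof
    assume "e = e'"
    then have "t \<otimes> a = t \<otimes> b" using e e' by simp
    then show False using ne by simp
  qed
  consider "e = \<one>" "e' = b" | "e = b" "e' = \<one>"
  proof -
    have "e = \<one> \<or> e = b" "e' = \<one> \<or> e' = b"
      using e(1) e'(1) \<open>e \<noteq> a\<close> \<open>e' \<noteq> a\<close> unfolding DD by blast+
    then show ?thesis using that \<open>e \<noteq> e'\<close> by blast
  qed
  then show ?thesis
  proof cases
    case 1
    have "b \<otimes> \<psi> (t \<otimes> s) = t \<otimes> (b \<otimes> \<psi> s)" using e' 1 by (simp add: m_assoc left_swap[of t b b "\<psi> t"])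
    then have "b \<otimes> \<psi> (t \<otimes> s) = t \<otimes> s" using bs by simp
    then have "\<delta> (t \<otimes> s) = b" "\<delta> s = b"
      using bs by (metis ab(2) aut_closed disp_def inv_solve_right' m_closed s t)+
    then have g: "inv s \<otimes> (t \<otimes> s) \<in> fixed" using disp_eq_iff[of s "t \<otimes> s"] by simp
    define g where "g = inv s \<otimes> (t \<otimes> s)"
    have gG [simp]: "g \<in> carrier G" and \<psi>g: "\<psi> g = g" using g fixedD by (simp_all add: g_def)
    have sg: "s \<otimes> g = t \<otimes> s" by (simp add: g_def flip: m_assoc)
    define d where "d = inv s \<otimes> \<psi> s"
    have dG [simp]: "d \<in> carrier G" by (simp add: d_def)
    have "d \<in> D" using disp_in[of "inv s"] by (simp add: disp_def d_def)
    then have gd: "g \<otimes> d = d \<otimes> g" using F_comm[OF g] DD by (auto simp: g_def[symmetric])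
    have sd: "s \<otimes> d = \<psi> s" by (simp add: d_def flip: m_assoc)
    have "t \<otimes> \<psi> s = (t \<otimes> s) \<otimes> d" using sd by (simp add: m_assoc)
    also have "\<dots> = (s \<otimes> d) \<otimes> g" using sg gd by (simp add: m_assoc flip: sg)
    also have "\<dots> = \<psi> (s \<otimes> g)" using sd \<psi>g by simp
    also have "\<dots> = \<psi> t \<otimes> \<psi> s" unfolding sg by simp
    finally have "t = \<psi> t" by simp
    then show ?thesis using \<psi>t by simp
  next
    case 2
    have tb: "t \<otimes> b = \<psi> t" using e' 2 by simp
    have atb: "a \<otimes> (t \<otimes> b) = t" using at tb by simp
    have ta: "t \<otimes> a = b \<otimes> (t \<otimes> b)" using e 2 tb by simp
    have ab1: "a \<otimes> b \<noteq> \<one>"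
    proof
      assume ab_one: "a \<otimes> b = \<one>"
      have "b \<otimes> t = b \<otimes> (a \<otimes> (t \<otimes> b))" using atb by simp
      also have "\<dots> = t \<otimes> b" using ab_one comm by (simp flip: m_assoc)
      finally have bt: "b \<otimes> t = t \<otimes> b" .
      have "t = (t \<otimes> a) \<otimes> b" using ab_one by (simp add: m_assoc)
      also have "\<dots> = b \<otimes> ((t \<otimes> b) \<otimes> b)" using ta by (simp add: m_assoc)
      also have "\<dots> = (b \<otimes> (b \<otimes> b)) \<otimes> t" using bt by (simp add: m_assoc bt[symmetric])
      finally have "(b \<otimes> (b \<otimes> b)) \<otimes> t = \<one> \<otimes> t" by simp
      then have "b \<otimes> (b \<otimes> b) = \<one>" by (simp del: l_one)
      moreover have "b \<otimes> (b \<otimes> (b \<otimes> b)) = \<one>" using four[OF bF] by (simp add: eval_nat_numeral m_assoc)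
      ultimately show False using ne by simp
    qed
    have "a \<otimes> b \<notin> {\<one>, a, b}" using ab1 ne by simp
    then have F: "fixed = {\<one>, a, b, a \<otimes> b}" by (rule F_eq[OF F_mult[OF aF bF]])
    have "a \<otimes> a \<noteq> b"
    proof
      assume aa: "a \<otimes> a = b"
      have "t \<otimes> a = a \<otimes> (a \<otimes> (t \<otimes> b))" using ta by (simp add: m_assoc flip: aa)
      also have "\<dots> = a \<otimes> t" using atb by simp
      finally have "t \<otimes> a = a \<otimes> t" .
      then have "t \<otimes> (a \<otimes> b) = a \<otimes> (t \<otimes> b)" by (simp flip: m_assoc)
      then have "t \<otimes> (a \<otimes> b) = t" using atb by simp
      then show False using ab1 by simp
    qed
    moreover have "a \<otimes> a \<in> {\<one>, a, b, a \<otimes> b}" using F_mult[OF aF aF] unfolding F .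
    ultimately have aa: "a \<otimes> a = \<one>" using ne by auto
    have "t \<otimes> b = a \<otimes> (a \<otimes> \<psi> t)" using tb aa by (simp flip: m_assoc)
    then have tb': "t \<otimes> b = a \<otimes> t" using at by simp
    have "t \<otimes> (b \<otimes> b) = (t \<otimes> b) \<otimes> b" by (simp add: m_assoc)
    also have "\<dots> = a \<otimes> (t \<otimes> b)" using tb' by (simp add: m_assoc)
    finally have "t \<otimes> (b \<otimes> b) = a \<otimes> (t \<otimes> b)" .
    then have "t \<otimes> (b \<otimes> b) = t" using atb by simp
    then have bb: "b \<otimes> b = \<one>" by simp
    have "realizes (abelian_model 2 2 1 (1,0,0) (0,1,0) (0,0,0) {(0,0,0), (1,0,0), (0,1,0)}) G \<psi>"
    proof (rule realizes_abelian_model[where u = a and v = b and w = \<one>])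
      show "i = 0 \<and> j = 0 \<and> k = 0"
        if "i < 2" "j < 2" "k < 1" "a [^] i \<otimes> b [^] j \<otimes> \<one> [^] k = \<one>" for i j k :: nat
      proof -
        have "i = 0 \<or> i = 1" "j = 0 \<or> j = 1" "k = 0" using that by auto
        then show ?thesis using that(4) ab1 ne by auto
      qed
      show "monomial a b \<one> ` {(0,0,0), (1,0,0), (0,1,0)} = D" using DD by (simp add: monomial_def)
    qed (use aa bb \<psi> comm in \<open>simp_all add: monomial_def numeral_2_eq_2\<close>)
    then show ?thesis ..
  qed
qed

section \<open>Automorphisms of groups of order eight and nine without fixed points\<close>

lemma monomial_onto:
  assumes carr: "u \<in> carrier G" "v \<in> carrier G" "w \<in> carrier G"
    and comm: "u \<otimes> v = v \<otimes> u" "u \<otimes> w = w \<otimes> u" "v \<otimes> w = w \<otimes> v"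
    and period: "u [^] l = \<one>" "v [^] m = \<one>" "w [^] n = \<one>" "l > 0" "m > 0" "n > 0"
    and indep: "\<And>i j k. i < l \<Longrightarrow> j < m \<Longrightarrow> k < n \<Longrightarrow>
      u [^] i \<otimes> v [^] j \<otimes> w [^] k = \<one> \<Longrightarrow> i = 0 \<and> j = 0 \<and> k = 0"
    and order: "l * m * n = order G"
  shows "monomial u v w ` ({..<l} \<times> {..<m} \<times> {..<n}) = carrier G"
proof (rule card_subset_eq)
  show "monomial u v w ` ({..<l} \<times> {..<m} \<times> {..<n}) \<subseteq> carrier G"
    using carr by (auto simp: monomial_def)
  have Z: "carrier (cyclic3 l m n) = {..<l} \<times> {..<m} \<times> {..<n}" by (simp add: cyclic3_def)
  have "inj_on (monomial u v w) ({..<l} \<times> {..<m} \<times> {..<n})"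
    using monomial_inj[OF carr comm period indep] unfolding Z .
  then show "card (monomial u v w ` ({..<l} \<times> {..<m} \<times> {..<n})) = card (carrier G)"
    using order by (simp add: card_image card_cartesian_product order_def mult.assoc)
qed simp

lemma full_displacements:
  assumes "card D = order G"
  shows "D = carrier G" "x \<in> carrier G \<Longrightarrow> \<psi> x = x \<Longrightarrow> x = \<one>"
proof -
  show "D = carrier G"
    using assms by (intro card_subset_eq) (auto simp: order_def)
  have "card fixed = 1"
    using card_displacements assms order_pos by simp
  then obtain y where y: "fixed = {y}" by (rule card_1_singletonE)
  then have "y = \<one>" using fixedI[OF one_closed aut_one] by simp
  then show "x = \<one>" if "x \<in> carrier G" "\<psi> x = x"
    using fixedI[OF that] y by simp
qed

text \<open>Modulo three every nonzero exponent is its own inverse, so a relation could be solved for \<open>u\<close> or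
  for \<open>v\<close>.\<close>

lemma indep_of_exponent_three:
  fixes i j :: nat
  assumes u: "u \<in> carrier G" "u [^] (3::nat) = \<one>" and v: "v \<in> carrier G" "v [^] (3::nat) = \<one>"
    and ne: "u \<noteq> \<one>" "\<And>k::nat. v \<noteq> u [^] k"
    and ij: "i < 3" "j < 3" "u [^] i \<otimes> v [^] j = \<one>"
  shows "i = 0 \<and> j = 0"
proof -
  have "u [^] i \<otimes> u [^] (2 * i) = (u [^] (3::nat)) [^] i"
    using u(1) by (simp add: nat_pow_mult nat_pow_pow)
  then have "u [^] i \<otimes> v [^] j = u [^] i \<otimes> u [^] (2 * i)" using ij u by simp
  then have vj: "v [^] j = u [^] (2 * i)" using u(1) v(1) by simp
  have j: "j = 0"
  proof (rule ccontr)
    assume "j \<noteq> 0"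
    then have "j = 1 \<or> j = 2" using ij(2) by linarith
    then have "j * j mod 3 = 1" by auto
    then have "v = v [^] (j * j)" using pow_mod_period[OF v, of "j * j"] v(1) by simp
    also have "\<dots> = u [^] (2 * i * j)" using vj u(1) v(1) by (metis nat_pow_pow)
    finally show False using ne(2) by blast
  qed
  have "i = 0"
  proof (rule ccontr)
    assume "i \<noteq> 0"
    then have "i = 1 \<or> i = 2" using ij(1) by linarith
    then have "i * i mod 3 = 1" by auto
    then have "u = u [^] (i * i)" using pow_mod_period[OF u, of "i * i"] u(1) by simp
    also have "\<dots> = (u [^] i) [^] i" using u(1) by (simp add: nat_pow_pow)
    also have "\<dots> = \<one>" using ij(3) j u(1) by simp
    finally show False using ne(1) by simp
  qed
  then show ?thesis using j by simp
qed

text \<open>The group is abelian. If it is cyclic, a multiplier that is 1 modulo 3 would fix the elements of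
  order three. Otherwise it is a plane over the field with three elements. Either some \<open>u\<close> is
  independent of \<open>\<psi> u\<close>, and \<open>\<psi>\<close> is a companion matrix whose characteristic polynomial has neither
  root 0 nor root 1; or every vector is an eigenvector, necessarily for the eigenvalue 2.\<close>

lemma order_nine_fixed_point_free:
  assumes ord9: "order G = 9" and card_D: "card D = 9"
  shows "(\<exists>a\<in>{2, 5, 8}. realizes (affine_model 9 a) G \<psi>) \<or>
    (\<exists>(a, b)\<in>{(1, 1), (1, 2), (2, 0), (2, 1)}. realizes (companion_model 3 a b) G \<psi>) \<or>
    realizes (abelian_model 3 3 1 (2,0,0) (0,2,0) (0,0,0) ({..<3} \<times> {..<3} \<times> {..<1})) G \<psi>"
proof (cases "\<exists>g\<in>carrier G. ord g = 9")
  case True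
  then obtain g where g: "g \<in> carrier G" "ord g = order G" using ord9 by auto
  obtain a where a: "a < 9" "coprime a 9" "realizes (affine_model 9 a) G \<psi>"
    using realizes_affine_model[OF g] ord9 by auto
  have "\<forall>a\<in>set [0, 3, 6]. \<not> coprime a (9::nat)" by code_simp
  moreover have "a \<notin> {1, 4, 7}"
  proof
    assume a147: "a \<in> {1, 4, 7}"
    let ?Z = "cyclic3 9 1 1" and ?\<theta> = "linear3 9 1 1 (a, 0, 0) (0, 0, 0) (0, 0, 0)"
    obtain c where c: "c \<in> hom ?Z G" "inj_on c (carrier ?Z)"
      and c_aut: "\<And>x. x \<in> carrier ?Z \<Longrightarrow> c (?\<theta> x) = \<psi> (c x)"
      using a(3) by (auto simp: realizes_def affine_model_def cyclic_model_def abelian_model_def)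
    interpret c: group_hom ?Z G c
      using c(1) group_cyclic3[of 9 1 1] by (simp add: group_hom_def group_hom_axioms_def is_group)
    have z3: "(3, 0, 0) \<in> carrier ?Z" and z0: "\<one>\<^bsub>?Z\<^esub> = (0, 0, 0)" by (simp_all add: cyclic3_def)
    \<comment> \<open>the element of order three is fixed\<close>
    have "?\<theta> (3, 0, 0) = (3, 0, 0)" using a147 by (auto simp: linear3_def)
    then have "\<psi> (c (3, 0, 0)) = c (3, 0, 0)" using c_aut[OF z3] by simp
    moreover have "D = carrier G \<and> (\<forall>x\<in>carrier G. \<psi> x = x \<longrightarrow> x = \<one>)"
      using full_displacements ord9 card_D by metis
    ultimately have "c (3, 0, 0) = c (0, 0, 0)"
      using c.hom_closed[OF z3] c.hom_one z0 by simp
    then show False using inj_onD[OF c(2) _ z3, of "(0, 0, 0)"] by (simp add: cyclic3_def)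
  qed
  moreover have "a \<in> {0, 3, 6} \<or> a \<in> {1, 4, 7} \<or> a \<in> {2, 5, 8}" using a(1) by auto
  ultimately have "a \<in> {2, 5, 8}" using a(2) by auto
  then show ?thesis using a(3) by blast
next
  case False
  have card_eq: "card D = order G" using card_D ord9 by simp
  note conn = full_displacements[OF card_eq]
  have cube: "x [^] (3::nat) = \<one>" if x: "x \<in> carrier G" for x
  proof -
    have "ord x dvd 9" using ord_dvd_group_order[OF x] ord9 by simp
    then have "ord x = 1 \<or> ord x = 3 \<or> ord x = 9" by (rule dvd_nine)
    moreover have "ord x \<noteq> 9" using False x by blast
    ultimately have "ord x dvd 3" by auto
    then show ?thesis using x by (simp add: pow_eq_id)
  qed
  have comm: "x \<otimes> y = y \<otimes> x" if "x \<in> carrier G" "y \<in> carrier G" for x y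
    using commutative_of_order_nine[OF ord9] that by blast
  have onto: "\<exists>i<3::nat. \<exists>j<3::nat. x = u [^] i \<otimes> v [^] j"
    if u: "u \<in> carrier G" and v: "v \<in> carrier G" and ne: "u \<noteq> \<one>" "\<And>k::nat. v \<noteq> u [^] k" and x: "x \<in> carrier G"
    for u v x
  proof -
    have "monomial u v \<one> ` ({..<3} \<times> {..<3} \<times> {..<1}) = carrier G"
    proof (rule monomial_onto)
      show "i = 0 \<and> j = 0 \<and> k = 0"
        if "i < 3" "j < 3" "k < 1" "u [^] i \<otimes> v [^] j \<otimes> \<one> [^] k = \<one>" for i j k :: nat
        using indep_of_exponent_three[OF u cube[OF u] v cube[OF v] ne, of i j] that u v by simp
    qed (use u v cube comm ord9 in simp_all)
    then obtain i j where "i < 3" "j < 3" "x = monomial u v \<one> (i, j, 0)" using x by force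
    then show ?thesis using u v by (auto simp: monomial_def)
  qed
  show ?thesis
  proof (cases "\<exists>u\<in>carrier G. \<forall>k::nat. \<psi> u \<noteq> u [^] k")
    case True
    then obtain u where u: "u \<in> carrier G" and \<psi>u: "\<And>k::nat. \<psi> u \<noteq> u [^] k" by blast
    define v where "v = \<psi> u"
    have v: "v \<in> carrier G" "\<And>k::nat. v \<noteq> u [^] k" using u \<psi>u by (simp_all add: v_def)
    have u1: "u \<noteq> \<one>" using \<psi>u[of 0] by auto
    have indep: "i = 0 \<and> j = 0" if "i < 3" "j < 3" "u [^] i \<otimes> v [^] j = \<one>" for i j :: nat
      by (rule indep_of_exponent_three[OF u cube[OF u] v(1) cube[OF v(1)] u1 v(2) that])
    obtain a b :: nat where ab: "a < 3" "b < 3" "\<psi> v = u [^] a \<otimes> v [^] b"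
      using onto[OF u v(1) u1 v(2), of "\<psi> v"] v by auto
    have "realizes (companion_model 3 a b) G \<psi>"
    proof (rule realizes_companion_model[where u = u])
      show "(\<lambda>(i, j). u [^] i \<otimes> \<psi> u [^] j) ` ({..<3::nat} \<times> {..<3::nat}) = D"
      proof
        show "D \<subseteq> (\<lambda>(i, j). u [^] i \<otimes> \<psi> u [^] j) ` ({..<3::nat} \<times> {..<3::nat})"
        proof
          fix x assume "x \<in> D"
          then obtain i j :: nat where "i < 3" "j < 3" "x = u [^] i \<otimes> v [^] j"
            using onto[OF u v(1) u1 v(2), of x] by auto
          then show "x \<in> (\<lambda>(i, j). u [^] i \<otimes> \<psi> u [^] j) ` ({..<3::nat} \<times> {..<3::nat})"
            by (intro image_eqI[of _ _ "(i, j)"]) (simp_all add: v_def)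
        qed
        show "(\<lambda>(i, j). u [^] i \<otimes> \<psi> u [^] j) ` ({..<3::nat} \<times> {..<3::nat}) \<subseteq> D"
          unfolding conn(1) using u by auto
      qed
    qed (use u v cube comm indep ab in \<open>simp_all add: v_def\<close>)
    moreover have "(a, b) \<in> {(1, 1), (1, 2), (2, 0), (2, 1)}"
    proof -
      have "a \<noteq> 0"
      proof
        assume "a = 0"
        then have "\<psi> v = v [^] b" using ab v by simp
        also have "\<dots> = \<psi> (u [^] b)" using u by (simp add: v_def)
        finally have "v = u [^] b" using u v(1) aut_eq_iff[of v "u [^] b"] by blast
        then show False using v(2) by blast
      qed
      moreover have "\<not> (a = 1 \<and> b = 0)"
      proof
        assume "a = 1 \<and> b = 0"
        then have "\<psi> v = u" using ab u v by simp
        then have "\<psi> (u \<otimes> v) = u \<otimes> v" using u v comm[OF u v(1)] by (simp add: v_def)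
        then have *: "u [^] (1::nat) \<otimes> v [^] (1::nat) = \<one>" using conn(2)[of "u \<otimes> v"] u v by simp
        show False using indep[OF _ _ *] by simp
      qed
      moreover have "\<not> (a = 2 \<and> b = 2)"
      proof
        assume "a = 2 \<and> b = 2"
        then have \<psi>v: "\<psi> v = u [^] (2::nat) \<otimes> v [^] (2::nat)" using ab by simp
        have "\<psi> (u [^] (2::nat) \<otimes> v) = v [^] (2::nat) \<otimes> (u [^] (2::nat) \<otimes> v [^] (2::nat))"
          using u aut_mult[of "u [^] (2::nat)" v] v(1) \<psi>v by (simp add: v_def)
        also have "\<dots> = u [^] (2::nat) \<otimes> (v [^] (2::nat) \<otimes> v [^] (2::nat))"
          using u v comm[of "v [^] (2::nat)" "u [^] (2::nat)"] by (simp flip: m_assoc)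
        also have "v [^] (2::nat) \<otimes> v [^] (2::nat) = v [^] (3::nat) \<otimes> v"
          using v by (simp add: eval_nat_numeral m_assoc)
        also have "\<dots> = v" using cube v by simp
        finally have "\<psi> (u [^] (2::nat) \<otimes> v) = u [^] (2::nat) \<otimes> v" .
        then have *: "u [^] (2::nat) \<otimes> v [^] (1::nat) = \<one>" using conn(2)[of "u [^] (2::nat) \<otimes> v"] u v by simp
        show False using indep[OF _ _ *] by simp
      qed
      ultimately show ?thesis using ab(1,2) by auto
    qed
    ultimately show ?thesis by blast
  next
    case all_powers: False
    have sq: "\<psi> u = u [^] (2::nat)" if u: "u \<in> carrier G" for u
    proof (cases "u = \<one>")
      case False
      obtain k :: nat where k: "\<psi> u = u [^] k" using all_powers u by blast
      then have k3: "\<psi> u = u [^] (k mod 3)" using pow_mod_period[OF u cube[OF u], of k] by simp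
      have "k mod 3 \<noteq> 0" using k3 False u by (metis aut_eq_one_iff nat_pow_0)
      moreover have "k mod 3 \<noteq> 1" using k3 False u conn(2)[of u] by auto
      ultimately have "k mod 3 = 2" by linarith
      then show ?thesis using k3 by simp
    qed simp
    have "carrier G \<noteq> {\<one>}" using ord9 by (auto simp: order_def)
    then obtain u where u: "u \<in> carrier G" "u \<noteq> \<one>" by blast
    have "\<exists>v\<in>carrier G. \<forall>k::nat. v \<noteq> u [^] k"
    proof (rule ccontr)
      assume "\<not> ?thesis"
      then have "carrier G \<subseteq> (\<lambda>k. u [^] k) ` {..<3::nat}"
        using pow_mod_period[OF u(1) cube[OF u(1)]] by (metis (no_types, lifting) image_eqI lessThan_iff mod_less_divisor subsetI zero_less_numeral)
      then have "order G \<le> card ((\<lambda>k. u [^] k) ` {..<3::nat})" unfolding order_def by (intro card_mono) simp_all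
      also have "\<dots> \<le> 3" using card_image_le[of "{..<3::nat}"] by simp
      finally show False using ord9 by simp
    qed
    then obtain v where v: "v \<in> carrier G" "\<And>k::nat. v \<noteq> u [^] k" by blast
    have indep: "i = 0 \<and> j = 0 \<and> k = 0"
      if "i < 3" "j < 3" "k < 1" "u [^] i \<otimes> v [^] j \<otimes> \<one> [^] k = \<one>" for i j k :: nat
      using indep_of_exponent_three[OF u(1) cube[OF u(1)] v(1) cube[OF v(1)] u(2) v(2), of i j] that u v by simp
    have "realizes (abelian_model 3 3 1 (2,0,0) (0,2,0) (0,0,0) ({..<3} \<times> {..<3} \<times> {..<1})) G \<psi>"
    proof (rule realizes_abelian_model[where u = u and v = v and w = \<one>])
      have "monomial u v \<one> ` ({..<3} \<times> {..<3} \<times> {..<1}) = carrier G"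
        by (rule monomial_onto[OF u(1) v(1) one_closed comm[OF u(1) v(1)] _ _ cube[OF u(1)] cube[OF v(1)] _ _ _ _ indep])
          (use u(1) v(1) ord9 in simp_all)
      then show "monomial u v \<one> ` ({..<3} \<times> {..<3} \<times> {..<1}) = D" using conn by simp
      show "u \<otimes> v = v \<otimes> u" by (rule comm[OF u(1) v(1)])
      show "i = 0 \<and> j = 0 \<and> k = 0"
        if "i < 3" "j < 3" "k < 1" "u [^] i \<otimes> v [^] j \<otimes> \<one> [^] k = \<one>" for i j k :: nat
        by (rule indep[OF that])
    qed (use u(1) v(1) cube[OF u(1)] cube[OF v(1)] sq[OF u(1)] sq[OF v(1)] in \<open>simp_all add: monomial_def\<close>)
    then show ?thesis by blast
  qed
qed

lemma funpow_group_aut: "group_aut G (\<psi> ^^ k)"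
proof -
  have "(\<psi> ^^ k) \<in> iso G G"
  proof (induction k)
    case 0
    show ?case by (simp add: iso_def hom_def bij_betw_def)
  next
    case (Suc k)
    then show ?case using iso_set_trans[OF Suc aut] by (simp add: comp_def)
  qed
  then show ?thesis using is_group by (simp add: group_aut_def group_aut_axioms_def)
qed

text \<open>Without nontrivial fixed points all fibres of \<open>\<delta>\<close> are singletons.\<close>

lemma fixed_point_free_displacements:
  assumes "\<And>x. x \<in> carrier G \<Longrightarrow> \<psi> x = x \<Longrightarrow> x = \<one>"
  shows "D = carrier G" "x \<in> carrier G \<Longrightarrow> y \<in> carrier G \<Longrightarrow> \<delta> x = \<delta> y \<Longrightarrow> x = y"
proof -
  have "fixed = {\<one>}" using assms fixedI[OF one_closed aut_one] fixedD by (auto dest: fixed_closed)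
  then have F: "fixed = {\<one>}" .
  then have "card D = order G" using card_displacements by simp
  then show "D = carrier G" by (rule full_displacements(1))
  show "x = y" if "x \<in> carrier G" "y \<in> carrier G" "\<delta> x = \<delta> y" for x y
  proof -
    have "inv x \<otimes> y = \<one>" using disp_eq_iff[OF that(1,2)] that(3) F by simp
    then show ?thesis using that by (metis inv_closed inv_equality inv_inv)
  qed
qed

lemma involution_power:
  assumes "x \<in> carrier G" "x \<noteq> \<one>" "x [^] (8::nat) = \<one>"
  obtains k :: nat where "x [^] k \<noteq> \<one>" "x [^] k \<otimes> x [^] k = \<one>"
proof -
  have dbl: "x [^] k \<otimes> x [^] k = x [^] (k + k)" for k :: nat using assms by (simp add: nat_pow_mult)
  consider "x [^] (2::nat) = \<one>" | "x [^] (2::nat) \<noteq> \<one>" "x [^] (4::nat) = \<one>" | "x [^] (4::nat) \<noteq> \<one>"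
    by blast
  then show ?thesis
  proof cases
    case 1 then show ?thesis using that[of 1] assms by (simp add: numeral_2_eq_2)
  next
    case 2 then show ?thesis using that[of 2] dbl[of 2] by simp
  next
    case 3 then show ?thesis using that[of 4] dbl[of 4] assms by simp
  qed
qed

text \<open>Write \<open>x = \<delta> y\<close>. Injectivity of \<open>\<delta>\<close> yields \<open>\<psi> (\<psi> y) = y\<close>, hence \<open>\<psi> x = inv x\<close>. A power of \<open>x\<close> that is
  an involution would then be a nontrivial fixed point.\<close>

lemma square_fixed_point_free:
  assumes ord: "order G = 8" and fpf: "\<And>x. x \<in> carrier G \<Longrightarrow> \<psi> x = x \<Longrightarrow> x = \<one>"
    and x: "x \<in> carrier G" "\<psi> (\<psi> x) = x"
  shows "x = \<one>"
proof (rule ccontr)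
  assume "x \<noteq> \<one>"
  note conn = fixed_point_free_displacements[OF fpf]
  have "x \<in> D" using x conn(1) by simp
  then obtain y where y: "y \<in> carrier G" "x = \<delta> y" unfolding displacements_eq by blast
  have "\<delta> (\<psi> (\<psi> y)) = \<delta> y" using x y by (simp add: aut_disp[symmetric])
  then have \<psi>y: "\<psi> (\<psi> y) = y" using conn(2)[of "\<psi> (\<psi> y)" y] y by simp
  have \<psi>x: "\<psi> x = inv x" using y \<psi>y by (simp add: disp_def inv_mult_group)
  have "x [^] (8::nat) = \<one>" using pow_order_eq_1[OF x(1)] ord by simp
  then obtain k :: nat where k: "x [^] k \<noteq> \<one>" "x [^] k \<otimes> x [^] k = \<one>"
    using involution_power[OF x(1) \<open>x \<noteq> \<one>\<close>] by blast
  have "inv (x [^] k) = x [^] k" using k(2) x by (simp add: inv_equality)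
  then have "\<psi> (x [^] k) = x [^] k" using x \<psi>x by (simp add: nat_pow_inv)
  then show False using fpf[of "x [^] k"] k(1) x by simp
qed

text \<open>Let \<open>u\<close> be an involution among the powers of \<open>x\<close>. Again \<open>u = \<delta> y\<close> where the cube of \<open>\<psi>\<close> fixes
  \<open>y\<close>, so the product of \<open>u\<close>, \<open>\<psi> u\<close> and \<open>\<psi> (\<psi> u)\<close> telescopes to \<open>\<one>\<close>. These three involutions thus form an
  invariant Klein four-group of index two, and all displacements would lie in it.\<close>

lemma cube_fixed_point_free:
  assumes ord: "order G = 8" and fpf: "\<And>x. x \<in> carrier G \<Longrightarrow> \<psi> x = x \<Longrightarrow> x = \<one>"
    and x: "x \<in> carrier G" "\<psi> (\<psi> (\<psi> x)) = x"
  shows "x = \<one>"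
proof (rule ccontr)
  assume "x \<noteq> \<one>"
  note conn = fixed_point_free_displacements[OF fpf]
  have "x [^] (8::nat) = \<one>" using pow_order_eq_1[OF x(1)] ord by simp
  then obtain k :: nat where k: "x [^] k \<noteq> \<one>" "x [^] k \<otimes> x [^] k = \<one>"
    using involution_power[OF x(1) \<open>x \<noteq> \<one>\<close>] by blast
  define u v w where "u = x [^] k" and "v = \<psi> u" and "w = \<psi> v"
  have G [simp]: "u \<in> carrier G" "v \<in> carrier G" "w \<in> carrier G" using x by (simp_all add: u_def v_def w_def)
  have \<psi>: "\<psi> u = v" "\<psi> v = w" "\<psi> w = u" using x by (simp_all add: u_def v_def w_def)
  have u: "u \<noteq> \<one>" "u \<otimes> u = \<one>" using k by (simp_all add: u_def)
  have vv: "v \<otimes> v = \<one>" using aut_mult[OF G(1) G(1)] u(2) \<psi>(1) by simp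
  have "w \<otimes> w = \<one>" using aut_mult[OF G(2) G(2)] vv \<psi>(2) by simp
  note sq = vv this
  have ne: "v \<noteq> \<one>" "w \<noteq> \<one>" "u \<noteq> v" "v \<noteq> w" "u \<noteq> w"
  proof -
    show v1: "v \<noteq> \<one>" using \<psi>(1) u(1) aut_eq_one_iff[OF G(1)] by auto
    show w1: "w \<noteq> \<one>" using \<psi>(2) v1 aut_eq_one_iff[OF G(2)] by auto
    show "u \<noteq> v" using \<psi>(1) u(1) fpf[OF G(1)] by auto
    show "v \<noteq> w" using \<psi>(2) v1 fpf[OF G(2)] by auto
    show "u \<noteq> w" using \<psi>(3) w1 fpf[OF G(3)] by auto
  qed
  have "u \<in> D" using conn(1) by simp
  then obtain y where y: "y \<in> carrier G" "u = \<delta> y" unfolding displacements_eq by blast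
  have "\<delta> (\<psi> (\<psi> (\<psi> y))) = \<delta> y" using \<psi> y by (simp add: aut_disp[symmetric])
  then have \<psi>y: "\<psi> (\<psi> (\<psi> y)) = y" using conn(2)[of "\<psi> (\<psi> (\<psi> y))" y] y by simp
  have "v = \<psi> y \<otimes> inv (\<psi> (\<psi> y))" "w = \<psi> (\<psi> y) \<otimes> inv y"
    using y \<psi>y \<psi> by (simp_all add: disp_def v_def w_def)
  moreover have "u = y \<otimes> inv (\<psi> y)" using y by (simp add: disp_def)
  moreover have "inv (\<psi> y) \<otimes> (\<psi> y \<otimes> z) = z" "inv (\<psi> (\<psi> y)) \<otimes> (\<psi> (\<psi> y) \<otimes> z) = z"
    if "z \<in> carrier G" for z
    using y that by (simp_all flip: m_assoc)
  ultimately have uvw: "u \<otimes> (v \<otimes> w) = \<one>" using y by (simp add: m_assoc)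
  have vw: "v \<otimes> w = u"
  proof -
    have "u \<otimes> (v \<otimes> w) = u \<otimes> u" using uvw u by simp
    then show ?thesis by simp
  qed
  then have wu: "w \<otimes> u = v" and uv: "u \<otimes> v = w" using \<psi> aut_mult[of v w] aut_mult[of w u] by simp_all
  have "inv (v \<otimes> w) = inv u" "inv (w \<otimes> u) = inv v" "inv (u \<otimes> v) = inv w"
    using vw wu uv by simp_all
  moreover have "inv u = u" "inv v = v" "inv w = w" using u sq by (simp_all add: inv_equality)
  ultimately have "w \<otimes> v = u" "u \<otimes> w = v" "v \<otimes> u = w" by (simp_all add: inv_mult_group)
  then have "subgroup {\<one>, u, v, w} G"
    using vw wu uv u sq by (intro subgroupI_finite) auto
  moreover have "card {\<one>, u, v, w} = 4" using u ne by auto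
  moreover have "\<psi> z \<in> {\<one>, u, v, w} \<longleftrightarrow> z \<in> {\<one>, u, v, w}" if "z \<in> carrier G" for z
    using that \<psi> aut_eq_iff[OF that G(1)] aut_eq_iff[OF that G(2)] aut_eq_iff[OF that G(3)]
    by (auto simp del: aut_eq_iff)
  ultimately have "D \<subseteq> {\<one>, u, v, w}" using ord by (intro displacements_in_index_two) simp_all
  then have "card D \<le> card {\<one>, u, v, w}" by (intro card_mono) simp_all
  then show False using conn(1) ord \<open>card {\<one>, u, v, w} = 4\<close> by (simp add: order_def)
qed

text \<open>The powers of \<open>\<psi>\<close> with exponent 1, 2, 3, 4 and 6 have no nontrivial fixed points. So the orbit of
  an involution consists of all seven nontrivial elements, the group is elementary abelian, and \<open>\<psi>\<close>
  is a root of one of the two irreducible cubic polynomials over the field with two elements.\<close>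

lemma order_eight_fixed_point_free:
  assumes ord: "order G = 8" and card_D: "card D = 8"
  shows "realizes (abelian_model 2 2 2 (0,1,0) (0,0,1) (1,1,0) ({..<2} \<times> {..<2} \<times> {..<2})) G \<psi> \<or>
    realizes (abelian_model 2 2 2 (0,1,0) (0,0,1) (1,0,1) ({..<2} \<times> {..<2} \<times> {..<2})) G \<psi>"
proof -
  have "card D = order G" using ord card_D by simp
  note conn = full_displacements[OF this]
  have fpf1: "\<And>x. x \<in> carrier G \<Longrightarrow> \<psi> x = x \<Longrightarrow> x = \<one>" by (rule conn(2))
  interpret P2: group_aut G "\<psi> ^^ 2" by (rule funpow_group_aut)
  interpret P3: group_aut G "\<psi> ^^ 3" by (rule funpow_group_aut)
  have fpf2: "x = \<one>" if "x \<in> carrier G" "(\<psi> ^^ 2) x = x" for x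
    using square_fixed_point_free[OF ord fpf1] that by (simp add: numeral_2_eq_2)
  have fpf3: "x = \<one>" if "x \<in> carrier G" "(\<psi> ^^ 3) x = x" for x
    using cube_fixed_point_free[OF ord fpf1] that by (simp add: numeral_3_eq_3)
  have fpf4: "x = \<one>" if "x \<in> carrier G" "(\<psi> ^^ 4) x = x" for x
    using P2.square_fixed_point_free[OF ord fpf2] that by (simp add: eval_nat_numeral)
  have fpf6: "x = \<one>" if "x \<in> carrier G" "(\<psi> ^^ 6) x = x" for x
    using P3.square_fixed_point_free[OF ord fpf3] that by (simp add: eval_nat_numeral)
  obtain u where u: "u \<in> carrier G" "u \<noteq> \<one>" "u \<otimes> u = \<one>"
  proof -
    have "carrier G \<noteq> {\<one>}" using ord by (auto simp: order_def)
    then obtain x where x: "x \<in> carrier G" "x \<noteq> \<one>" by blast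
    have "x [^] (8::nat) = \<one>" using pow_order_eq_1[OF x(1)] ord by simp
    then obtain k :: nat where "x [^] k \<noteq> \<one>" "x [^] k \<otimes> x [^] k = \<one>"
      using involution_power[OF x] by blast
    then show ?thesis using that[of "x [^] k"] x by simp
  qed
  define r where "r i = (\<psi> ^^ i) u" for i
  have r_closed [simp]: "r i \<in> carrier G" for i by (induction i) (simp_all add: r_def u)
  have r_Suc: "\<psi> (r i) = r (Suc i)" for i by (simp add: r_def)
  have r_add: "(\<psi> ^^ k) (r i) = r (k + i)" for i k by (simp add: r_def funpow_add)
  have r_ne_one: "r i \<noteq> \<one>" for i
  proof (induction i)
    case (Suc i)
    then show ?case using aut_eq_one_iff[OF r_closed[of i]] by (simp add: r_Suc)
  qed (simp add: r_def u)
  have r_sq: "r i \<otimes> r i = \<one>" for i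
  proof (induction i)
    case (Suc i)
    then show ?case using aut_mult[OF r_closed[of i] r_closed[of i]] by (simp add: r_Suc)
  qed (simp add: r_def u)
  have r_inj: "r i = r j" if "r (k + i) = r (k + j)" for i j k
    using that by (induction k) (simp_all add: r_Suc[symmetric])
  have step: "r (k + i) \<noteq> r i" if "k \<in> {1, 2, 3, 4, 6}" for k i
    using that r_ne_one[of i] fpf1[OF r_closed[of i]] fpf2[OF r_closed[of i]] fpf3[OF r_closed[of i]] fpf4[OF r_closed[of i]] fpf6[OF r_closed[of i]]
      r_add[of 2 i] r_add[of 3 i] r_add[of 4 i] r_add[of 6 i] r_Suc[of i] by auto
  \<comment> \<open>a five-cycle would leave only two elements for the remaining orbits\<close>
  have r5: "r 5 \<noteq> r 0"
  proof
    assume r5: "r 5 = r 0"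
    let ?S = "{\<one>, r 0, r 1, r 2, r 3, r 4}"
    have "card ?S = 6"
      using r_ne_one step[of 1 0] step[of 2 0] step[of 3 0] step[of 4 0] step[of 1 1] step[of 2 1] step[of 3 1]
        step[of 1 2] step[of 2 2] step[of 1 3] r_ne_one[THEN not_sym] by (auto simp: eval_nat_numeral)
    then have "card (carrier G - ?S) = 2" using ord u by (subst card_Diff_subset) (auto simp: order_def)
    then obtain p q where pq: "carrier G - ?S = {p, q}" by (metis card_2_iff)
    have stable: "\<psi> x \<in> {p, q}" if "x \<in> {p, q}" for x
    proof -
      have x: "x \<in> carrier G" "x \<notin> ?S" using that pq by blast+
      have "\<psi> x \<noteq> \<one>" using x by simp
      moreover have "\<psi> x \<noteq> r (Suc i)" if "i \<in> {0, 1, 2, 3, 4}" for i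
        using x that aut_eq_iff[OF x(1) r_closed[of i]] by (auto simp: r_Suc[symmetric])
      from this[of 0] this[of 1] this[of 2] this[of 3] this[of 4] r5
      have "\<psi> x \<notin> {r 0, r 1, r 2, r 3, r 4}" by (simp add: eval_nat_numeral)
      ultimately have "\<psi> x \<in> carrier G - ?S" using x by simp
      then show ?thesis unfolding pq .
    qed
    have p: "p \<in> carrier G" "p \<noteq> \<one>" "q \<in> carrier G" "q \<noteq> \<one>" using pq by blast+
    have "\<psi> p = q" "\<psi> q = p" using stable[of p] stable[of q] fpf1 p by blast+
    then have "(\<psi> ^^ 2) p = p" by (simp add: numeral_2_eq_2)
    then show False using fpf2[OF p(1)] p by simp
  qed
  then have step: "r (k + i) \<noteq> r i" if "k \<in> {1, 2, 3, 4, 5, 6}" for k i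
  proof (cases "k = 5")
    case True
    then show ?thesis using r5 r_inj[of i 5 0] by (auto simp: add.commute)
  next
    case False
    then show ?thesis using that step by auto
  qed
  have r_ne: "r i \<noteq> r j" if "i < j" "j \<le> i + 6" for i j
  proof -
    have "j - i \<in> {1, 2, 3, 4, 5, 6}" using that by auto
    then have "r (j - i + i) \<noteq> r i" by (rule step)
    then show ?thesis using that by simp
  qed
  have "inj_on r {..<7}"
  proof (rule inj_onI)
    fix i j :: nat assume ij: "i \<in> {..<7}" "j \<in> {..<7}" "r i = r j"
    show "i = j" using r_ne[of i j] r_ne[of j i] ij by (cases i j rule: linorder_cases) auto
  qed
  then have "card (insert \<one> (r ` {..<7})) = 8" using r_ne_one[THEN not_sym] by (subst card_insert_disjoint) (auto simp: card_image)
  then have all: "carrier G = insert \<one> (r ` {..<7})"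
    using ord by (intro card_subset_eq[symmetric]) (auto simp: order_def)
  have "r 7 \<in> insert \<one> (r ` {..<7})" using all by auto
  then obtain i where i: "i < 7" "r 7 = r i" using r_ne_one by auto
  have r7: "r 7 = r 0"
  proof (cases "i = 0")
    case False
    then show ?thesis using i r_ne[of i 7] by auto
  qed (use i in simp)
  have sq: "x \<otimes> x = \<one>" if "x \<in> carrier G" for x using that r_sq unfolding all by auto
  have comm: "x \<otimes> y = y \<otimes> x" if "x \<in> carrier G" "y \<in> carrier G" for x y
  proof -
    have "inv (x \<otimes> y) = x \<otimes> y" "inv x = x" "inv y = y" using that sq by (simp_all add: inv_equality)
    then show ?thesis using that by (simp add: inv_mult_group)
  qed
  have r_mult: "r (k + i) \<otimes> r (k + j) = r (k + l)" if "r i \<otimes> r j = r l" for i j k l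
  proof (induction k)
    case (Suc k)
    then show ?case using aut_mult[OF r_closed r_closed, of "k + i" "k + j"] by (simp add: r_Suc)
  qed (use that in simp)
  have not2: "r 0 \<otimes> r 1 \<noteq> r 2"
  proof
    assume a: "r 0 \<otimes> r 1 = r 2"
    have "r 3 = r 1 \<otimes> r 2" using r_mult[OF a, of 1] by (simp add: eval_nat_numeral)
    also have "\<dots> = r 1 \<otimes> (r 1 \<otimes> r 0)" using a comm[of "r 0" "r 1"] by simp
    also have "\<dots> = r 0" using r_sq[of 1] by (simp flip: m_assoc)
    finally show False using r_ne[of 0 3] by simp
  qed
  have indep: "i = 0 \<and> j = 0 \<and> k = 0"
    if "i < 2" "j < 2" "k < 2" "r 0 [^] i \<otimes> r 1 [^] j \<otimes> r 2 [^] k = \<one>" for i j k :: nat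
  proof -
    have *: "x \<noteq> y \<Longrightarrow> x \<otimes> y \<noteq> \<one>" if "x \<in> carrier G" "y \<in> carrier G" for x y
      using that sq[of y] by (metis r_cancel_one' right_cancel)
    have "i \<in> {0, 1}" "j \<in> {0, 1}" "k \<in> {0, 1}" using that by auto
    then show ?thesis
      using that(4) r_ne_one *[of "r 0" "r 1"] *[of "r 0" "r 2"] *[of "r 1" "r 2"] *[of "r 0 \<otimes> r 1" "r 2"]
        not2 r_ne[of 0 1] r_ne[of 0 2] r_ne[of 1 2] by auto
  qed
  have period: "r i [^] (2::nat) = \<one>" for i using r_sq by (simp add: numeral_2_eq_2)
  have E: "monomial (r 0) (r 1) (r 2) ` ({..<2} \<times> {..<2} \<times> {..<2}) = D"
    unfolding conn(1)
    by (rule monomial_onto[OF r_closed r_closed r_closed comm[OF r_closed r_closed] comm[OF r_closed r_closed] comm[OF r_closed r_closed] period period period _ _ _ indep])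
      (simp_all add: ord)
  have model: "realizes (abelian_model 2 2 2 (0,1,0) (0,0,1) t ({..<2} \<times> {..<2} \<times> {..<2})) G \<psi>"
    if t: "r 3 = monomial (r 0) (r 1) (r 2) t" for t
    by (rule realizes_abelian_model[OF r_closed r_closed r_closed comm[OF r_closed r_closed] comm[OF r_closed r_closed] comm[OF r_closed r_closed]
          period period period _ _ _ indep _ _ _ E])
      (use t in \<open>simp_all add: monomial_def r_Suc numeral_2_eq_2 numeral_3_eq_3\<close>)
  have "r 0 \<otimes> r 1 \<in> insert \<one> (r ` {..<7})" using all by (metis m_closed r_closed)
  moreover have "r 0 \<otimes> r 1 \<noteq> \<one>" using indep[of 1 1 0] by auto
  ultimately obtain k where k: "k < 7" "r 0 \<otimes> r 1 = r k" by auto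
  have "r 0 \<otimes> r 1 \<noteq> r 0" "r 0 \<otimes> r 1 \<noteq> r 1" using r_ne_one[of 0] r_ne_one[of 1] by simp_all
  then have "k \<noteq> 0" "k \<noteq> 1" using k(2) by metis+
  moreover have "k \<noteq> 2" using k(2) not2 by auto
  moreover have "k \<noteq> 4"
  proof
    assume "k = 4"
    then have a: "r 0 \<otimes> r 1 = r 4" using k by simp
    have "r 3 \<otimes> r 4 = r 0" using r_mult[OF a, of 3] r7 by (simp add: eval_nat_numeral)
    then have "r 3 \<otimes> (r 1 \<otimes> r 0) = r 0" using a comm[of "r 0" "r 1"] by simp
    then have "(r 3 \<otimes> r 1) \<otimes> r 0 = \<one> \<otimes> r 0" by (simp add: m_assoc)
    then have "r 3 \<otimes> r 1 = \<one>" by (simp del: l_one)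
    then have "r 3 \<otimes> r 1 = r 1 \<otimes> r 1" using r_sq by simp
    then show False using r_ne[of 1 3] by simp
  qed
  moreover have "k \<noteq> 6"
  proof
    assume "k = 6"
    then have a: "r 0 \<otimes> r 1 = r 6" using k by simp
    have "r 1 \<otimes> r 2 = r 0" using r_mult[OF a, of 1] r7 by (simp add: eval_nat_numeral)
    then have "r 0 \<otimes> r 1 = r 1 \<otimes> (r 1 \<otimes> r 2)" using comm[of "r 0" "r 1"] by simp
    also have "\<dots> = r 2" using r_sq[of 1] by (simp flip: m_assoc)
    finally show False using not2 by simp
  qed
  ultimately consider "k = 3" | "k = 5" using k(1) by linarith
  then show ?thesis
  proof cases
    case 1
    then have "r 3 = monomial (r 0) (r 1) (r 2) (1, 1, 0)" using k by (simp add: monomial_def)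
    then show ?thesis using model by blast
  next
    case 2
    then have a: "r 0 \<otimes> r 1 = r 5" using k by simp
    have "r 2 \<otimes> r 3 = r 0" using r_mult[OF a, of 2] r7 by (simp add: eval_nat_numeral)
    then have "r 2 \<otimes> (r 2 \<otimes> r 3) = r 2 \<otimes> r 0" by simp
    moreover have "r 2 \<otimes> (r 2 \<otimes> r 3) = r 3" using r_sq[of 2] by (simp flip: m_assoc)
    ultimately have "r 3 = r 0 \<otimes> r 2" using comm[of "r 0" "r 2"] by simp
    then have "r 3 = monomial (r 0) (r 1) (r 2) (1, 0, 1)" by (simp add: monomial_def)
    then show ?thesis using model by blast
  qed
qed

section \<open>Six or twelve displacements in a group of order twelve\<close>

text \<open>Suppose there are elements \<open>z\<close> and \<open>y\<close> of order three that generate different subgroups. They do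
  not commute, since 9 does not divide 12. Conjugation by \<open>z\<close> moves \<open>y\<close> and \<open>y \<otimes> y\<close> along two
  disjoint three-cycles, which together with \<open>z\<close> and \<open>z \<otimes> z\<close> make eight elements of order three. A
  Sylow 2-subgroup must then contain all other elements.\<close>

lemma order_twelve_dichotomy:
  assumes ord: "order G = 12"
  obtains (unique) z where "z \<in> carrier G" "z \<noteq> \<one>" "z \<otimes> (z \<otimes> z) = \<one>"
      "\<And>y. y \<in> carrier G \<Longrightarrow> y \<otimes> (y \<otimes> y) = \<one> \<Longrightarrow> y \<in> {\<one>, z, z \<otimes> z}"
  | (complement) S where "subgroup S G" "card S = 4"
      "\<And>x. x \<in> carrier G \<Longrightarrow> x \<in> S \<longleftrightarrow> x = \<one> \<or> x \<otimes> (x \<otimes> x) \<noteq> \<one>"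
proof -
  have "prime (3::nat)" by simp
  obtain H where H: "subgroup H G" "card H = 3" using cauchy[OF \<open>prime 3\<close>] ord by auto
  obtain z where z: "z \<in> carrier G" "z \<in> H" "z \<noteq> \<one>" by (rule prime_subgroup_generator[OF H \<open>prime 3\<close>])
  note [simp] = z(1)
  have zpow: "z [^] (3::nat) = \<one>" using pow_card_subgroup[OF H(1) z(2)] H(2) by simp
  then have zzz: "z \<otimes> (z \<otimes> z) = \<one>" by (simp add: numeral_3_eq_3 m_assoc)
  show ?thesis
  proof (cases "\<forall>y\<in>carrier G. y \<otimes> (y \<otimes> y) = \<one> \<longrightarrow> y \<in> {\<one>, z, z \<otimes> z}")
    case True
    then show ?thesis using unique[of z] z zzz by blast
  next
    case False
    then obtain y where y [simp]: "y \<in> carrier G" and yyy: "y \<otimes> (y \<otimes> y) = \<one>"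
      and y_notin: "y \<notin> {\<one>, z, z \<otimes> z}" by blast
    have ypow: "y [^] (3::nat) = \<one>" using yyy by (simp add: numeral_3_eq_3 m_assoc)
    define \<iota> where "\<iota> x = z \<otimes> x \<otimes> inv z" for x
    have "group_aut G \<iota>" unfolding \<iota>_def by (rule inner_group_aut[OF finite_carrier z(1)])
    then interpret \<iota>: group_aut G \<iota> .
    have \<iota>3: "\<iota> (\<iota> (\<iota> x)) = x" if "x \<in> carrier G" for x
    proof -
      have "\<iota> (\<iota> (\<iota> x)) = (z \<otimes> (z \<otimes> z)) \<otimes> x \<otimes> inv (z \<otimes> (z \<otimes> z))"
        using that by (simp add: \<iota>_def m_assoc inv_mult_group)
      then show ?thesis using zzz that by simp
    qed
    have \<iota>z: "\<iota> z = z" by (simp add: \<iota>_def m_assoc)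
    have not_comm: "z \<otimes> y \<noteq> y \<otimes> z"
    proof
      assume comm: "z \<otimes> y = y \<otimes> z"
      have zk: "z [^] k \<in> {\<one>, z, z \<otimes> z}" for k :: nat
      proof -
        have "k mod 3 = 0 \<or> k mod 3 = 1 \<or> k mod 3 = 2" by linarith
        then have "z [^] (k mod 3) \<in> {\<one>, z, z \<otimes> z}" by (auto simp: numeral_2_eq_2)
        then show ?thesis using pow_mod_period[OF z(1) zpow, of k] by simp
      qed
      have indep: "i = 0 \<and> j = 0 \<and> k = 0"
        if "i < 3" "j < 3" "k < 1" "z [^] i \<otimes> y [^] j \<otimes> \<one> [^] k = \<one>" for i j k :: nat
      proof -
        have "\<And>k::nat. y \<noteq> z [^] k" using zk y_notin by metis
        then show ?thesis
          using indep_of_exponent_three[OF z(1) zpow y ypow z(3), of i j] that by simp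
      qed
      have "3 * 3 * 1 dvd order G"
        by (rule monomial_order_dvd[OF z(1) y one_closed comm _ _ zpow ypow _ _ _ _ indep]) simp_all
      then show False using ord by simp
    qed
    define a where "a = y \<otimes> y"
    define b b' c c' where "b = \<iota> y" and "b' = \<iota> a" and "c = \<iota> b" and "c' = \<iota> b'"
    have G [simp]: "a \<in> carrier G" "b \<in> carrier G" "b' \<in> carrier G" "c \<in> carrier G" "c' \<in> carrier G"
      by (simp_all add: a_def b_def b'_def c_def c'_def)
    have \<iota>: "\<iota> y = b" "\<iota> a = b'" "\<iota> b = c" "\<iota> b' = c'" "\<iota> c = y" "\<iota> c' = a"
      using \<iota>3[OF y] \<iota>3[OF G(1)] by (simp_all add: b_def b'_def c_def c'_def)
    have yy: "y \<otimes> y = a" by (simp add: a_def)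
    have bb': "b \<otimes> b = b'" using \<iota>.aut_mult[OF y y] \<iota> yy by simp
    have "c \<otimes> c = c'" using \<iota>.aut_mult[OF G(2,2)] \<iota> bb' by simp
    note sq = yy bb' this
    have aa: "a \<otimes> a = y" using yyy by (simp add: a_def m_assoc)
    have bb: "b' \<otimes> b' = b" using \<iota>.aut_mult[OF G(1,1)] \<iota> aa by simp
    have yb: "y \<noteq> b"
    proof
      assume "y = b"
      then have "\<iota> y = y" using \<iota> by simp
      then have "z \<otimes> y \<otimes> inv z = y" by (simp add: \<iota>_def)
      then show False using not_comm inv_solve_right'[of y "z \<otimes> y" z] by simp
    qed
    have ya: "y \<noteq> a" using y_notin sq(1) by (metis insertI1 r_cancel_one' y)
    have ab: "a \<noteq> b"
    proof
      assume "a = b"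
      then have "b' = y" using sq aa by simp
      then have "\<iota> b' = b" using \<iota> by simp
      then have "\<iota> c' = c" using \<iota> by simp
      then have "c = a" using \<iota> by simp
      then have "c = b" using \<open>a = b\<close> by simp
      then have "\<iota> b = \<iota> y" using \<iota> by simp
      then show False using yb by simp
    qed
    have ab': "a \<noteq> b'" using yb aa bb by auto
    have yb': "y \<noteq> b'" using ab sq(1) bb by auto
    have d1: "distinct [y, a, b, b']" using yb ya ab ab' yb' \<iota>.aut_eq_iff[OF y G(1)] \<iota> by auto
    have d2: "distinct [b, b', c, c']"
      using d1 \<iota> \<iota>.aut_eq_iff[OF y G(2)] \<iota>.aut_eq_iff[OF y G(3)] \<iota>.aut_eq_iff[OF G(1) G(2)]
        \<iota>.aut_eq_iff[OF G(1) G(3)] \<iota>.aut_eq_iff[OF G(2) G(3)] \<iota>.aut_eq_iff[OF y G(1)] by auto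
    have d3: "distinct [c, c', y, a]"
      using d2 \<iota> \<iota>.aut_eq_iff[OF G(2) G(4)] \<iota>.aut_eq_iff[OF G(2) G(5)] \<iota>.aut_eq_iff[OF G(3) G(4)]
        \<iota>.aut_eq_iff[OF G(3) G(5)] \<iota>.aut_eq_iff[OF G(4) G(5)] \<iota>.aut_eq_iff[OF G(2) G(3)] by auto
    have \<iota>zz: "\<iota> (z \<otimes> z) = z \<otimes> z" using \<iota>.aut_mult[OF z(1) z(1)] \<iota>z by simp
    have moved: "x \<noteq> z \<and> x \<noteq> z \<otimes> z \<and> x \<noteq> \<one>" if "\<iota> x \<noteq> x" for x
      using that \<iota>z \<iota>zz \<iota>.aut_one by auto
    have all_moved: "\<forall>x\<in>{y, a, b, b', c, c'}. \<iota> x \<noteq> x" using d1 d2 d3 by (auto simp: \<iota>)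
    let ?X = "{z, z \<otimes> z, y, a, b, b', c, c'}"
    have zz: "z \<noteq> z \<otimes> z" "z \<otimes> z \<noteq> \<one>" using z(3) zzz by (auto simp: eq_commute[of z])
    have "distinct [z, z \<otimes> z, y, a, b, b', c, c']"
      using all_moved[THEN bspec, THEN moved] d1 d2 d3 zz by auto
    then have card_X: "card ?X = 8" using distinct_card by fastforce
    have cube: "x \<otimes> (x \<otimes> x) = \<one> \<and> x \<noteq> \<one>" if "x \<in> ?X" for x
    proof -
      have hom: "\<iota> x \<otimes> (\<iota> x \<otimes> \<iota> x) = \<one>" if "x \<in> carrier G" "x \<otimes> (x \<otimes> x) = \<one>" for x
        using that \<iota>.aut_mult[of x "x \<otimes> x"] by simp
      have aaa: "a \<otimes> (a \<otimes> a) = \<one>" using aa yyy by (simp add: a_def m_assoc)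
      have "z \<otimes> z \<otimes> (z \<otimes> z \<otimes> (z \<otimes> z)) = (z \<otimes> (z \<otimes> z)) \<otimes> (z \<otimes> (z \<otimes> z))" by (simp add: m_assoc)
      then have "z \<otimes> z \<otimes> (z \<otimes> z \<otimes> (z \<otimes> z)) = \<one>" using zzz by simp
      moreover have bbb: "b \<otimes> (b \<otimes> b) = \<one>" and bbb': "b' \<otimes> (b' \<otimes> b') = \<one>"
        using hom[OF y yyy] hom[OF G(1) aaa] unfolding \<iota> .
      moreover have "c \<otimes> (c \<otimes> c) = \<one>" "c' \<otimes> (c' \<otimes> c') = \<one>"
        using hom[OF G(2) bbb] hom[OF G(3) bbb'] unfolding \<iota> .
      ultimately have "x \<otimes> (x \<otimes> x) = \<one>"
        using that zzz yyy aaa by (elim insertE emptyE) (simp_all only:)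
      moreover have "x \<noteq> \<one>"
      proof
        assume "x = \<one>"
        then have "\<one> \<in> {y, a, b, b', c, c'}" using that z(3) zz(2) by simp
        then have "\<iota> \<one> \<noteq> \<one>" by (rule all_moved[THEN bspec])
        then show False by simp
      qed
      ultimately show ?thesis ..
    qed
    obtain S where S: "subgroup S G" "card S = 2 ^ 2"
      using sylow_thm[of 2 G 2 3] is_group ord by auto
    have sub: "S \<subseteq> carrier G" by (rule subgroup.subset[OF S(1)])
    let ?C = "{x \<in> carrier G. x \<otimes> (x \<otimes> x) = \<one> \<and> x \<noteq> \<one>}"
    have "?X \<subseteq> ?C" using cube by auto
    then have "8 \<le> card ?C" using card_X card_mono[of ?C ?X] by simp
    moreover have disj: "S \<inter> ?C = {}"
    proof -
      have False if "x \<in> S" "x \<otimes> (x \<otimes> x) = \<one>" "x \<noteq> \<one>" for x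
      proof -
        have x: "x \<in> carrier G" using that sub by blast
        have "x [^] (4::nat) = \<one>" using pow_card_subgroup[OF S(1) that(1)] S(2) by simp
        then have "x \<otimes> (x \<otimes> (x \<otimes> x)) = \<one>" using x by (simp add: eval_nat_numeral m_assoc)
        then show False using that x by simp
      qed
      then show ?thesis by blast
    qed
    then have "card (S \<union> ?C) = 4 + card ?C"
      using S(2) finite_subset[OF sub] by (subst card_Un_disjoint) auto
    moreover have "card (S \<union> ?C) \<le> 12"
      using ord sub card_mono[of "carrier G" "S \<union> ?C"] by (auto simp: order_def)
    ultimately have "card (S \<union> ?C) = 12" by linarith
    then have all: "S \<union> ?C = carrier G"
      using ord sub by (intro card_subset_eq) (auto simp: order_def)
    have "x \<in> S \<longleftrightarrow> x = \<one> \<or> x \<otimes> (x \<otimes> x) \<noteq> \<one>" if "x \<in> carrier G" for x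
      using that all disj subgroup.one_closed[OF S(1)] by blast
    then show ?thesis using complement[of S] S by simp
  qed
qed

text \<open>By uniqueness every \<open>x\<close> centralizes or inverts \<open>z\<close>. As \<open>\<psi>\<close> inverts \<open>z\<close>, the element \<open>\<psi> x\<close> acts on \<open>z\<close> in
  the same way as \<open>x\<close>, so \<open>x \<otimes> inv (\<psi> x)\<close> centralizes \<open>z\<close>.\<close>

lemma unique_three_centralized:
  assumes z [simp]: "z \<in> carrier G" and zzz: "z \<otimes> (z \<otimes> z) = \<one>" and z1: "z \<noteq> \<one>"
    and uniq: "\<And>y. y \<in> carrier G \<Longrightarrow> y \<otimes> (y \<otimes> y) = \<one> \<Longrightarrow> y \<in> {\<one>, z, z \<otimes> z}"
    and \<psi>z: "\<psi> z = z \<otimes> z" and d: "d \<in> D"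
  shows "d \<otimes> z = z \<otimes> d"
proof -
  have dG [simp]: "d \<in> carrier G" by (rule displacements_closed[OF d])
  obtain x where x [simp]: "x \<in> carrier G" and dx: "d \<otimes> \<psi> x = x" using d by (rule displacement_witness)
  have z4: "z \<otimes> (z \<otimes> (z \<otimes> z)) = z" using zzz by simp
  have z4x: "z \<otimes> (z \<otimes> (z \<otimes> w)) = w" if "w \<in> carrier G" for w
  proof -
    have "z \<otimes> (z \<otimes> (z \<otimes> w)) = (z \<otimes> (z \<otimes> z)) \<otimes> w" using that by (simp add: m_assoc)
    then show ?thesis using zzz that by simp
  qed
  define y where "y = x \<otimes> z \<otimes> inv x"
  have y [simp]: "y \<in> carrier G" by (simp add: y_def)
  have yx: "x \<otimes> z = y \<otimes> x" by (simp add: y_def m_assoc)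
  have xx: "inv x \<otimes> (x \<otimes> w) = w" if "w \<in> carrier G" for w using that by (simp flip: m_assoc)
  have "y \<otimes> (y \<otimes> y) = x \<otimes> (z \<otimes> (z \<otimes> z)) \<otimes> inv x" by (simp add: y_def m_assoc xx)
  then have "y \<in> {\<one>, z, z \<otimes> z}" using uniq[OF y] zzz by simp
  moreover have "y \<noteq> \<one>" using yx z1 by auto
  ultimately consider "x \<otimes> z = z \<otimes> x" | "x \<otimes> z = z \<otimes> z \<otimes> x" using yx by auto
  then show ?thesis
  proof cases
    case 1
    have "\<psi> (x \<otimes> z) = \<psi> x \<otimes> (z \<otimes> z)" "\<psi> (z \<otimes> x) = z \<otimes> z \<otimes> \<psi> x" by (simp_all add: \<psi>z)
    then have a: "\<psi> x \<otimes> (z \<otimes> z) = z \<otimes> z \<otimes> \<psi> x" using 1 by metis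
    have "\<psi> x \<otimes> z = (\<psi> x \<otimes> (z \<otimes> z)) \<otimes> (z \<otimes> z)" by (simp add: m_assoc z4)
    also have "\<dots> = (z \<otimes> z \<otimes> \<psi> x) \<otimes> (z \<otimes> z)" by (simp only: a)
    also have "\<dots> = z \<otimes> z \<otimes> (\<psi> x \<otimes> (z \<otimes> z))" by (simp add: m_assoc)
    also have "\<dots> = z \<otimes> z \<otimes> (z \<otimes> z \<otimes> \<psi> x)" by (simp only: a)
    also have "\<dots> = z \<otimes> \<psi> x" by (simp add: m_assoc z4x)
    finally have b: "\<psi> x \<otimes> z = z \<otimes> \<psi> x" .
    have "(d \<otimes> z) \<otimes> \<psi> x = (d \<otimes> \<psi> x) \<otimes> z" using b by (simp add: m_assoc)
    also have "\<dots> = (z \<otimes> d) \<otimes> \<psi> x" using dx 1 by (simp add: m_assoc)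
    finally show ?thesis by simp
  next
    case 2
    have "\<psi> (x \<otimes> z) = \<psi> x \<otimes> (z \<otimes> z)" "\<psi> (z \<otimes> z \<otimes> x) = z \<otimes> \<psi> x"
      by (simp_all add: \<psi>z m_assoc z4x)
    then have a: "\<psi> x \<otimes> (z \<otimes> z) = z \<otimes> \<psi> x" using 2 by metis
    have "\<psi> x \<otimes> z = (\<psi> x \<otimes> (z \<otimes> z)) \<otimes> (z \<otimes> z)" by (simp add: m_assoc z4)
    also have "\<dots> = (z \<otimes> \<psi> x) \<otimes> (z \<otimes> z)" by (simp only: a)
    also have "\<dots> = z \<otimes> (\<psi> x \<otimes> (z \<otimes> z))" by (simp add: m_assoc)
    also have "\<dots> = z \<otimes> (z \<otimes> \<psi> x)" by (simp only: a)
    also have "\<dots> = z \<otimes> z \<otimes> \<psi> x" by (simp add: m_assoc)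
    finally have b: "\<psi> x \<otimes> z = z \<otimes> z \<otimes> \<psi> x" .
    have "(d \<otimes> (z \<otimes> z)) \<otimes> \<psi> x = (d \<otimes> \<psi> x) \<otimes> z" using b by (simp add: m_assoc)
    also have "\<dots> = (z \<otimes> z \<otimes> d) \<otimes> \<psi> x" using dx 2 by (simp add: m_assoc)
    finally have c: "d \<otimes> (z \<otimes> z) = z \<otimes> z \<otimes> d" by (subst (asm) right_cancel) simp_all
    have "d \<otimes> z = (d \<otimes> (z \<otimes> z)) \<otimes> (z \<otimes> z)" by (simp add: m_assoc z4)
    also have "\<dots> = (z \<otimes> z \<otimes> d) \<otimes> (z \<otimes> z)" by (simp only: c)
    also have "\<dots> = z \<otimes> z \<otimes> (d \<otimes> (z \<otimes> z))" by (simp add: m_assoc)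
    also have "\<dots> = z \<otimes> z \<otimes> (z \<otimes> z \<otimes> d)" by (simp only: c)
    also have "\<dots> = z \<otimes> d" by (simp add: m_assoc z4x)
    finally show ?thesis .
  qed
qed

text \<open>There are two fixed points, so \<open>\<psi>\<close> inverts \<open>z\<close> and \<open>D\<close> is the union of two cosets of the group
  generated by \<open>z\<close>. On the nontrivial coset \<open>\<psi>\<close> has a fixed point \<open>f\<close>, an involution that commutes
  with \<open>z\<close>; so \<open>z \<otimes> f\<close> generates \<open>D\<close>.\<close>

lemma six_displacements_unique_three:
  assumes ord: "order G = 12" and card_D: "card D = 6"
    and z [simp]: "z \<in> carrier G" and z1: "z \<noteq> \<one>" and zzz: "z \<otimes> (z \<otimes> z) = \<one>"
    and uniq: "\<And>y. y \<in> carrier G \<Longrightarrow> y \<otimes> (y \<otimes> y) = \<one> \<Longrightarrow> y \<in> {\<one>, z, z \<otimes> z}"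
  shows "realizes (cyclic_model 6 5 {..<6}) G \<psi>"
proof -
  have F: "card fixed = 2" using card_displacements ord card_D by simp
  have F_sq: "x \<otimes> x = \<one>" if "x \<in> fixed" for x
    using pow_card_subgroup[OF fixed_subgroup that] F fixed_closed[OF that] by (simp add: numeral_2_eq_2)
  have z4: "z \<otimes> (z \<otimes> (z \<otimes> z)) = z" using zzz by simp
  have z4x: "z \<otimes> (z \<otimes> (z \<otimes> w)) = w" if "w \<in> carrier G" for w
  proof -
    have "z \<otimes> (z \<otimes> (z \<otimes> w)) = (z \<otimes> (z \<otimes> z)) \<otimes> w" using that by (simp add: m_assoc)
    then show ?thesis using zzz that by simp
  qed
  have zz1: "z \<otimes> z \<noteq> \<one>" using zzz z1 by auto
  have "\<psi> z \<in> {\<one>, z, z \<otimes> z}" using uniq[of "\<psi> z"] aut_mult[OF z] zzz by (metis aut_closed aut_mult aut_one m_closed z)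
  moreover have "\<psi> z \<noteq> \<one>" using z1 by simp
  moreover have "\<psi> z \<noteq> z" using F_sq[OF fixedI[OF z]] zz1 by auto
  ultimately have \<psi>z: "\<psi> z = z \<otimes> z" by simp
  have \<psi>zz: "\<psi> (z \<otimes> z) = z" by (simp add: \<psi>z m_assoc z4)
  have comm: "d \<otimes> z = z \<otimes> d" if "d \<in> D" for d
    by (rule unique_three_centralized[OF z zzz z1 uniq \<psi>z that])
  have zD: "z \<in> D"
    unfolding displacements_def using \<psi>zz by (auto intro!: bexI[of _ "z \<otimes> z"])
  have shift: "z \<otimes> d \<in> D" if d: "d \<in> D" for d
  proof -
    have dG: "d \<in> carrier G" by (rule displacements_closed[OF d])
    obtain e where e: "e \<in> D" "z \<otimes> z \<otimes> d = e \<otimes> \<psi> (z \<otimes> z)" using twisted_exchange[OF _ d, of "z \<otimes> z"] by auto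
    have "(z \<otimes> d) \<otimes> z = e \<otimes> z" using e dG comm[OF d] \<psi>zz by (simp add: m_assoc)
    then have "z \<otimes> d = e" using dG displacements_closed[OF e(1)] by simp
    then show ?thesis using e by simp
  qed
  have "\<not> D \<subseteq> {\<one>, z, z \<otimes> z}"
  proof
    assume "D \<subseteq> {\<one>, z, z \<otimes> z}"
    then have "card D \<le> card {\<one>, z, z \<otimes> z}" by (intro card_mono) simp_all
    also have "\<dots> \<le> 3" using card_length[of "[\<one>, z, z \<otimes> z]"] by simp
    finally show False using card_D by simp
  qed
  then obtain d where d: "d \<in> D" "d \<notin> {\<one>, z, z \<otimes> z}" by blast
  have dG [simp]: "d \<in> carrier G" by (rule displacements_closed[OF d(1)])
  have coset: "D = {\<one>, z, z \<otimes> z, e, z \<otimes> e, z \<otimes> (z \<otimes> e)}" if e: "e \<in> D" "e \<notin> {\<one>, z, z \<otimes> z}" for e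
  proof -
    have eG [simp]: "e \<in> carrier G" by (rule displacements_closed[OF e(1)])
    have ne: "z \<otimes> e \<notin> {\<one>, z, z \<otimes> z}" "z \<otimes> (z \<otimes> e) \<notin> {\<one>, z, z \<otimes> z}"
    proof -
      show "z \<otimes> e \<notin> {\<one>, z, z \<otimes> z}"
      proof
        assume "z \<otimes> e \<in> {\<one>, z, z \<otimes> z}"
        then have "z \<otimes> (z \<otimes> (z \<otimes> e)) \<in> {z \<otimes> z, \<one>, z}" using zzz z4 by auto
        then show False using e(2) z4x[OF eG] by auto
      qed
      show "z \<otimes> (z \<otimes> e) \<notin> {\<one>, z, z \<otimes> z}"
      proof
        assume "z \<otimes> (z \<otimes> e) \<in> {\<one>, z, z \<otimes> z}"
        then have "z \<otimes> (z \<otimes> (z \<otimes> e)) \<in> {z, z \<otimes> z, \<one>}" using zzz by auto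
        then show False using e(2) z4x[OF eG] by auto
      qed
    qed
    have ne': "z \<otimes> e \<noteq> e" "z \<otimes> (z \<otimes> e) \<noteq> e" "z \<otimes> (z \<otimes> e) \<noteq> z \<otimes> e" "z \<otimes> z \<noteq> z"
      using z1 zz1 by (simp_all flip: m_assoc)
    have "card {\<one>, z, z \<otimes> z, e, z \<otimes> e, z \<otimes> (z \<otimes> e)} = 6"
      using ne ne' ne'[THEN not_sym] e(2) z1 zz1 z1[THEN not_sym] zz1[THEN not_sym] by auto
    moreover have "{\<one>, z, z \<otimes> z, e, z \<otimes> e, z \<otimes> (z \<otimes> e)} \<subseteq> D"
      using shift zD e(1) by simp
    ultimately show ?thesis using card_D by (intro card_subset_eq[symmetric]) simp_all
  qed
  have "\<psi> d \<in> D" using d by simp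
  moreover have "\<psi> d \<notin> {\<one>, z, z \<otimes> z}"
    using d(2) aut_eq_iff[OF dG z] aut_eq_iff[of d "z \<otimes> z"] aut_eq_one_iff[OF dG] unfolding \<psi>z \<psi>zz by auto
  ultimately have "\<psi> d = d \<or> \<psi> d = z \<otimes> d \<or> \<psi> d = z \<otimes> (z \<otimes> d)" using coset[OF d] by blast
  then have "\<exists>f\<in>{d, z \<otimes> d, z \<otimes> (z \<otimes> d)}. \<psi> f = f"
    by (elim disjE) (simp_all add: \<psi>z m_assoc z4x)
  then obtain f where f: "f \<in> {d, z \<otimes> d, z \<otimes> (z \<otimes> d)}" "\<psi> f = f" by blast
  have fD: "f \<in> D" using f(1) d(1) shift by auto
  then have fG [simp]: "f \<in> carrier G" by (rule displacements_closed)
  have f_notin: "f \<notin> {\<one>, z, z \<otimes> z}"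
  proof
    assume "f \<in> {\<one>, z, z \<otimes> z}"
    then have "{f, z \<otimes> f, z \<otimes> (z \<otimes> f)} \<subseteq> {\<one>, z, z \<otimes> z}" using zzz by auto
    moreover have "d \<in> {f, z \<otimes> f, z \<otimes> (z \<otimes> f)}" using f(1) z4x by auto
    ultimately show False using d(2) by blast
  qed
  note D_eq = coset[OF fD f_notin]
  have ff: "f \<otimes> f = \<one>" by (rule F_sq[OF fixedI[OF fG f(2)]])
  have ffx: "f \<otimes> (f \<otimes> w) = w" if "w \<in> carrier G" for w using that ff by (simp flip: m_assoc)
  have fz: "f \<otimes> z = z \<otimes> f" by (rule comm[OF fD])
  have fzx: "f \<otimes> (z \<otimes> w) = z \<otimes> (f \<otimes> w)" if "w \<in> carrier G" for w using left_swap[OF fz] that by simp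
  define u where "u = z \<otimes> f"
  have u [simp]: "u \<in> carrier G" by (simp add: u_def)
  have pows: "u [^] (2::nat) = z \<otimes> z" "u [^] (3::nat) = f" "u [^] (4::nat) = z"
      "u [^] (5::nat) = z \<otimes> (z \<otimes> f)" "u [^] (6::nat) = \<one>"
    by (simp_all add: u_def eval_nat_numeral m_assoc fz fzx ff ffx z4x zzz)
  show ?thesis
  proof (rule realizes_cyclic_model[where u = u])
    have six: "{..<6::nat} = {0, 1, 2, 3, 4, 5}" by auto
    show "(\<lambda>i. u [^] i) ` {..<6::nat} = D" unfolding six D_eq using pows by (auto simp: u_def)
    show "u [^] i \<noteq> \<one>" if "0 < i" "i < 6" for i :: nat
    proof -
      have "i \<in> {1, 2, 3, 4, 5}" using that by auto
      moreover have "u \<noteq> \<one>" using pows(1) zz1 by auto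
      moreover have "z \<otimes> (z \<otimes> f) \<noteq> \<one>"
      proof
        assume "z \<otimes> (z \<otimes> f) = \<one>"
        then have "z \<otimes> (z \<otimes> (z \<otimes> f)) = z" by simp
        then show False using z4x f_notin by simp
      qed
      ultimately show ?thesis using pows z1 zz1 f_notin by auto
    qed
    show "\<psi> u = u [^] (5::nat)" using pows f(2) by (simp add: u_def \<psi>z m_assoc)
  qed (use pows in simp_all)
qed

text \<open>Since \<open>D\<close> is everything, \<open>z\<close> is central, and the group is the product of a Sylow 2-subgroup \<open>S\<close> and
  the group generated by \<open>z\<close>. As the set of solutions of \<open>x [^] 4 = \<one>\<close>, \<open>S\<close> is invariant; having no
  fixed points, \<open>\<psi>\<close> permutes its three nontrivial elements cyclically, so they are involutions.\<close>

lemma twelve_displacements_unique_three: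
  assumes ord: "order G = 12" and card_D: "card D = 12"
    and z [simp]: "z \<in> carrier G" and z1: "z \<noteq> \<one>" and zzz: "z \<otimes> (z \<otimes> z) = \<one>"
    and uniq: "\<And>y. y \<in> carrier G \<Longrightarrow> y \<otimes> (y \<otimes> y) = \<one> \<Longrightarrow> y \<in> {\<one>, z, z \<otimes> z}"
  shows "realizes (abelian_model 2 2 3 (0,1,0) (1,1,0) (0,0,2) ({..<2} \<times> {..<2} \<times> {..<3})) G \<psi>"
proof -
  have card_eq: "card D = order G" using ord card_D by simp
  have D: "D = carrier G" by (rule full_displacements(1)[OF card_eq])
  have fpf: "x = \<one>" if "x \<in> carrier G" "\<psi> x = x" for x by (rule full_displacements(2)[OF card_eq that])
  have "\<psi> z \<otimes> (\<psi> z \<otimes> \<psi> z) = \<psi> (z \<otimes> (z \<otimes> z))" by simp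
  then have "\<psi> z \<in> {\<one>, z, z \<otimes> z}" using uniq[of "\<psi> z"] zzz by simp
  then have \<psi>z: "\<psi> z = z \<otimes> z" using z1 fpf[OF z] by auto
  have central: "x \<otimes> z = z \<otimes> x" if "x \<in> carrier G" for x
    by (rule unique_three_centralized[OF z zzz z1 uniq \<psi>z]) (use that D in simp_all)
  have z3: "z [^] (3::nat) = \<one>" using zzz by (simp add: numeral_3_eq_3 m_assoc)
  obtain S where S: "subgroup S G" "card S = 2 ^ 2"
    using sylow_thm[of 2 G 2 3] is_group ord by auto
  have sub: "x \<in> carrier G" if "x \<in> S" for x using subgroup.mem_carrier[OF S(1) that] .
  have S4: "x [^] (4::nat) = \<one>" if "x \<in> S" for x
    using pow_card_subgroup[OF S(1) that] S(2) by simp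
  have pow4: "(z [^] i \<otimes> s) [^] (4::nat) = z [^] i" if s: "s \<in> S" for i :: nat and s
  proof -
    have "(z [^] i \<otimes> s) [^] (4::nat) = (z [^] i) [^] (4::nat) \<otimes> s [^] (4::nat)"
      using sub[OF s] commute_pows[OF z sub[OF s] central[OF sub[OF s], symmetric], of i 1]
      by (intro pow_mult_distrib) simp_all
    also have "\<dots> = (z [^] (3::nat)) [^] i \<otimes> z [^] i"
      using S4[OF s] by (simp add: nat_pow_pow nat_pow_mult mult.commute)
    finally show ?thesis using z3 by simp
  qed
  have zk: "z [^] i \<noteq> \<one>" if "0 < i" "i < 3" for i :: nat
  proof -
    have "i = 1 \<or> i = 2" using that by auto
    then show ?thesis using z1 zzz by (auto simp: numeral_2_eq_2)
  qed
  have zinj: "i = j" if "i < 3" "j < 3" "z [^] i = z [^] j" for i j :: nat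
  proof -
    have "{i, j} \<subseteq> {0, 1, 2}" using that by auto
    moreover have "z \<otimes> z \<noteq> z" "z \<otimes> z \<noteq> \<one>" using z1 zk[of 2] by (simp_all add: numeral_2_eq_2)
    ultimately show ?thesis using that(3) z1 by (auto simp: numeral_2_eq_2 eq_commute[of _ z] eq_commute[of \<one>])
  qed
  have "inj_on (\<lambda>(i, s). z [^] i \<otimes> s) ({..<3::nat} \<times> S)"
  proof (rule inj_onI, clarify)
    fix i j :: nat and s t
    assume *: "i < 3" "j < 3" "s \<in> S" "t \<in> S" "z [^] i \<otimes> s = z [^] j \<otimes> t"
    then have "z [^] i = z [^] j" using pow4[of s i] pow4[of t j] by simp
    then show "i = j \<and> s = t" using * zinj[of i j] sub by simp
  qed
  then have "card ((\<lambda>(i, s). z [^] i \<otimes> s) ` ({..<3::nat} \<times> S)) = 12"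
    using S(2) by (simp add: card_image card_cartesian_product)
  then have all: "(\<lambda>(i, s). z [^] i \<otimes> s) ` ({..<3::nat} \<times> S) = carrier G"
    using ord sub by (intro card_subset_eq) (auto simp: order_def)
  have S_iff: "x \<in> S \<longleftrightarrow> x [^] (4::nat) = \<one>" if x: "x \<in> carrier G" for x
  proof
    assume x4: "x [^] (4::nat) = \<one>"
    obtain i :: nat and s where xs: "i < 3" "s \<in> S" "x = z [^] i \<otimes> s"
      using x unfolding all[symmetric] by auto
    then have "z [^] i = \<one>" using pow4[of s i] x4 by simp
    then show "x \<in> S" using xs sub by simp
  qed (rule S4)
  have S_aut: "\<psi> x \<in> S" if "x \<in> S" for x
    using that S_iff[OF sub[OF that]] S_iff[of "\<psi> x"] sub[OF that] by (simp flip: aut_pow)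
  have "S \<noteq> {\<one>}" using S(2) by auto
  then obtain a where a: "a \<in> S" "a \<noteq> \<one>" using subgroup.one_closed[OF S(1)] by blast
  define b c where "b = \<psi> a" and "c = \<psi> b"
  have abc: "a \<in> S" "b \<in> S" "c \<in> S" using a S_aut by (simp_all add: b_def c_def)
  note G [simp] = abc[THEN sub]
  have ne: "a \<noteq> \<one>" "b \<noteq> \<one>" "c \<noteq> \<one>" using a by (simp_all add: b_def c_def)
  have ab: "a \<noteq> b" "b \<noteq> c" using fpf[OF G(1)] fpf[OF G(2)] ne by (auto simp: b_def c_def)
  have finS: "finite S" using S(2) by (metis card.infinite power_not_zero zero_neq_numeral)
  have ac: "a \<noteq> c"
  proof
    assume ac: "a = c"
    have "card (S - {\<one>, a, b}) = 1"
      using S(2) subgroup.one_closed[OF S(1)] abc ne ab finS by (subst card_Diff_subset) auto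
    then obtain d where d: "S - {\<one>, a, b} = {d}" by (rule card_1_singletonE)
    then have dS: "d \<in> S" "d \<notin> {\<one>, a, b}" by blast+
    have "\<psi> d \<noteq> \<psi> a" "\<psi> d \<noteq> \<psi> b" "\<psi> d \<noteq> \<one>" using dS sub[OF dS(1)] by simp_all
    moreover have "\<psi> a = b" "\<psi> b = a" using ac by (simp_all add: b_def c_def)
    ultimately have "\<psi> d \<notin> {\<one>, a, b}" by simp
    then have "\<psi> d = d" using d S_aut[OF dS(1)] by blast
    then show False using fpf[OF sub[OF dS(1)]] dS by simp
  qed
  have S_eq: "S = {\<one>, a, b, c}"
  proof (rule card_subset_eq[symmetric])
    show "{\<one>, a, b, c} \<subseteq> S" using abc subgroup.one_closed[OF S(1)] by simp
    show "card {\<one>, a, b, c} = card S" using ne ne[THEN not_sym] ab ac S(2) by simp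
  qed (rule finS)
  have "\<psi> c \<in> S" using S_aut abc by simp
  moreover have "\<psi> c \<notin> {\<one>, b, c}"
    using ne ac fpf[OF G(3)] aut_eq_iff[OF G(3) G(1)] by (auto simp: b_def simp del: aut_eq_iff)
  ultimately have \<psi>: "\<psi> a = b" "\<psi> b = c" "\<psi> c = a" by (auto simp: S_eq b_def c_def)
  have S_mult: "x \<otimes> y \<in> S" if "x \<in> S" "y \<in> S" for x y using subgroup.m_closed[OF S(1) that] .
  have a4: "(a \<otimes> a) \<otimes> (a \<otimes> a) = \<one>" using S4[OF a(1)] by (simp add: eval_nat_numeral m_assoc)
  have sq: "\<psi> (a \<otimes> a) = b \<otimes> b" "\<psi> (b \<otimes> b) = c \<otimes> c" "\<psi> (c \<otimes> c) = a \<otimes> a" using \<psi> by simp_all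
  have "a \<otimes> a \<noteq> b"
  proof
    assume "a \<otimes> a = b"
    then have "b \<otimes> b = c" using sq \<psi> by simp
    then show False using a4 \<open>a \<otimes> a = b\<close> ne by simp
  qed
  moreover have "a \<otimes> a \<noteq> c"
  proof
    assume "a \<otimes> a = c"
    then have "b \<otimes> b = a" using sq \<psi> by simp
    then have "c \<otimes> c = b" using sq \<psi> by simp
    then show False using a4 \<open>a \<otimes> a = c\<close> ne by simp
  qed
  moreover have "a \<otimes> a \<noteq> a" using ne by simp
  ultimately have aa: "a \<otimes> a = \<one>" using S_mult[OF a(1) a(1)] by (simp add: S_eq)
  then have bb: "b \<otimes> b = \<one>" using sq by simp
  have "a \<otimes> b \<noteq> a \<otimes> a" "b \<otimes> a \<noteq> a \<otimes> a" using ab(1) by simp_all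
  then have "a \<otimes> b \<noteq> \<one>" "b \<otimes> a \<noteq> \<one>" unfolding aa .
  moreover have "a \<otimes> b \<noteq> a" "a \<otimes> b \<noteq> b" "b \<otimes> a \<noteq> a" "b \<otimes> a \<noteq> b" using ne by simp_all
  ultimately have ab_c: "a \<otimes> b = c" and ba_c: "b \<otimes> a = c"
    using S_mult[OF abc(1,2)] S_mult[OF abc(2,1)] by (simp_all add: S_eq)
  have period: "a [^] (2::nat) = \<one>" "b [^] (2::nat) = \<one>" using aa bb by (simp_all add: numeral_2_eq_2)
  have comm: "a \<otimes> b = b \<otimes> a" using ab_c ba_c by simp
  have indep: "i = 0 \<and> j = 0 \<and> k = 0"
    if "i < 2" "j < 2" "k < 3" "a [^] i \<otimes> b [^] j \<otimes> z [^] k = \<one>" for i j k :: nat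
  proof -
    have "i = 0 \<or> i = 1" "j = 0 \<or> j = 1" using that by auto
    then have s: "a [^] i \<otimes> b [^] j \<in> S" using abc ab_c subgroup.one_closed[OF S(1)] by auto
    have "z [^] k \<otimes> (a [^] i \<otimes> b [^] j) = \<one>"
      using that(4) commute_pows[OF z sub[OF s] central[OF sub[OF s], symmetric], of k 1] by simp
    then have "z [^] k = \<one>" using pow4[OF s, of k] by simp
    then have "k = 0" using zk[of k] that(3) by auto
    moreover have "i = 0 \<and> j = 0"
      using \<open>i = 0 \<or> i = 1\<close> \<open>j = 0 \<or> j = 1\<close> \<open>k = 0\<close> that(4) ne ab_c by auto
    ultimately show ?thesis by simp
  qed
  have E: "monomial a b z ` ({..<2} \<times> {..<2} \<times> {..<3}) = D"
    unfolding D
    by (rule monomial_onto[OF G(1,2) z comm central[OF G(1)] central[OF G(2)] period z3 _ _ _ indep])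
      (simp_all add: ord)
  show ?thesis
    by (rule realizes_abelian_model[OF G(1,2) z comm central[OF G(1)] central[OF G(2)] period z3 _ _ _ indep _ _ _ E])
      (use \<psi> \<psi>z ab_c in \<open>simp_all add: monomial_def numeral_2_eq_2\<close>)
qed

text \<open>The relations rewrite every product to the normal form \<open>f\<^sup>i \<otimes> t\<^sup>j \<otimes> z\<^sup>k\<close>; comparing orders, this
  identifies the whole group with the alternating group.\<close>

lemma realizes_alternating_model:
  assumes ord: "order G = 12" and e: "e < 2"
    and G [simp]: "f \<in> carrier G" "t \<in> carrier G" "z \<in> carrier G"
    and rel: "f \<otimes> f = \<one>" "t \<otimes> t = \<one>" "t \<otimes> f = f \<otimes> t" "z \<otimes> (z \<otimes> z) = \<one>"
      "z \<otimes> f = t \<otimes> z" "z \<otimes> t = f \<otimes> (t \<otimes> z)"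
    and ne: "f \<noteq> \<one>" "t \<noteq> \<one>" "f \<otimes> t \<noteq> \<one>" "z \<notin> {\<one>, f, t, f \<otimes> t}"
    and \<psi>: "\<psi> f = f" "\<psi> t = f \<otimes> t" "\<psi> z = f [^] e \<otimes> (z \<otimes> z)"
  shows "realizes (alternating_model e) G \<psi>"
proof -
  note swaps = rel left_swap[OF rel(3)] left_swap[OF rel(5)]
  have absorb: "f \<otimes> (f \<otimes> x) = x" "t \<otimes> (t \<otimes> x) = x" "z \<otimes> (z \<otimes> (z \<otimes> x)) = x"
    "z \<otimes> (t \<otimes> x) = f \<otimes> (t \<otimes> (z \<otimes> x))" if "x \<in> carrier G" for x
  proof -
    show "f \<otimes> (f \<otimes> x) = x" "t \<otimes> (t \<otimes> x) = x" using that rel by (simp_all flip: m_assoc)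
    have "z \<otimes> (z \<otimes> (z \<otimes> x)) = (z \<otimes> (z \<otimes> z)) \<otimes> x" using that by (simp add: m_assoc)
    then show "z \<otimes> (z \<otimes> (z \<otimes> x)) = x" using that rel by simp
    have "z \<otimes> (t \<otimes> x) = (z \<otimes> t) \<otimes> x" using that by (simp add: m_assoc)
    then show "z \<otimes> (t \<otimes> x) = f \<otimes> (t \<otimes> (z \<otimes> x))" using that rel by (simp add: m_assoc)
  qed
  have pow2: "x [^] (2::nat) = x \<otimes> x" if "x \<in> carrier G" for x
    using that by (simp add: numeral_2_eq_2)
  define h where "h = monomial f t z"
  have two: "i = 0 \<or> i = 1" if "i < 2" for i :: nat using that by auto
  have three: "i = 0 \<or> i = 1 \<or> i = 2" if "i < 3" for i :: nat using that by auto
  have hom: "h \<in> hom alternating G"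
  proof (rule homI)
    show "h x \<in> carrier G" for x by (simp add: h_def monomial_def split: prod.split)
    fix x y assume "x \<in> carrier alternating" "y \<in> carrier alternating"
    then obtain i j k i' j' k' where x: "x = (i, j, k)" "i < 2" "j < 2" "k < 3"
      and y: "y = (i', j', k')" "i' < 2" "j' < 2" "k' < 3"
      by (auto simp: alternating_def)
    show "h (x \<otimes>\<^bsub>alternating\<^esub> y) = h x \<otimes> h y"
      using two[OF x(2)] two[OF x(3)] three[OF x(4)] two[OF y(2)] two[OF y(3)] three[OF y(4)]
      unfolding x(1) y(1)
      by (elim disjE) (simp_all add: h_def monomial_def alternating_def pow2 swaps absorb m_assoc)
  qed
  interpret h: group_hom alternating G h
    using hom group_alternating by (simp add: group_hom_def group_hom_axioms_def is_group)
  have z_ne: "s \<otimes> z \<noteq> \<one> \<and> s \<otimes> (z \<otimes> z) \<noteq> \<one>" if s: "s \<in> {\<one>, f, t, f \<otimes> t}" for s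
  proof -
    have sG: "s \<in> carrier G" and ss: "s \<otimes> s = \<one>" using s rel by (auto simp: m_assoc absorb swaps)
    have ssx: "s \<otimes> (s \<otimes> x) = x" if "x \<in> carrier G" for x using that ss sG by (simp flip: m_assoc)
    have "s \<otimes> z \<noteq> \<one>"
    proof
      assume "s \<otimes> z = \<one>"
      then have "s \<otimes> (s \<otimes> z) = s" using sG by simp
      then show False using ssx s ne by auto
    qed
    moreover have "s \<otimes> (z \<otimes> z) \<noteq> \<one>"
    proof
      assume "s \<otimes> (z \<otimes> z) = \<one>"
      then have "s \<otimes> (s \<otimes> (z \<otimes> z)) = s" using sG by simp
      then have zz: "z \<otimes> z = s" using ssx by simp
      have "z = z \<otimes> (z \<otimes> (z \<otimes> z))" using rel(4) by simp
      also have "\<dots> = (z \<otimes> z) \<otimes> (z \<otimes> z)" by (simp add: m_assoc)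
      also have "\<dots> = \<one>" using zz ss by simp
      finally show False using ne(4) by simp
    qed
    ultimately show ?thesis ..
  qed
  have "x = \<one>\<^bsub>alternating\<^esub>" if x_in: "x \<in> carrier alternating" and hx: "h x = \<one>" for x
  proof -
    obtain i j k where x: "x = (i, j, k)" "i < 2" "j < 2" "k < 3"
      using x_in by (auto simp: alternating_def)
    show ?thesis
      using two[OF x(2)] two[OF x(3)] three[OF x(4)] hx ne z_ne[of \<one>] z_ne[of f] z_ne[of t] z_ne[of "f \<otimes> t"]
      unfolding x(1)
      by (elim disjE) (simp_all add: h_def monomial_def alternating_def pow2 m_assoc)
  qed
  then have "kernel alternating G h = {\<one>\<^bsub>alternating\<^esub>}" by (auto simp: kernel_def)
  then have inj: "inj_on h (carrier alternating)" by (simp add: h.inj_iff_trivial_ker)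
  have eqv: "h (alternating_aut e x) = \<psi> (h x)" if x_in: "x \<in> carrier alternating" for x
  proof -
    obtain i j k where x: "x = (i, j, k)" "i < 2" "j < 2" "k < 3"
      using x_in by (auto simp: alternating_def)
    show ?thesis
      using two[OF x(2)] two[OF x(3)] three[OF x(4)] two[OF e] unfolding x(1)
      by (elim disjE)
        (simp_all add: h_def monomial_def alternating_aut_def pow2 \<psi> swaps absorb m_assoc)
  qed
  have onto: "h ` carrier alternating = carrier G"
  proof (rule card_subset_eq)
    show "card (h ` carrier alternating) = card (carrier G)"
      using card_image[OF inj] ord by (simp add: alternating_def order_def card_cartesian_product)
  qed (use h.hom_closed in auto)
  have aut_in: "alternating_aut e x \<in> carrier alternating" if "x \<in> carrier alternating" for x
    using that e by (auto simp: alternating_def alternating_aut_def)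
  have "h ` displacements alternating (alternating_aut e) = D"
  proof
    show "h ` displacements alternating (alternating_aut e) \<subseteq> D"
    proof clarify
      fix d assume "d \<in> displacements alternating (alternating_aut e)"
      then obtain x where x: "d \<in> carrier alternating" "x \<in> carrier alternating"
        "d \<otimes>\<^bsub>alternating\<^esub> alternating_aut e x = x" unfolding displacements_def by blast
      then have "h d \<otimes> \<psi> (h x) = h x" using h.hom_mult[OF x(1) aut_in[OF x(2)]] eqv[OF x(2)] by simp
      then show "h d \<in> D" unfolding displacements_def using h.hom_closed x by blast
    qed
    show "D \<subseteq> h ` displacements alternating (alternating_aut e)"
    proof
      fix y assume y: "y \<in> D"
      then obtain w where w: "w \<in> carrier G" "y \<otimes> \<psi> w = w" by (rule displacement_witness)
      obtain d where d: "d \<in> carrier alternating" "y = h d" using displacements_closed[OF y] onto by blast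
      obtain x where x: "x \<in> carrier alternating" "w = h x" using w(1) onto by blast
      have "h (d \<otimes>\<^bsub>alternating\<^esub> alternating_aut e x) = h x"
        using w(2) h.hom_mult[OF d(1) aut_in[OF x(1)]] eqv[OF x(1)] d x by simp
      then have "d \<otimes>\<^bsub>alternating\<^esub> alternating_aut e x = x"
        using inj_onD[OF inj] d x aut_in h.m_closed by blast
      then show "y \<in> h ` displacements alternating (alternating_aut e)"
        unfolding displacements_def using d x by blast
    qed
  qed
  then show ?thesis using hom inj eqv unfolding realizes_def alternating_model_def prod.case by blast
qed

end

text \<open>The group is the alternating group of degree four: outside the four-group \<open>S\<close> all elements have
  order three.\<close>

locale kleinian_twelve = group_aut +
  fixes S
  assumes order_twelve: "order G = 12" and S: "subgroup S G" "card S = 4"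
    and S_iff: "x \<in> carrier G \<Longrightarrow> x \<in> S \<longleftrightarrow> x = \<one> \<or> x \<otimes> (x \<otimes> x) \<noteq> \<one>"
begin

lemma S_closed: "x \<in> S \<Longrightarrow> x \<in> carrier G"
  by (rule subgroup.mem_carrier[OF S(1)])

lemma S_mult: "x \<in> S \<Longrightarrow> y \<in> S \<Longrightarrow> x \<otimes> y \<in> S"
  by (rule subgroup.m_closed[OF S(1)])

lemma S_inv: "x \<in> S \<Longrightarrow> inv x \<in> S"
  by (rule subgroup.m_inv_closed[OF S(1)])

lemma S_one: "\<one> \<in> S"
  by (rule subgroup.one_closed[OF S(1)])

lemma finite_S: "finite S"
  by (rule finite_subset[OF subgroup.subset[OF S(1)] finite_carrier])

lemma cube_outside: "x \<in> carrier G \<Longrightarrow> x \<notin> S \<Longrightarrow> x \<otimes> (x \<otimes> x) = \<one>"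
  using S_iff by blast

lemma S_invariant:
  assumes "group_aut G \<phi>" and x: "x \<in> carrier G"
  shows "\<phi> x \<in> S \<longleftrightarrow> x \<in> S"
proof -
  interpret \<phi>: group_aut G \<phi> by fact
  have "\<phi> x \<otimes> (\<phi> x \<otimes> \<phi> x) = \<phi> (x \<otimes> (x \<otimes> x))" using x by simp
  then have "\<phi> x \<otimes> (\<phi> x \<otimes> \<phi> x) = \<one> \<longleftrightarrow> x \<otimes> (x \<otimes> x) = \<one>"
    using x by (metis \<phi>.aut_eq_one_iff m_closed)
  moreover have "\<phi> x = \<one> \<longleftrightarrow> x = \<one>" using x by simp
  ultimately show ?thesis using S_iff[OF x] S_iff[OF \<phi>.aut_closed[OF x]] by simp
qed

lemma aut_S: "x \<in> S \<Longrightarrow> \<psi> x \<in> S"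
  using S_invariant[OF group_aut_axioms] S_closed by blast

lemma conj_S: "x \<in> carrier G \<Longrightarrow> s \<in> S \<Longrightarrow> x \<otimes> s \<otimes> inv x \<in> S"
  using S_invariant[OF inner_group_aut[OF finite_carrier]] S_closed by blast

lemma S_pow4: "s \<in> S \<Longrightarrow> (s \<otimes> s) \<otimes> (s \<otimes> s) = \<one>"
  using pow_card_subgroup[OF S(1)] S S_closed[of s] by (force simp: eval_nat_numeral m_assoc)

text \<open>Otherwise \<open>x \<otimes> a\<close> is outside \<open>S\<close> as well, so the cubes of \<open>x\<close> and of \<open>x \<otimes> a\<close> are \<open>\<one>\<close>; hence so is that of
  \<open>a\<close>, whose order divides four.\<close>

lemma commute_with_S:
  assumes x: "x \<in> carrier G" and a: "a \<in> S" "a \<noteq> \<one>" and comm: "x \<otimes> a = a \<otimes> x"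
  shows "x \<in> S"
proof (rule ccontr)
  assume x_out: "x \<notin> S"
  have aG: "a \<in> carrier G" by (rule S_closed[OF a(1)])
  have "x \<otimes> a \<notin> S"
  proof
    assume "x \<otimes> a \<in> S"
    then have "(x \<otimes> a) \<otimes> inv a \<in> S" using S_mult S_inv[OF a(1)] by blast
    then show False using x_out x aG by (simp add: m_assoc)
  qed
  then have "(x \<otimes> a) \<otimes> ((x \<otimes> a) \<otimes> (x \<otimes> a)) = \<one>" using cube_outside x aG by simp
  moreover have "(x \<otimes> a) \<otimes> ((x \<otimes> a) \<otimes> (x \<otimes> a)) = (x \<otimes> (x \<otimes> x)) \<otimes> (a \<otimes> (a \<otimes> a))"
    using x aG left_swap[OF comm[symmetric]] by (simp add: m_assoc comm[symmetric])
  ultimately have "a \<otimes> (a \<otimes> a) = \<one>" using cube_outside[OF x x_out] aG by simp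
  moreover have "(a \<otimes> a) \<otimes> (a \<otimes> a) = a \<otimes> (a \<otimes> (a \<otimes> a))" using aG by (simp add: m_assoc)
  ultimately show False using S_pow4[OF a(1)] a(2) aG by simp
qed

text \<open>Conjugation by \<open>x\<close> has order three and, by \<open>commute_with_S\<close>, no nontrivial fixed points in \<open>S\<close>. So it
  permutes the three nontrivial elements of \<open>S\<close> cyclically.\<close>

lemma S_structure:
  assumes x: "x \<in> carrier G" "x \<notin> S" and f: "f \<in> S" "f \<noteq> \<one>"
  defines "t \<equiv> x \<otimes> f \<otimes> inv x"
  shows "S = {\<one>, f, t, f \<otimes> t}" "distinct [\<one>, f, t, f \<otimes> t]" "f \<otimes> f = \<one>" "t \<otimes> t = \<one>"
    "t \<otimes> f = f \<otimes> t" "x \<otimes> f = t \<otimes> x" "x \<otimes> t = f \<otimes> (t \<otimes> x)" "x \<otimes> (f \<otimes> t) = f \<otimes> x" "t \<in> S"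
proof -
  define \<iota> where "\<iota> y = x \<otimes> y \<otimes> inv x" for y
  have "group_aut G \<iota>" unfolding \<iota>_def by (rule inner_group_aut[OF finite_carrier x(1)])
  then interpret \<iota>: group_aut G \<iota> .
  have \<iota>S: "\<iota> y \<in> S" if "y \<in> S" for y using conj_S[OF x(1) that] by (simp add: \<iota>_def)
  have \<iota>_swap: "x \<otimes> y = \<iota> y \<otimes> x" if "y \<in> carrier G" for y using that x by (simp add: \<iota>_def m_assoc)
  have \<iota>_ne: "\<iota> y \<noteq> y" if "y \<in> S" "y \<noteq> \<one>" for y
  proof
    assume "\<iota> y = y"
    then have "x \<otimes> y = y \<otimes> x" using \<iota>_swap[OF S_closed[OF that(1)]] by simp
    then show False using commute_with_S[OF x(1) that] x(2) by simp
  qed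
  have \<iota>3: "\<iota> (\<iota> (\<iota> y)) = y" if "y \<in> carrier G" for y
  proof -
    have "\<iota> (\<iota> (\<iota> y)) = (x \<otimes> (x \<otimes> x)) \<otimes> y \<otimes> inv (x \<otimes> (x \<otimes> x))"
      using that x by (simp add: \<iota>_def m_assoc inv_mult_group)
    then show ?thesis using cube_outside[OF x] that by simp
  qed
  have t: "t = \<iota> f" by (simp add: t_def \<iota>_def)
  define t' where "t' = \<iota> t"
  have mem: "f \<in> S" "t \<in> S" "t' \<in> S" using f \<iota>S by (simp_all add: t t'_def)
  note G [simp] = mem[THEN S_closed]
  have ne: "f \<noteq> \<one>" "t \<noteq> \<one>" "t' \<noteq> \<one>" using f G(1) by (simp_all add: t t'_def)
  have ft: "f \<noteq> t" using \<iota>_ne[OF f] t by simp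
  have tt': "t \<noteq> t'" using \<iota>_ne[OF mem(2) ne(2)] t'_def by simp
  have \<iota>t': "\<iota> t' = f" using \<iota>3[OF G(1)] by (simp add: t t'_def)
  have ft': "f \<noteq> t'" using \<iota>_ne[OF mem(3) ne(3)] \<iota>t' by simp
  have S_eq: "S = {\<one>, f, t, t'}"
  proof (rule card_subset_eq[symmetric])
    show "{\<one>, f, t, t'} \<subseteq> S" using mem S_one by simp
    show "card {\<one>, f, t, t'} = card S" using ne ne[THEN not_sym] ft tt' ft' S(2) by simp
  qed (rule finite_S)
  have sq: "\<iota> (f \<otimes> f) = t \<otimes> t" "\<iota> (t \<otimes> t) = t' \<otimes> t'" "\<iota> (t' \<otimes> t') = f \<otimes> f"
    using \<iota>t' by (simp_all add: t[symmetric] t'_def[symmetric])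
  have "f \<otimes> f \<noteq> t"
  proof
    assume ff: "f \<otimes> f = t"
    then have "t \<otimes> t = t'" using sq t'_def by simp
    then show False using S_pow4[OF f(1)] ff ne by simp
  qed
  moreover have "f \<otimes> f \<noteq> t'"
  proof
    assume ff: "f \<otimes> f = t'"
    then have "t \<otimes> t = f" using sq \<iota>t' by simp
    then have "t' \<otimes> t' = t" using sq t by simp
    then show False using S_pow4[OF f(1)] ff ne by simp
  qed
  moreover have "f \<otimes> f \<noteq> f" using ne by simp
  ultimately show ff: "f \<otimes> f = \<one>" using S_mult[OF f(1) f(1)] by (simp add: S_eq)
  then show tt: "t \<otimes> t = \<one>" using sq by simp
  have "f \<otimes> t \<noteq> f \<otimes> f" "t \<otimes> f \<noteq> f \<otimes> f" using ft by simp_all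
  then have "f \<otimes> t \<noteq> \<one>" "t \<otimes> f \<noteq> \<one>" unfolding ff .
  moreover have "f \<otimes> t \<noteq> f" "f \<otimes> t \<noteq> t" "t \<otimes> f \<noteq> f" "t \<otimes> f \<noteq> t" using ne by simp_all
  ultimately have ft_t': "f \<otimes> t = t'" and tf_t': "t \<otimes> f = t'"
    using S_mult[OF mem(1,2)] S_mult[OF mem(2,1)] by (simp_all add: S_eq)
  then show "t \<otimes> f = f \<otimes> t" by simp
  show "S = {\<one>, f, t, f \<otimes> t}" using S_eq ft_t' by simp
  show "distinct [\<one>, f, t, f \<otimes> t]" using ne ne[THEN not_sym] ft tt' ft' ft_t' by simp
  show "x \<otimes> f = t \<otimes> x" using \<iota>_swap[OF G(1)] t by simp
  have "x \<otimes> t = (f \<otimes> t) \<otimes> x" using \<iota>_swap[OF G(2)] t'_def ft_t' by simp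
  then show "x \<otimes> t = f \<otimes> (t \<otimes> x)" using x(1) by (simp add: m_assoc)
  show "x \<otimes> (f \<otimes> t) = f \<otimes> x" using \<iota>_swap[OF G(3)] \<iota>t' ft_t' by simp
  show "t \<in> S" by (rule mem(2))
qed

lemma nontrivial_S: obtains a where "a \<in> S" "a \<noteq> \<one>"
proof -
  have "S \<noteq> {\<one>}" using S(2) by auto
  then show ?thesis using that S_one by blast
qed

text \<open>Let \<open>x\<close> be outside \<open>S\<close>. Both \<open>\<psi>\<close> and conjugation by \<open>x\<close> permute the three nontrivial elements of \<open>S\<close>
  cyclically, so they commute on \<open>S\<close>. Therefore \<open>x\<close> and \<open>\<psi> x\<close> act on \<open>S\<close> in the same way, and
  \<open>inv x \<otimes> \<psi> x\<close> lies in \<open>S\<close> by \<open>commute_with_S\<close>.\<close>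

lemma displacements_in_S:
  assumes fpf: "\<And>s. s \<in> S \<Longrightarrow> \<psi> s = s \<Longrightarrow> s = \<one>"
  shows "D \<subseteq> S"
proof
  fix d assume "d \<in> D"
  then obtain x where x: "x \<in> carrier G" "d = \<delta> x" unfolding displacements_eq by blast
  show "d \<in> S"
  proof (cases "x \<in> S")
    case True
    then show ?thesis using x S_mult S_inv aut_S by (simp add: disp_def)
  next
    case False
    note [simp] = x(1)
    obtain a where a: "a \<in> S" "a \<noteq> \<one>" by (rule nontrivial_S)
    define t where "t = x \<otimes> a \<otimes> inv x"
    note struct = S_structure[OF x(1) False a, folded t_def]
    have aG [simp]: "a \<in> carrier G" "t \<in> carrier G" using S_closed a(1) struct(9) by blast+
    define b where "b = \<psi> a"
    have bS: "b \<in> S" using aut_S a by (simp add: b_def)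
    have bG [simp]: "b \<in> carrier G" by (rule S_closed[OF bS])
    have b1: "b \<noteq> \<one>" using a by (simp add: b_def)
    have ba: "b \<noteq> a" using fpf[OF a(1)] a(2) by (auto simp: b_def)
    have S_comm: "u \<otimes> v = v \<otimes> u" if "u \<in> S" "v \<in> S" for u v
    proof -
      have "u \<in> {\<one>, a, t, a \<otimes> t}" "v \<in> {\<one>, a, t, a \<otimes> t}" using that struct(1) by auto
      then show ?thesis using struct(5) left_swap[OF struct(5)] by (auto simp: m_assoc)
    qed
    have aax: "a \<otimes> (a \<otimes> w) = w" "t \<otimes> (t \<otimes> w) = w" if "w \<in> carrier G" for w
      using that struct(3,4) by (simp_all flip: m_assoc)
    have \<psi>b: "\<psi> b \<notin> {\<one>, a, b}"
    proof -
      have "\<psi> b \<noteq> a"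
      proof
        assume "\<psi> b = a"
        then have "\<psi> (a \<otimes> b) = a \<otimes> b" using S_comm[OF bS a(1)] by (simp add: b_def)
        then have "a \<otimes> b = \<one>" using fpf[OF S_mult[OF a(1) bS]] by simp
        then have "a \<otimes> b = a \<otimes> a" using struct(3) by simp
        then show False using ba by simp
      qed
      moreover have "\<psi> b \<noteq> b" using fpf[OF bS] b1 by auto
      ultimately show ?thesis using b1 by simp
    qed
    have \<psi>bS: "\<psi> b \<in> S" by (rule aut_S[OF bS])
    \<comment> \<open>conjugation by \<open>x\<close> and by \<open>\<psi> x\<close> agree on \<open>b\<close>\<close>
    have "x \<otimes> b = \<psi> t \<otimes> x"
    proof (cases "b = t")
      case True
      then have "\<psi> t = a \<otimes> t" using \<psi>bS \<psi>b struct(1) by auto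
      then show ?thesis using True struct(7) by (simp add: m_assoc)
    next
      case False
      then have b: "b = a \<otimes> t" using bS b1 ba struct(1) by blast
      then have "\<psi> b = t" using \<psi>bS \<psi>b struct(1) by auto
      moreover have "\<psi> b = b \<otimes> \<psi> t" using b by (simp add: b_def[symmetric])
      ultimately have "b \<otimes> \<psi> t = b \<otimes> a" using b S_comm[OF a(1) struct(9)] aax by (simp add: m_assoc struct(3))
      then have "\<psi> t = a" by simp
      then show ?thesis using b struct(8) by simp
    qed
    moreover have "\<psi> x \<otimes> b = \<psi> t \<otimes> \<psi> x"
      using arg_cong[OF struct(6), of \<psi>] by (simp add: b_def)
    ultimately have eqs: "x \<otimes> b = \<psi> t \<otimes> x" "\<psi> x \<otimes> b = \<psi> t \<otimes> \<psi> x" .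
    have "b \<otimes> inv x = inv x \<otimes> \<psi> t"
    proof -
      have "b \<otimes> inv x = inv x \<otimes> (x \<otimes> b) \<otimes> inv x" by (simp flip: m_assoc)
      also have "\<dots> = inv x \<otimes> \<psi> t" unfolding eqs(1) by (simp add: m_assoc)
      finally show ?thesis .
    qed
    then have "(inv x \<otimes> \<psi> x) \<otimes> b = b \<otimes> (inv x \<otimes> \<psi> x)"
      using eqs(2) by (simp add: m_assoc left_swap[of b "inv x" "inv x" "\<psi> t"])
    then have "inv x \<otimes> \<psi> x \<in> S" using commute_with_S[OF _ bS b1] by simp
    then have "x \<otimes> inv (inv x \<otimes> \<psi> x) \<otimes> inv x \<in> S" using conj_S[OF x(1) S_inv] by blast
    moreover have "x \<otimes> inv (inv x \<otimes> \<psi> x) \<otimes> inv x = \<delta> x" by (simp add: disp_def inv_mult_group m_assoc)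
    ultimately show ?thesis using x(2) by simp
  qed
qed

text \<open>There is a fixed point \<open>f\<close> in \<open>S\<close> by \<open>displacements_in_S\<close>, and \<open>\<psi>\<close> interchanges the other two
  involutions, since fewer than three points are fixed. For \<open>z\<close> outside \<open>S\<close> the element \<open>\<psi> z \<otimes> z\<close>
  commutes with \<open>f\<close>, hence lies in \<open>S\<close>; for a suitable \<open>z\<close> it is \<open>\<one>\<close> or \<open>f\<close>.\<close>

lemma kleinian_displacements:
  assumes "card D > 4"
  obtains e where "e < 2" "realizes (alternating_model e) G \<psi>" "card fixed > 1"
proof -
  have "\<not> D \<subseteq> S" using card_mono[OF finite_S, of D] S(2) assms by auto
  then obtain f where f: "f \<in> S" "\<psi> f = f" "f \<noteq> \<one>" using displacements_in_S by blast
  have card_F: "card fixed < 3"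
  proof (rule ccontr)
    assume "\<not> card fixed < 3"
    then have "5 * 3 \<le> card D * card fixed" using assms by (intro mult_le_mono) simp_all
    then show False using card_displacements order_twelve by simp
  qed
  obtain z where z: "z \<in> carrier G" "z \<notin> S"
  proof -
    have "S \<noteq> carrier G" using S(2) order_twelve by (auto simp: order_def)
    then show ?thesis using that S_closed by blast
  qed
  define t where "t = z \<otimes> f \<otimes> inv z"
  note struct = S_structure[OF z f(1,3), folded t_def]
  have G [simp]: "f \<in> carrier G" "t \<in> carrier G" "z \<in> carrier G" using S_closed f(1) struct(9) z by blast+
  have fx: "f \<otimes> (f \<otimes> w) = w" "t \<otimes> (t \<otimes> w) = w" if "w \<in> carrier G" for w
    using that struct(3,4) by (simp_all flip: m_assoc)
  have F2: "\<one> \<in> fixed" "f \<in> fixed" using fixedI[OF one_closed aut_one] fixedI[OF G(1) f(2)] .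
  have "\<psi> t \<noteq> t"
  proof
    assume "\<psi> t = t"
    then have "{\<one>, f, t} \<subseteq> fixed" using F2 fixedI[OF G(2)] by simp
    then have "card {\<one>, f, t} \<le> card fixed" by (rule card_mono[OF finite_fixed])
    then show False using card_F struct(2) by simp
  qed
  moreover have "\<psi> t \<noteq> f" using aut_eq_iff[OF G(2,1)] f(2) struct(2) by auto
  moreover have "\<psi> t \<noteq> \<one>" using struct(2) by auto
  ultimately have \<psi>t: "\<psi> t = f \<otimes> t" using aut_S[OF struct(9)] struct(1) by blast
  define s where "s = \<psi> z \<otimes> z"
  have [simp]: "s \<in> carrier G" by (simp add: s_def)
  have conj1: "\<psi> z \<otimes> f = f \<otimes> t \<otimes> \<psi> z"
    using arg_cong[OF struct(6), of \<psi>] \<psi>t f(2) by simp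
  have conj2: "\<psi> z \<otimes> t = f \<otimes> \<psi> z"
  proof -
    have "\<psi> (f \<otimes> t) = t" using \<psi>t f(2) fx by simp
    then show ?thesis using arg_cong[OF struct(8), of \<psi>] f(2) by simp
  qed
  have "s \<otimes> f = \<psi> z \<otimes> (t \<otimes> z)" using struct(6) by (simp add: s_def m_assoc)
  also have "\<dots> = (\<psi> z \<otimes> t) \<otimes> z" by (simp add: m_assoc)
  also have "\<dots> = f \<otimes> s" unfolding conj2 by (simp add: s_def m_assoc)
  finally have "s \<in> S" by (intro commute_with_S[OF _ f(1,3)]) simp_all
  then have s: "s \<in> {\<one>, f, t, f \<otimes> t}" using struct(1) by simp
  \<comment> \<open>replacing \<open>z\<close> by \<open>f z\<close> multiplies \<open>\<psi> z z\<close> by \<open>t\<close>\<close>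
  have "\<exists>z'. z' \<in> carrier G \<and> z' \<notin> S \<and> z' \<otimes> f \<otimes> inv z' = t \<and> \<psi> z' \<otimes> z' \<in> {\<one>, f}"
  proof (cases "s \<in> {\<one>, f}")
    case True
    then have "\<psi> z \<otimes> z \<in> {\<one>, f}" unfolding s_def .
    then show ?thesis using z t_def[symmetric] by (intro exI[of _ z] conjI)
  next
    case False
    then have s: "s = t \<or> s = f \<otimes> t" using s by blast
    have "f \<otimes> z \<notin> S"
    proof
      assume "f \<otimes> z \<in> S"
      then have "f \<otimes> (f \<otimes> z) \<in> S" using S_mult[OF f(1)] by blast
      then show False using fx z by simp
    qed
    note out = this
    have conj: "f \<otimes> z \<otimes> f \<otimes> inv (f \<otimes> z) = t"
    proof -
      have inv_f: "inv f = f" using struct(3) by (simp add: inv_equality)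
      have "f \<otimes> z \<otimes> f \<otimes> inv (f \<otimes> z) = f \<otimes> (z \<otimes> f \<otimes> inv z) \<otimes> f" by (simp add: inv_mult_group inv_f m_assoc)
      then show ?thesis using struct(5) fx by (simp add: t_def[symmetric] m_assoc)
    qed
    have "\<psi> (f \<otimes> z) \<otimes> (f \<otimes> z) = f \<otimes> (\<psi> z \<otimes> f) \<otimes> z" using f(2) by (simp add: m_assoc)
    then have "\<psi> (f \<otimes> z) \<otimes> (f \<otimes> z) = t \<otimes> s" unfolding conj1 by (simp add: s_def m_assoc fx)
    moreover have "t \<otimes> (f \<otimes> t) = f"
      using struct(4) left_swap[OF struct(5), of t] by simp
    ultimately have "\<psi> (f \<otimes> z) \<otimes> (f \<otimes> z) \<in> {\<one>, f}"
      using s struct(4) by auto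
    moreover have "f \<otimes> z \<in> carrier G" by simp
    ultimately show ?thesis using out conj by blast
  qed
  then obtain y where y: "y \<in> carrier G" "y \<notin> S" "y \<otimes> f \<otimes> inv y = t" "\<psi> y \<otimes> y \<in> {\<one>, f}" by blast
  note struct' = S_structure[OF y(1,2) f(1,3), unfolded y(3)]
  have y3: "y \<otimes> (y \<otimes> y) = \<one>" by (rule cube_outside[OF y(1,2)])
  have \<psi>y: "\<psi> y = (\<psi> y \<otimes> y) \<otimes> (y \<otimes> y)" using y(1) y3 by (simp add: m_assoc)
  obtain e :: nat where e: "e < 2" "\<psi> y \<otimes> y = f [^] e"
  proof (cases "\<psi> y \<otimes> y = \<one>")
    case True
    then show ?thesis using that[of 0] by simp
  next
    case False
    then show ?thesis using that[of 1] y(4) by simp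
  qed
  have "\<psi> y = f [^] e \<otimes> (y \<otimes> y)" using \<psi>y unfolding e(2) .
  moreover have "y \<notin> {\<one>, f, t, f \<otimes> t}" using y(2) struct'(1) by simp
  ultimately have "realizes (alternating_model e) G \<psi>"
    using realizes_alternating_model[OF order_twelve e(1) G(1,2) y(1) struct'(3,4,5) y3 struct'(6,7) f(3)]
      struct'(2) f(2) \<psi>t by auto
  moreover have "card fixed > 1"
  proof -
    have "card {\<one>, f} \<le> card fixed" using F2 by (intro card_mono) simp_all
    then show ?thesis using f(3) by simp
  qed
  ultimately show ?thesis using that e(1) by blast
qed

end

context group_aut
begin

lemma order_twelve_six_displacements:
  assumes "order G = 12" "card D = 6"
  shows "realizes (cyclic_model 6 5 {..<6}) G \<psi> \<or> (\<exists>e\<in>{0, 1}. realizes (alternating_model e) G \<psi>)"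
proof (cases rule: order_twelve_dichotomy[OF assms(1)])
  case (1 z)
  then show ?thesis using six_displacements_unique_three[OF assms 1] by simp
next
  case (2 S)
  interpret kleinian_twelve G \<psi> S
    by (intro kleinian_twelve.intro kleinian_twelve_axioms.intro group_aut_axioms assms(1) 2)
  obtain e where "e < 2" "realizes (alternating_model e) G \<psi>"
    using kleinian_displacements assms by auto
  moreover from this have "e \<in> {0, 1}" by auto
  ultimately show ?thesis by blast
qed

lemma order_twelve_fixed_point_free:
  assumes "order G = 12" "card D = 12"
  shows "realizes (abelian_model 2 2 3 (0,1,0) (1,1,0) (0,0,2) ({..<2} \<times> {..<2} \<times> {..<3})) G \<psi>"
proof (cases rule: order_twelve_dichotomy[OF assms(1)])
  case (1 z)
  then show ?thesis by (rule twelve_displacements_unique_three[OF assms])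
next
  case (2 S)
  interpret kleinian_twelve G \<psi> S
    by (intro kleinian_twelve.intro kleinian_twelve_axioms.intro group_aut_axioms assms(1) 2)
  have "card fixed = 1" using card_displacements assms by simp
  then show ?thesis using kleinian_displacements assms by auto
qed

end

text \<open>What has to be evaluated in order to see that \<open>c\<close> embeds the model \<open>M\<close> into the group \<open>G\<close> of order
  \<open>n\<close>.\<close>

definition witness_check ::
    "nat \<Rightarrow> triple monoid \<Rightarrow> (triple \<Rightarrow> triple) \<Rightarrow> (triple \<Rightarrow> triple) \<Rightarrow> triple model \<Rightarrow> bool" where
  "witness_check n G \<psi> c M \<longleftrightarrow> card (carrier G) = n \<and> auto_check G \<psi> \<and> embed_check c M G \<psi> \<and>
     (case M of (H, \<theta>, E) \<Rightarrow> \<theta> ` carrier H \<subseteq> carrier H \<and> E \<subseteq> carrier H \<and>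
       (\<forall>x\<in>carrier H. \<forall>y\<in>carrier H. \<theta> (x \<otimes>\<^bsub>H\<^esub> y) = \<theta> x \<otimes>\<^bsub>H\<^esub> \<theta> y))"

lemma witness:
  assumes "witness_check n G \<psi> c M" "group G" "finite (carrier G)" "group (fst M)" "finite (carrier (fst M))"
  shows "model M \<and> realizable n M"
proof
  obtain H \<theta> E where M: "M = (H, \<theta>, E)" by (cases M)
  show "model M"
    using assms by (auto simp: model_def witness_check_def M hom_def)
  show "realizable n M"
    by (rule realizableI[of G n \<psi> M c]) (use assms in \<open>auto simp: witness_check_def\<close>)
qed

lemma finite_concrete:
  "finite (carrier (cyclic3 l m n))" "finite (carrier (dihedral m))"
  "finite (carrier quaternion)" "finite (carrier alternating)"
  by (simp_all add: cyclic3_def dihedral_def quaternion_def alternating_def)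

lemmas model_defs = trivial_model_def two_model_def cyclic_model_def abelian_model_def
  companion_model_def quaternion_model_def alternating_model_def

lemmas concrete = model_defs finite_concrete group_cyclic3 group_dihedral group_quaternion group_alternating

section \<open>Realizing the models\<close>

text \<open>The automorphism \<open>r \<mapsto> r\<close>, \<open>s \<mapsto> inv x \<otimes> s\<close>, where \<open>x = r [^] (m div d)\<close> has order \<open>d\<close>. Its displacements are
  \<open>\<one>\<close> and \<open>x\<close>.\<close>

definition dihedral_twist :: "nat \<Rightarrow> nat \<Rightarrow> triple \<Rightarrow> triple" where
  "dihedral_twist m d = (\<lambda>(i, e, _). ((i + e * (m - m div d)) mod m, e, 0))"

definition diagonal :: "nat \<Rightarrow> nat \<Rightarrow> nat \<Rightarrow> nat \<Rightarrow> nat \<Rightarrow> nat \<Rightarrow> triple \<Rightarrow> triple" where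
  "diagonal l m n a b c = linear3 l m n (a, 0, 0) (0, b, 0) (0, 0, c)"

text \<open>Two commuting involutions that are displacements, but whose product is not.\<close>

definition klein_base_model :: "triple model" where
  "klein_base_model = abelian_model 2 2 1 (1,0,0) (0,1,0) (0,0,0) {(0,0,0), (1,0,0), (0,1,0)}"

abbreviation "full l m n \<equiv> {..<l} \<times> {..<m} \<times> {..<n}"

lemma trivial_witness:
  assumes "n > 0"
  shows "model trivial_model \<and> realizable n trivial_model"
proof (rule witness[where G = "cyclic3 n 1 1" and \<psi> = id and c = id])
  have "d = (0, 0, 0)" if "d \<in> displacements (cyclic3 n 1 1) id" for d
  proof -
    interpret group "cyclic3 n 1 1" using assms by (simp add: group_cyclic3)
    have "\<one>\<^bsub>cyclic3 n 1 1\<^esub> = (0, 0, 0)" by (simp add: cyclic3_def)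
    then show ?thesis using that by (auto simp: displacements_def simp del: One_nat_def)
  qed
  moreover have "(0, 0, 0) \<in> displacements (cyclic3 n 1 1) id"
    using assms by (force simp: displacements_def cyclic3_def)
  ultimately have "displacements (cyclic3 n 1 1) id = {(0, 0, 0)}" by blast
  then show "witness_check n (cyclic3 n 1 1) id id trivial_model"
    using assms by (auto simp: witness_check_def auto_check_def embed_check_def model_defs
        cyclic3_def linear3_def card_cartesian_product)
qed (use assms in \<open>simp_all add: concrete\<close>)

lemma two_model_witness:
  "model (two_model 2) \<and> realizable 4 (two_model 2)"
  "model (two_model 3) \<and> realizable 6 (two_model 3)"
  "model (two_model 2) \<and> realizable 8 (two_model 2)"
  "model (two_model 4) \<and> realizable 8 (two_model 4)"
  "model (two_model 5) \<and> realizable 10 (two_model 5)"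
  "model (two_model 2) \<and> realizable 12 (two_model 2)"
  "model (two_model 3) \<and> realizable 12 (two_model 3)"
  "model (two_model 6) \<and> realizable 12 (two_model 6)"
  "model (two_model 7) \<and> realizable 14 (two_model 7)"
proof -
  have *: "model (two_model d) \<and> realizable n (two_model d)"
    if "witness_check n (dihedral m) (dihedral_twist m d) (\<lambda>(i, _). (i * (m div d), 0, 0)) (two_model d)"
      "m > 0" "d > 0" for m n d
    by (rule witness[OF that(1)]) (use that in \<open>simp_all add: concrete\<close>)
  show "model (two_model 2) \<and> realizable 4 (two_model 2)" by (rule *[of _ 2], code_simp) simp_all
  show "model (two_model 3) \<and> realizable 6 (two_model 3)" by (rule *[of _ 3], code_simp) simp_all
  show "model (two_model 2) \<and> realizable 8 (two_model 2)" by (rule *[of _ 4], code_simp) simp_all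
  show "model (two_model 4) \<and> realizable 8 (two_model 4)" by (rule *[of _ 4], code_simp) simp_all
  show "model (two_model 5) \<and> realizable 10 (two_model 5)" by (rule *[of _ 5], code_simp) simp_all
  show "model (two_model 2) \<and> realizable 12 (two_model 2)" by (rule *[of _ 6], code_simp) simp_all
  show "model (two_model 3) \<and> realizable 12 (two_model 3)" by (rule *[of _ 6], code_simp) simp_all
  show "model (two_model 6) \<and> realizable 12 (two_model 6)" by (rule *[of _ 6], code_simp) simp_all
  show "model (two_model 7) \<and> realizable 14 (two_model 7)" by (rule *[of _ 7], code_simp) simp_all
qed

lemma cyclic3_witness:
  assumes "witness_check (l * m * n) (cyclic3 l m n) \<psi> c M" "l > 0" "m > 0" "n > 0"
    and "group (fst M)" "finite (carrier (fst M))"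
  shows "model M \<and> realizable (l * m * n) M"
  by (rule witness[OF assms(1)]) (use assms in \<open>simp_all add: concrete\<close>)

lemma multiplier_witness:
  "a \<in> {2} \<Longrightarrow> model (cyclic_model 3 a {..<3}) \<and> realizable (3 * 2 * 1) (cyclic_model 3 a {..<3})"
  "a \<in> {2, 3, 4} \<Longrightarrow> model (cyclic_model 5 a {..<5}) \<and> realizable (5 * 2 * 1) (cyclic_model 5 a {..<5})"
  "a \<in> {2, 3, 4, 5, 6} \<Longrightarrow> model (cyclic_model 7 a {..<7}) \<and> realizable (7 * 2 * 1) (cyclic_model 7 a {..<7})"
proof -
  have *: "model (cyclic_model p a {..<p}) \<and> realizable (p * 2 * 1) (cyclic_model p a {..<p})"
    if "witness_check (p * 2 * 1) (cyclic3 p 2 1) (diagonal p 2 1 a 1 0) id (cyclic_model p a {..<p})" "p > 0" for p a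
    by (rule cyclic3_witness[OF that(1)]) (use that in \<open>simp_all add: concrete\<close>)
  have "\<forall>a\<in>{2}. witness_check (3 * 2 * 1) (cyclic3 3 2 1) (diagonal 3 2 1 a 1 0) id (cyclic_model 3 a {..<3})"
    by code_simp
  then show "a \<in> {2} \<Longrightarrow> model (cyclic_model 3 a {..<3}) \<and> realizable (3 * 2 * 1) (cyclic_model 3 a {..<3})"
    by (intro *) (blast, simp)
  have "\<forall>a\<in>{2, 3, 4}. witness_check (5 * 2 * 1) (cyclic3 5 2 1) (diagonal 5 2 1 a 1 0) id (cyclic_model 5 a {..<5})"
    by code_simp
  then show "a \<in> {2, 3, 4} \<Longrightarrow> model (cyclic_model 5 a {..<5}) \<and> realizable (5 * 2 * 1) (cyclic_model 5 a {..<5})"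
    by (intro *) (blast, simp)
  have "\<forall>a\<in>{2, 3, 4, 5, 6}. witness_check (7 * 2 * 1) (cyclic3 7 2 1) (diagonal 7 2 1 a 1 0) id (cyclic_model 7 a {..<7})"
    by code_simp
  then show "a \<in> {2, 3, 4, 5, 6} \<Longrightarrow> model (cyclic_model 7 a {..<7}) \<and> realizable (7 * 2 * 1) (cyclic_model 7 a {..<7})"
    by (intro *) (blast, simp)
qed

lemma order_eight_witness:
  "model (cyclic_model 4 3 {..<4}) \<and> realizable (8 * 1 * 1) (cyclic_model 4 3 {..<4})"
  "model (companion_model 2 1 1) \<and> realizable (2 * 2 * 2) (companion_model 2 1 1)"
  "model (companion_model 2 1 0) \<and> realizable (2 * 2 * 2) (companion_model 2 1 0)"
  "model (abelian_model 2 2 2 (0,1,0) (0,0,1) (1,1,0) (full 2 2 2)) \<and>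
   realizable (2 * 2 * 2) (abelian_model 2 2 2 (0,1,0) (0,0,1) (1,1,0) (full 2 2 2))"
  "model (abelian_model 2 2 2 (0,1,0) (0,0,1) (1,0,1) (full 2 2 2)) \<and>
   realizable (2 * 2 * 2) (abelian_model 2 2 2 (0,1,0) (0,0,1) (1,0,1) (full 2 2 2))"
  "model quaternion_model \<and> realizable 8 quaternion_model"
proof -
  show "model (cyclic_model 4 3 {..<4}) \<and> realizable (8 * 1 * 1) (cyclic_model 4 3 {..<4})"
    by (rule cyclic3_witness[where \<psi> = "diagonal 8 1 1 7 0 0" and c = "\<lambda>(i, _). (2 * i, 0, 0)"], code_simp)
      (simp_all add: concrete)
  show "model (companion_model 2 1 1) \<and> realizable (2 * 2 * 2) (companion_model 2 1 1)"
    by (rule cyclic3_witness[where \<psi> = "linear3 2 2 2 (0,1,0) (1,1,0) (0,0,1)" and c = id], code_simp)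
      (simp_all add: concrete)
  show "model (companion_model 2 1 0) \<and> realizable (2 * 2 * 2) (companion_model 2 1 0)"
    by (rule cyclic3_witness[where \<psi> = "linear3 2 2 2 (0,1,0) (1,0,0) (1,0,1)" and c = id], code_simp)
      (simp_all add: concrete)
  show "model (abelian_model 2 2 2 (0,1,0) (0,0,1) (1,1,0) (full 2 2 2)) \<and>
      realizable (2 * 2 * 2) (abelian_model 2 2 2 (0,1,0) (0,0,1) (1,1,0) (full 2 2 2))"
    by (rule cyclic3_witness[where \<psi> = "linear3 2 2 2 (0,1,0) (0,0,1) (1,1,0)" and c = id], code_simp)
      (simp_all add: concrete)
  show "model (abelian_model 2 2 2 (0,1,0) (0,0,1) (1,0,1) (full 2 2 2)) \<and>
      realizable (2 * 2 * 2) (abelian_model 2 2 2 (0,1,0) (0,0,1) (1,0,1) (full 2 2 2))"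
    by (rule cyclic3_witness[where \<psi> = "linear3 2 2 2 (0,1,0) (0,0,1) (1,0,1)" and c = id], code_simp)
      (simp_all add: concrete)
  show "model quaternion_model \<and> realizable 8 quaternion_model"
    by (rule witness[where G = quaternion and \<psi> = quaternion_aut and c = id], code_simp)
      (simp_all add: concrete)
qed

lemma klein_witness_four: "model (companion_model 2 1 1) \<and> realizable (2 * 2 * 1) (companion_model 2 1 1)"
  by (rule cyclic3_witness[where \<psi> = "linear3 2 2 1 (0,1,0) (1,1,0) (0,0,0)" and c = id], code_simp)
    (simp_all add: concrete)

lemma order_nine_witness:
  "model (cyclic_model 3 1 {..<3}) \<and> realizable (9 * 1 * 1) (cyclic_model 3 1 {..<3})"
  "model (cyclic_model 3 2 {..<3}) \<and> realizable (3 * 3 * 1) (cyclic_model 3 2 {..<3})"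
  "ab \<in> {(1, 1), (1, 2), (2, 0), (2, 1)} \<Longrightarrow>
     model (companion_model 3 (fst ab) (snd ab)) \<and> realizable (3 * 3 * 1) (companion_model 3 (fst ab) (snd ab))"
  "model (abelian_model 3 3 1 (2,0,0) (0,2,0) (0,0,0) (full 3 3 1)) \<and>
   realizable (3 * 3 * 1) (abelian_model 3 3 1 (2,0,0) (0,2,0) (0,0,0) (full 3 3 1))"
proof -
  show "model (cyclic_model 3 1 {..<3}) \<and> realizable (9 * 1 * 1) (cyclic_model 3 1 {..<3})"
    by (rule cyclic3_witness[where \<psi> = "diagonal 9 1 1 4 0 0" and c = "\<lambda>(i, _). (3 * i, 0, 0)"], code_simp)
      (simp_all add: concrete)
  show "model (cyclic_model 3 2 {..<3}) \<and> realizable (3 * 3 * 1) (cyclic_model 3 2 {..<3})"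
    by (rule cyclic3_witness[where \<psi> = "diagonal 3 3 1 2 1 0" and c = id], code_simp)
      (simp_all add: concrete)
  have "\<forall>ab\<in>{(1, 1), (1, 2), (2, 0), (2, 1)}. witness_check (3 * 3 * 1) (cyclic3 3 3 1)
      (linear3 3 3 1 (0,1,0) (fst ab, snd ab, 0) (0,0,0)) id (companion_model 3 (fst ab) (snd ab))"
    by code_simp
  then have "ab \<in> {(1, 1), (1, 2), (2, 0), (2, 1)} \<Longrightarrow> witness_check (3 * 3 * 1) (cyclic3 3 3 1)
      (linear3 3 3 1 (0,1,0) (fst ab, snd ab, 0) (0,0,0)) id (companion_model 3 (fst ab) (snd ab))" by blast
  then show "ab \<in> {(1, 1), (1, 2), (2, 0), (2, 1)} \<Longrightarrow>
     model (companion_model 3 (fst ab) (snd ab)) \<and> realizable (3 * 3 * 1) (companion_model 3 (fst ab) (snd ab))"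
    by (rule cyclic3_witness) (simp_all add: concrete)
  show "model (abelian_model 3 3 1 (2,0,0) (0,2,0) (0,0,0) (full 3 3 1)) \<and>
     realizable (3 * 3 * 1) (abelian_model 3 3 1 (2,0,0) (0,2,0) (0,0,0) (full 3 3 1))"
    by (rule cyclic3_witness[where \<psi> = "diagonal 3 3 1 2 2 0" and c = id], code_simp)
      (simp_all add: concrete)
qed

lemma order_twelve_witness:
  "model (cyclic_model 3 2 {..<3}) \<and> realizable (3 * 4 * 1) (cyclic_model 3 2 {..<3})"
  "model (companion_model 2 1 1) \<and> realizable (2 * 2 * 3) (companion_model 2 1 1)"
  "model (cyclic_model 6 5 {..<6}) \<and> realizable (12 * 1 * 1) (cyclic_model 6 5 {..<6})"
  "model (abelian_model 2 2 3 (0,1,0) (1,1,0) (0,0,2) (full 2 2 3)) \<and>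
   realizable (2 * 2 * 3) (abelian_model 2 2 3 (0,1,0) (1,1,0) (0,0,2) (full 2 2 3))"
  "model klein_base_model \<and> realizable 12 klein_base_model"
  "model (alternating_model 0) \<and> realizable 12 (alternating_model 0)"
  "model (alternating_model 1) \<and> realizable 12 (alternating_model 1)"
proof -
  show "model (cyclic_model 3 2 {..<3}) \<and> realizable (3 * 4 * 1) (cyclic_model 3 2 {..<3})"
    by (rule cyclic3_witness[where \<psi> = "diagonal 3 4 1 2 1 0" and c = id], code_simp)
      (simp_all add: concrete)
  show "model (companion_model 2 1 1) \<and> realizable (2 * 2 * 3) (companion_model 2 1 1)"
    by (rule cyclic3_witness[where \<psi> = "linear3 2 2 3 (0,1,0) (1,1,0) (0,0,1)" and c = id], code_simp)
      (simp_all add: concrete)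
  show "model (cyclic_model 6 5 {..<6}) \<and> realizable (12 * 1 * 1) (cyclic_model 6 5 {..<6})"
    by (rule cyclic3_witness[where \<psi> = "diagonal 12 1 1 11 0 0" and c = "\<lambda>(i, _). (2 * i, 0, 0)"], code_simp)
      (simp_all add: concrete)
  show "model (abelian_model 2 2 3 (0,1,0) (1,1,0) (0,0,2) (full 2 2 3)) \<and>
     realizable (2 * 2 * 3) (abelian_model 2 2 3 (0,1,0) (1,1,0) (0,0,2) (full 2 2 3))"
    by (rule cyclic3_witness[where \<psi> = "linear3 2 2 3 (0,1,0) (1,1,0) (0,0,2)" and c = id], code_simp)
      (simp_all add: concrete)
  show "model klein_base_model \<and> realizable 12 klein_base_model"
    \<comment> \<open>the nontrivial displacements of this automorphism are \<open>f \<otimes> t\<close> and \<open>t\<close>\<close>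
    by (rule witness[where G = alternating and c = "\<lambda>(i, j, _). (i, (i + j) mod 2, 0)"
        and \<psi> = "\<lambda>(i, j, k). if k = 0 then (i, j, 0) else if k = 1 then ((i + 1) mod 2, (j + 1) mod 2, 1)
          else (i, (j + 1) mod 2, 2)"], code_simp)
      (simp_all add: concrete klein_base_model_def)
  show "model (alternating_model 0) \<and> realizable 12 (alternating_model 0)"
    by (rule witness[where G = alternating and \<psi> = "alternating_aut 0" and c = id], code_simp)
      (simp_all add: concrete)
  show "model (alternating_model 1) \<and> realizable 12 (alternating_model 1)"
    by (rule witness[where G = alternating and \<psi> = "alternating_aut 1" and c = id], code_simp)
      (simp_all add: concrete)
qed

section \<open>Counting the isomorphism classes\<close>

lemma card_classes_eq_length:
  fixes Ms :: "triple model list"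
  assumes "\<And>M. M \<in> set Ms \<Longrightarrow> model M \<and> realizable n M"
    and "\<And>(G :: nat monoid) \<psi>. group_aut G \<psi> \<Longrightarrow> order G = n \<Longrightarrow> \<exists>M\<in>set Ms. realizes M G \<psi>"
    and "distinct (map (solutions W) Ms)" "length Ms = k"
  shows "card (GAQ_classes n) = k"
  using card_classes[of Ms n W] assms by (auto simp: realizable_def)

lemma divisor_cases:
  assumes "k dvd n" "n > 0"
  shows "k \<in> set (filter (\<lambda>d. d dvd n) [1..<Suc n])"
proof -
  have "k \<le> n" using assms by (rule dvd_imp_le)
  moreover have "k \<noteq> 0" using assms by auto
  ultimately show ?thesis using assms(1) by (auto simp: less_Suc_eq_le)
qed

text \<open>The equations \<open>\<psi> u = u [^] a\<close> recover the multiplier of a cyclic model.\<close>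

abbreviation multiplier_tests :: "nat \<Rightarrow> (nat list \<times> nat list) list" where
  "multiplier_tests n \<equiv> ([], []) # map (\<lambda>a. ([1], replicate a 0)) [0..<n]"

lemma word_cyclic:
  "word (cyclic3 n 1 1) \<theta> (replicate k 0) (i, 0, 0) = (k * i mod n, 0, 0)"
  "word (cyclic3 n 1 1) (linear3 n 1 1 (a, 0, 0) (0, 0, 0) (0, 0, 0)) [1] (i, 0, 0) = (a * i mod n, 0, 0)"
  by (induction k) (simp_all add: cyclic3_def linear3_def mod_simps mult.commute)

text \<open>All elements of \<open>E\<close> solve \<open>\<psi> u = u [^] a\<close> in the first model. Equality of the counts makes all
  elements of \<open>F\<close> solve the same equation in the second.\<close>

lemma multiplier_cong:
  assumes eq: "solutions (multiplier_tests n) (cyclic_model n a E) = solutions (multiplier_tests n) (cyclic_model n b F)"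
    and "a < n" "finite F" "i \<in> F"
  shows "b * i mod n = a * i mod n"
proof -
  let ?h = "\<lambda>i :: nat. (i, 0, 0) :: triple"
  define N where "N c S k = card {i \<in> S. c * i mod n = k * i mod n}" for c k and S :: "nat set"
  have inj: "inj_on ?h S" for S by (rule inj_onI) simp
  have N: "card {u \<in> ?h ` S. word (cyclic3 n 1 1) (linear3 n 1 1 (c, 0, 0) (0, 0, 0) (0, 0, 0)) [1] u =
      word (cyclic3 n 1 1) (linear3 n 1 1 (c, 0, 0) (0, 0, 0) (0, 0, 0)) (replicate k 0) u} = N c S k" for c S k
  proof -
    have "{u \<in> ?h ` S. word (cyclic3 n 1 1) (linear3 n 1 1 (c, 0, 0) (0, 0, 0) (0, 0, 0)) [1] u =
        word (cyclic3 n 1 1) (linear3 n 1 1 (c, 0, 0) (0, 0, 0) (0, 0, 0)) (replicate k 0) u} =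
        ?h ` {i \<in> S. c * i mod n = k * i mod n}"
      unfolding image_def using word_cyclic[of n] by auto
    then show ?thesis by (simp add: N_def card_image[OF inj])
  qed
  have "solutions (multiplier_tests n) (cyclic_model n c S) = card S # map (N c S) [0..<n]" for c S
    unfolding solutions_def cyclic_model_def abelian_model_def
    by (simp add: N card_image[OF inj] comp_def del: word.simps One_nat_def)
  then have "card E = card F" and "N a E a = N b F a"
    using eq \<open>a < n\<close> by auto
  then have "card {i \<in> F. b * i mod n = a * i mod n} = card F" by (simp add: N_def)
  then have "{i \<in> F. b * i mod n = a * i mod n} = F"
    using \<open>finite F\<close> by (intro card_subset_eq) auto
  then show ?thesis using \<open>i \<in> F\<close> by auto
qed

text \<open>By \<open>multiplier_cong\<close> the displacement \<open>1 - b\<close> of the second model is multiplied alike by \<open>a\<close> and by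
  \<open>b\<close>, so \<open>n\<close> divides \<open>(b - a) * (1 - b)\<close>. Adding the corresponding relation for the first model shows
  that \<open>n\<close> divides the square of \<open>a - b\<close>. For \<open>n = 9\<close> the conclusion fails.\<close>

lemma affine_model_eqD:
  assumes eq: "solutions (multiplier_tests n) (affine_model n a) = solutions (multiplier_tests n) (affine_model n b)"
    and "a < n" "b < n" and squarefree: "\<And>k :: int. int n dvd k * k \<Longrightarrow> int n dvd k"
  shows "a = b"
proof -
  have key: "int n dvd (int d - int c) * (1 - int d)"
    if "solutions (multiplier_tests n) (affine_model n c) = solutions (multiplier_tests n) (affine_model n d)"
      "c < n" for c d
  proof (cases "n = 1")
    case False
    then have n: "n > 1" using that by simp
    let ?S = "{i \<in> {..<n}. \<exists>x\<in>{..<n}. (i + d * x) mod n = x}"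
    define e where "e = nat ((1 - int d) mod int n)"
    have e: "int e = (1 - int d) mod int n" using n by (simp add: e_def)
    have "int ((e + d * 1) mod n) = ((1 - int d) mod int n + int d) mod int n" by (simp add: zmod_int e)
    also have "\<dots> = 1" using n by (simp add: mod_simps)
    finally have "(e + d * 1) mod n = 1" by linarith
    moreover have "int e < int n" using n by (simp add: e)
    ultimately have "e \<in> ?S" using n by force
    then have "d * e mod n = c * e mod n"
      using multiplier_cong[of n c _ d ?S e] that unfolding affine_model_def by simp
    then have "int (d * e) mod int n = int (c * e) mod int n" unfolding zmod_int[symmetric] by (rule arg_cong)
    then have "int n dvd (int d - int c) * int e" by (simp add: mod_eq_dvd_iff algebra_simps)
    then have "(int d - int c) * ((1 - int d) mod int n) mod int n = 0" unfolding e by (rule dvd_imp_mod_0)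
    then have "(int d - int c) * (1 - int d) mod int n = 0" by (simp only: mod_mult_right_eq)
    then show ?thesis by (rule mod_0_imp_dvd)
  qed simp
  have "int n dvd (int b - int a) * (1 - int b) + (int a - int b) * (1 - int a)"
    using key[OF eq \<open>a < n\<close>] key[OF eq[symmetric] \<open>b < n\<close>] by (rule dvd_add)
  also have "(int b - int a) * (1 - int b) + (int a - int b) * (1 - int a) = - ((int a - int b) * (int a - int b))"
    by (simp add: algebra_simps)
  finally have "int n dvd (int a - int b) * (int a - int b)" by (simp only: dvd_minus_iff)
  then have "int n dvd int a - int b" by (rule squarefree)
  then have "int a mod int n = int b mod int n" by (simp add: mod_eq_dvd_iff)
  then show ?thesis using assms(2,3) by (simp flip: zmod_int)
qed

lemma card_classes_cyclic:
  assumes n: "n > 0" and squarefree: "\<And>k :: int. int n dvd k * k \<Longrightarrow> int n dvd k"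
    and gen: "\<And>(G :: nat monoid) \<psi>. group_aut G \<psi> \<Longrightarrow> order G = n \<Longrightarrow>
      \<exists>a<n. coprime a n \<and> realizes (affine_model n a) G \<psi>"
  shows "card (GAQ_classes n) = card {a. a < n \<and> coprime a n}"
proof (rule card_classes_eq_length)
  let ?units = "filter (\<lambda>a. coprime a n) [0..<n]"
  show "model M \<and> realizable n M" if "M \<in> set (map (affine_model n) ?units)" for M
    using that affine_model_realizable n by auto
  show "\<exists>M\<in>set (map (affine_model n) ?units). realizes M G \<psi>" if "group_aut G \<psi>" "order G = n"
    for G :: "nat monoid" and \<psi>
    using gen[OF that] by auto
  have "inj_on (\<lambda>a. solutions (multiplier_tests n) (affine_model n a)) (set ?units)"
    by (rule inj_onI) (rule affine_model_eqD[OF _ _ _ squarefree], auto)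
  then show "distinct (map (solutions (multiplier_tests n)) (map (affine_model n) ?units))"
    by (simp add: distinct_map comp_def)
  have "set ?units = {a. a < n \<and> coprime a n}" by auto
  then show "length (map (affine_model n) ?units) = card {a. a < n \<and> coprime a n}"
    using distinct_card[of ?units] by simp
qed

lemma card_classes_prime:
  assumes "prime p"
  shows "card (GAQ_classes p) = p - 1"
proof -
  have "card (GAQ_classes p) = card {a. a < p \<and> coprime a p}"
  proof (rule card_classes_cyclic)
    show "p > 0" using assms by (rule prime_gt_0_nat)
    show "int p dvd k" if "int p dvd k * k" for k
      using that assms prime_dvd_multD[of "int p" k k] by simp
    show "\<exists>a<p. coprime a p \<and> realizes (affine_model p a) G \<psi>" if "group_aut G \<psi>" "order G = p"
      for G :: "nat monoid" and \<psi>
      using group_aut.realizes_affine_model_prime[OF that(1)] that(2) assms by simp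
  qed
  also have "{a. a < p \<and> coprime a p} = {1..<p}"
  proof (rule equalityI; rule subsetI)
    fix a assume "a \<in> {a. a < p \<and> coprime a p}"
    moreover have "p > 1" using assms by (rule prime_gt_1_nat)
    ultimately show "a \<in> {1..<p}" by (cases "a = 0") auto
  next
    fix a assume a: "a \<in> {1..<p}"
    then have "\<not> p dvd a" by (auto dest: dvd_imp_le)
    then have "coprime p a" using assms by (rule prime_imp_coprime[rotated])
    then show "a \<in> {a. a < p \<and> coprime a p}" using a by (simp add: coprime_commute)
  qed
  finally show ?thesis by simp
qed

lemma card_classes_1: "card (GAQ_classes 1) = 1"
proof (rule card_classes_eq_length[where Ms = "[trivial_model]" and W = "[]"])
  show "\<exists>M\<in>set [trivial_model]. realizes M G \<psi>" if "group_aut G \<psi>" "order G = 1" for G :: "nat monoid" and \<psi>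
  proof -
    interpret group_aut G \<psi> by fact
    have "card D = 1" using card_displacements_dvd that(2) by simp
    then show ?thesis using realizes_trivial_model by simp
  qed
qed (use trivial_witness[of 1] in simp_all)

lemma card_classes_15: "card (GAQ_classes 15) = 8"
proof -
  have "card (GAQ_classes 15) = card {a::nat. a < 15 \<and> coprime a 15}"
  proof (rule card_classes_cyclic)
    show "int 15 dvd k" if "int 15 dvd k * k" for k :: int
    proof -
      have "3 dvd k * k" "5 dvd k * k"
        using that dvd_trans[of 3 15 "k * k"] dvd_trans[of 5 15 "k * k"] by simp_all
      then have "3 dvd k" "5 dvd k" using prime_dvd_multD[of "3::int" k k] prime_dvd_multD[of "5::int" k k] by simp_all
      then have "15 dvd k" by presburger
      then show ?thesis by simp
    qed
    show "\<exists>a<15. coprime a 15 \<and> realizes (affine_model 15 a) G \<psi>" if "group_aut G \<psi>" "order G = 15"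
      for G :: "nat monoid" and \<psi>
      using group_aut.order_fifteen_generator[OF that] group_aut.realizes_affine_model[OF that(1)] that(2) by auto
  qed simp
  also have "{a::nat. a < 15 \<and> coprime a 15} = set (filter (\<lambda>a. coprime a 15) [0..<15])" by auto
  also have "card \<dots> = 8" by code_simp
  finally show ?thesis .
qed

lemma card_classes_twice_prime:
  assumes "prime p" "odd p"
    and "model (two_model p) \<and> realizable (2 * p) (two_model p)"
    and "\<And>a. a \<in> {2..<p} \<Longrightarrow> model (cyclic_model p a {..<p}) \<and> realizable (2 * p) (cyclic_model p a {..<p})"
    and "distinct (map (solutions (multiplier_tests p))
      (trivial_model # two_model p # map (\<lambda>a. cyclic_model p a {..<p}) [2..<p]))"
  shows "card (GAQ_classes (2 * p)) = p"
proof (rule card_classes_eq_length[OF _ _ assms(5)])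
  let ?Ms = "trivial_model # two_model p # map (\<lambda>a. cyclic_model p a {..<p}) [2..<p]"
  have "p > 2" using assms(1,2) by (metis even_numeral le_neq_implies_less prime_ge_2_nat)
  then show "length ?Ms = p" by simp
  show "model M \<and> realizable (2 * p) M" if "M \<in> set ?Ms" for M
    using that assms(3,4) trivial_witness[of "2 * p"] \<open>p > 2\<close> by auto
  show "\<exists>M\<in>set ?Ms. realizes M G \<psi>" if "group_aut G \<psi>" "order G = 2 * p" for G :: "nat monoid" and \<psi>
    using group_aut.order_twice_prime_cases[OF that(1) assms(1,2) that(2)] by auto
qed

lemma card_classes_6: "card (GAQ_classes 6) = 3"
proof -
  have "{2..<3::nat} = {2}" by auto
  then have "distinct (map (solutions (multiplier_tests 3))
      (trivial_model # two_model 3 # map (\<lambda>a. cyclic_model 3 a {..<3}) [2..<3]))"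
    by code_simp
  moreover have "prime (3::nat)" by simp
  ultimately have "card (GAQ_classes (2 * 3)) = 3"
    using two_model_witness(2) multiplier_witness(1) \<open>{2..<3::nat} = _\<close>
    by (intro card_classes_twice_prime) simp_all
  then show ?thesis by simp
qed

lemma card_classes_10: "card (GAQ_classes 10) = 5"
proof -
  have "{2..<5::nat} = {2, 3, 4}" by auto
  then have "distinct (map (solutions (multiplier_tests 5))
      (trivial_model # two_model 5 # map (\<lambda>a. cyclic_model 5 a {..<5}) [2..<5]))"
    by code_simp
  moreover have "prime (5::nat)" by simp
  ultimately have "card (GAQ_classes (2 * 5)) = 5"
    using two_model_witness(5) multiplier_witness(2) \<open>{2..<5::nat} = _\<close>
    by (intro card_classes_twice_prime) simp_all
  then show ?thesis by simp
qed

lemma card_classes_14: "card (GAQ_classes 14) = 7"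
proof -
  have "{2..<7::nat} = {2, 3, 4, 5, 6}" by auto
  then have "distinct (map (solutions (multiplier_tests 7))
      (trivial_model # two_model 7 # map (\<lambda>a. cyclic_model 7 a {..<7}) [2..<7]))"
    by code_simp
  moreover have "prime (7::nat)" by simp
  ultimately have "card (GAQ_classes (2 * 7)) = 7"
    using two_model_witness(9) multiplier_witness(3) \<open>{2..<7::nat} = _\<close>
    by (intro card_classes_twice_prime) simp_all
  then show ?thesis by simp
qed

lemma card_classes_4: "card (GAQ_classes 4) = 3"
proof (rule card_classes_eq_length[where
    Ms = "[trivial_model, two_model 2, companion_model 2 1 1]" and W = "[([], [])]"])
  show "model M \<and> realizable 4 M" if "M \<in> set [trivial_model, two_model 2, companion_model 2 1 1]" for M
    using that trivial_witness[of 4] two_model_witness(1) klein_witness_four by auto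
  show "distinct (map (solutions [([], [])]) [trivial_model, two_model 2, companion_model 2 1 1])" by code_simp
  show "\<exists>M\<in>set [trivial_model, two_model 2, companion_model 2 1 1]. realizes M G \<psi>"
    if "group_aut G \<psi>" and ord: "order G = 4" for G :: "nat monoid" and \<psi>
  proof -
    interpret group_aut G \<psi> by fact
    have "filter (\<lambda>d. d dvd 4) [1..<Suc 4] = [1, 2, 4::nat]" by code_simp
    then have "card D \<in> {1, 2, 4}" using divisor_cases[OF card_displacements_dvd order_pos] ord by simp
    then consider "card D = 1" | "card D = 2" | "card D = 4" by blast
    then show ?thesis
    proof cases
      case 1 then show ?thesis using realizes_trivial_model by simp
    next
      case 2
      then obtain m where m: "m > 1" "m dvd 2" "realizes (two_model m) G \<psi>" using realizes_two_model ord by auto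
      then have "m = 2" using dvd_imp_le[OF m(2)] by simp
      then show ?thesis using m by simp
    next
      case 3 then show ?thesis using order_four_cases[OF ord] by simp
    qed
  qed
qed simp

definition models_8 :: "triple model list" where
  "models_8 = [trivial_model, two_model 2, two_model 4, cyclic_model 4 3 {..<4},
     companion_model 2 1 1, companion_model 2 1 0, quaternion_model,
     abelian_model 2 2 2 (0,1,0) (0,0,1) (1,1,0) (full 2 2 2),
     abelian_model 2 2 2 (0,1,0) (0,0,1) (1,0,1) (full 2 2 2)]"

lemma card_classes_8: "card (GAQ_classes 8) = 9"
  \<comment> \<open>besides \<open>card D\<close>, count the solutions of \<open>u \<otimes> u = \<one>\<close>, \<open>\<psi> (\<psi> u) = u\<close> and \<open>\<psi> (\<psi> (\<psi> u)) = u \<otimes> \<psi> u\<close>\<close>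
proof (rule card_classes_eq_length[where Ms = models_8
    and W = "[([], []), ([0, 0], []), ([2], [0]), ([3], [0, 1])]"])
  show "model M \<and> realizable 8 M" if "M \<in> set models_8" for M
    using that trivial_witness[of 8] two_model_witness(3,4) order_eight_witness by (auto simp: models_8_def)
  show "distinct (map (solutions [([], []), ([0, 0], []), ([2], [0]), ([3], [0, 1])]) models_8)" by code_simp
  show "\<exists>M\<in>set models_8. realizes M G \<psi>"
    if "group_aut G \<psi>" and ord: "order G = 8" for G :: "nat monoid" and \<psi>
  proof -
    interpret group_aut G \<psi> by fact
    have "filter (\<lambda>d. d dvd 8) [1..<Suc 8] = [1, 2, 4, 8::nat]" by code_simp
    then have "card D \<in> {1, 2, 4, 8}" using divisor_cases[OF card_displacements_dvd order_pos] ord by simp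
    then consider "card D = 1" | "card D = 2" | "card D = 4" | "card D = 8" by blast
    then show ?thesis
    proof cases
      case 1 then show ?thesis using realizes_trivial_model by (simp add: models_8_def)
    next
      case 2
      then obtain m where m: "m > 1" "m dvd 4" "realizes (two_model m) G \<psi>" using realizes_two_model ord by auto
      have "filter (\<lambda>d. d dvd 4) [1..<Suc 4] = [1, 2, 4::nat]" by code_simp
      then have "m \<in> {2, 4}" using divisor_cases[OF m(2)] m(1) by simp
      then show ?thesis using m by (auto simp: models_8_def)
    next
      case 3 then show ?thesis using order_eight_four_displacements[OF ord] by (auto simp: models_8_def)
    next
      case 4 then show ?thesis using order_eight_fixed_point_free[OF ord] by (auto simp: models_8_def)
    qed
  qed
qed (simp add: models_8_def)

definition models_9 :: "triple model list" where
  "models_9 = [trivial_model, cyclic_model 3 1 {..<3}, cyclic_model 3 2 {..<3},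
     affine_model 9 2, affine_model 9 5, affine_model 9 8,
     companion_model 3 1 1, companion_model 3 1 2, companion_model 3 2 0, companion_model 3 2 1,
     abelian_model 3 3 1 (2,0,0) (0,2,0) (0,0,0) (full 3 3 1)]"

lemma card_classes_9: "card (GAQ_classes 9) = 11"
  \<comment> \<open>the tests with \<open>[1]\<close> read off the multiplier of a cyclic group, those with \<open>[2]\<close> the
    characteristic polynomial of a matrix\<close>
proof (rule card_classes_eq_length[where Ms = models_9
    and W = "[([], []), ([0, 0, 0], []), ([1], [0]), ([1], [0, 0]), ([1], [0, 0, 0, 0, 0]),
      ([2], [0, 1]), ([2], [0, 1, 1]), ([2], [0, 0])]"])
  have coprime: "coprime 2 (9::nat)" "coprime 5 (9::nat)" "coprime 8 (9::nat)" by code_simp+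
  show "model M \<and> realizable 9 M" if "M \<in> set models_9" for M
    using that trivial_witness[of 9] order_nine_witness(1,2,4) order_nine_witness(3)[of "(1, 1)"]
      order_nine_witness(3)[of "(1, 2)"] order_nine_witness(3)[of "(2, 0)"] order_nine_witness(3)[of "(2, 1)"]
      affine_model_realizable[OF coprime(1)] affine_model_realizable[OF coprime(2)]
      affine_model_realizable[OF coprime(3)] by (auto simp: models_9_def)
  show "distinct (map (solutions [([], []), ([0, 0, 0], []), ([1], [0]), ([1], [0, 0]), ([1], [0, 0, 0, 0, 0]),
      ([2], [0, 1]), ([2], [0, 1, 1]), ([2], [0, 0])]) models_9)" by code_simp
  show "\<exists>M\<in>set models_9. realizes M G \<psi>"
    if "group_aut G \<psi>" and ord: "order G = 9" for G :: "nat monoid" and \<psi>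
  proof -
    interpret group_aut G \<psi> by fact
    have "card D dvd 9" using card_displacements_dvd ord by simp
    then consider "card D = 1" | "card D = 3" | "card D = 9" using dvd_nine by blast
    then show ?thesis
    proof cases
      case 1 then show ?thesis using realizes_trivial_model by (simp add: models_9_def)
    next
      case 2 then show ?thesis using order_nine_three_displacements[OF ord] by (auto simp: models_9_def)
    next
      case 3 then show ?thesis using order_nine_fixed_point_free[OF ord] by (auto simp: models_9_def)
    qed
  qed
qed (simp add: models_9_def)

definition models_12 :: "triple model list" where
  "models_12 = [trivial_model, two_model 2, two_model 3, two_model 6, cyclic_model 3 2 {..<3},
     klein_base_model, companion_model 2 1 1, cyclic_model 6 5 {..<6},
     alternating_model 0, alternating_model 1,
     abelian_model 2 2 3 (0,1,0) (1,1,0) (0,0,2) (full 2 2 3)]"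

lemma card_classes_12: "card (GAQ_classes 12) = 11"
  \<comment> \<open>besides \<open>card D\<close>, count the solutions of \<open>u \<otimes> u = \<one>\<close>, \<open>u \<otimes> u \<otimes> u = \<one>\<close>, \<open>\<psi> u = u\<close> and
    \<open>\<psi> (\<psi> u) = u\<close>\<close>
proof (rule card_classes_eq_length[where Ms = models_12
    and W = "[([], []), ([0, 0], []), ([0, 0, 0], []), ([1], [0]), ([2], [0])]"])
  show "model M \<and> realizable 12 M" if "M \<in> set models_12" for M
    using that trivial_witness[of 12] two_model_witness(6,7,8) order_twelve_witness by (auto simp: models_12_def)
  show "distinct (map (solutions [([], []), ([0, 0], []), ([0, 0, 0], []), ([1], [0]), ([2], [0])]) models_12)"
    by code_simp
  show "\<exists>M\<in>set models_12. realizes M G \<psi>"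
    if "group_aut G \<psi>" and ord: "order G = 12" for G :: "nat monoid" and \<psi>
  proof -
    interpret group_aut G \<psi> by fact
    have "filter (\<lambda>d. d dvd 12) [1..<Suc 12] = [1, 2, 3, 4, 6, 12::nat]" by code_simp
    then have "card D \<in> {1, 2, 3, 4, 6, 12}"
      using divisor_cases[OF card_displacements_dvd order_pos] ord by simp
    then consider "card D = 1" | "card D = 2" | "card D = 3" | "card D = 4" | "card D = 6" | "card D = 12" by blast
    then show ?thesis
    proof cases
      case 1 then show ?thesis using realizes_trivial_model by (simp add: models_12_def)
    next
      case 2
      then obtain m where m: "m > 1" "m dvd 6" "realizes (two_model m) G \<psi>" using realizes_two_model ord by auto
      have "filter (\<lambda>d. d dvd 6) [1..<Suc 6] = [1, 2, 3, 6::nat]" by code_simp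
      then have "m \<in> {2, 3, 6}" using divisor_cases[OF m(2)] m(1) by simp
      then show ?thesis using m by (auto simp: models_12_def)
    next
      case 3
      then show ?thesis
        using order_twelve_three_displacements[OF ord] by (auto simp: models_12_def klein_base_model_def)
    next
      case 4 then show ?thesis using order_twelve_four_displacements[OF ord] by (simp add: models_12_def)
    next
      case 5 then show ?thesis using order_twelve_six_displacements[OF ord] by (auto simp: models_12_def)
    next
      case 6 then show ?thesis using order_twelve_fixed_point_free[OF ord] by (simp add: models_12_def)
    qed
  qed
qed (simp add: models_12_def)

theorem theorem1p8:
  shows "map (\<lambda>n. card (GAQ_classes n)) [1, 2, 3, 4, 5, 6, 7, 8, 9, 10, 11, 12, 13, 14, 15] =
                                        [1, 1, 2, 3, 4, 3, 6, 9, 11, 5, 10, 11, 12, 7, 8]"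
  using card_classes_1 card_classes_prime[of 2] card_classes_prime[of 3] card_classes_prime[of 5]
    card_classes_prime[of 7] card_classes_prime[of 11] card_classes_prime[of 13] card_classes_4 card_classes_6 card_classes_8 card_classes_9
    card_classes_10 card_classes_12 card_classes_14 card_classes_15 by simp

end
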